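(* Let $(\mathcal M,d)$ be a compact geodesic Ahlfors-regular metric space of dimension $r>0$, and take $\mathcal Q=\mathcal A=\mathcal M$. Fix $\theta_0>0$, $x_0\ge1$, and $\kappa>0$. After a context $q$ is disclosed, sensor calibration $a$ produces independent counts \[ Y_i\sim\operatorname{Poisson}\{\theta/x(q,a)\},\qquad x(q,a)=x_0+\kappa\,d(q,a)^2 . \] Let $\psi(\theta)$ be twice continuously differentiable near $\theta_0$, with $b=\dot\psi(\theta_0)\ne0$. Then \[ A_k=b^2\theta_0\kappa\,\rho_k(\mathcal M)^2\asymp k^{-2/r}. \] For every $k_n\to\infty$ and every $H_n$ satisfying \[ H_n\to\infty,\qquad \frac{H_n^{11}}{\sqrt n}\to0,\qquad H_n^{10}A_{k_n}\to0, \] one has $F_{n,k_n}(H_n)=A_{k_n}\{1+o(1)\}$. Consequently, the excess mean squared error for estimating $\psi(\theta)$ on the original scale, $n^{-1}F_{n,k_n}(H_n)$, is of order $n^{-1}k_n^{-2/r}$.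
   Context: Covering radius: $\rho_k(\mathcal M)=\inf_{V\subset\mathcal M,\,1\le|V|\le k}\sup_{s\in\mathcal M}\min_{z\in V}d(s,z)$. Ahlfors regular of dimension $r$: there are a Borel measure $\mu$ on $\mathcal M$ and constants $0<c\le C$ with $cR^r\le\mu\{B(s,R)\}\le CR^r$ for all $s$ and all small $R>0$. The one-observation inverse Fisher information at $\theta_0$ is $v(q,a)=\theta_0x(q,a)$, with oracle value $v_\star(q)=\theta_0x_0$ (attained at $a=q$). For a menu $V$ (nonempty finite subset of $\mathcal M$), $v_V(q)=\min_{a\in V}v(q,a)$. The frontier is $A_k=\inf_{1\le|V|\le k}\sup_{q\in\mathcal Q}b^2\{v_V(q)-v_\star(q)\}$. Put $\psi_n(h)=\sqrt n\{\psi(\theta_0+h/\sqrt n)-\psi(\theta_0)\}$ and, for $v=\theta_0x$, let $\mathcal R^\psi_{n,H}(v)=\inf_T\sup_{|h|\le H}\mathbb E\{T-\psi_n(h)\}^2$ be the minimax risk based on $n$ independent $\operatorname{Poisson}\{(\theta_0+h/\sqrt n)/x\}$ observations. Then $F_{n,k}(H)=\inf_{1\le|V|\le k}\sup_{q\in\mathcal Q}\{\mathcal R^\psi_{n,H}(v_V(q))-\mathcal R^\psi_{n,H}(v_\star(q))\}$. If $T$ estimates $\psi_n(h)$, then $\psi(\theta_0)+T/\sqrt n$ estimates $\psi(\theta)$ on the original scale with mean squared error $n^{-1}$ times the local risk. *)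

theory Defs
  imports "HOL-Probability.Probability"
begin

text \<open>The metric space is a subset \<open>M\<close> of a type of class \<^class>\<open>metric_space\<close>, with the
  restriction of \<^const>\<open>dist\<close> as its metric.\<close>

definition geodesic_space :: "'a::metric_space set \<Rightarrow> bool" where
  "geodesic_space M \<longleftrightarrow>
     (\<forall>x\<in>M. \<forall>y\<in>M. \<exists>\<gamma> :: real \<Rightarrow> 'a.
        \<gamma> 0 = x \<and> \<gamma> (dist x y) = y \<and> \<gamma> ` {0..dist x y} \<subseteq> M \<and>
        (\<forall>s\<in>{0..dist x y}. \<forall>t\<in>{0..dist x y}. dist (\<gamma> s) (\<gamma> t) = \<bar>s - t\<bar>))"

definition ahlfors_regular :: "'a::metric_space set \<Rightarrow> real \<Rightarrow> bool" where
  "ahlfors_regular M r \<longleftrightarrow>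
     (\<exists>\<mu> :: 'a measure. sets \<mu> = sets (restrict_space borel M) \<and>
       (\<exists>c C R\<^sub>0 :: real. 0 < c \<and> c \<le> C \<and> 0 < R\<^sub>0 \<and>
          (\<forall>s\<in>M. \<forall>R. 0 < R \<and> R < R\<^sub>0 \<longrightarrow>
             ennreal (c * R powr r) \<le> emeasure \<mu> (ball s R \<inter> M) \<and>
             emeasure \<mu> (ball s R \<inter> M) \<le> ennreal (C * R powr r))))"

text \<open>The bound \<open>1 \<le> card V\<close> makes \<open>V\<close> finite and nonempty, as \<^const>\<open>card\<close> is \<open>0\<close> on infinite
  sets.\<close>

definition menus :: "'a set \<Rightarrow> nat \<Rightarrow> 'a set set" where
  "menus M k = {V. V \<subseteq> M \<and> 1 \<le> card V \<and> card V \<le> k}"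

definition covering_radius :: "'a::metric_space set \<Rightarrow> nat \<Rightarrow> real" where
  "covering_radius M k = (INF V\<in>menus M k. SUP s\<in>M. Min ((\<lambda>z. dist s z) ` V))"

definition calib_scale :: "real \<Rightarrow> real \<Rightarrow> 'a::metric_space \<Rightarrow> 'a \<Rightarrow> real" where
  "calib_scale x\<^sub>0 \<kappa> q a = x\<^sub>0 + \<kappa> * (dist q a)\<^sup>2"

text \<open>One Poisson count with mean \<open>\<theta> / x\<close> has Fisher information \<open>1 / (\<theta> * x)\<close> about \<open>\<theta>\<close>.\<close>

definition inv_fisher :: "real \<Rightarrow> real \<Rightarrow> real \<Rightarrow> 'a::metric_space \<Rightarrow> 'a \<Rightarrow> real" where
  "inv_fisher \<theta>\<^sub>0 x\<^sub>0 \<kappa> q a = \<theta>\<^sub>0 * calib_scale x\<^sub>0 \<kappa> q a"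

definition oracle_value :: "real \<Rightarrow> real \<Rightarrow> real" where
  "oracle_value \<theta>\<^sub>0 x\<^sub>0 = \<theta>\<^sub>0 * x\<^sub>0"

definition menu_value :: "real \<Rightarrow> real \<Rightarrow> real \<Rightarrow> 'a::metric_space set \<Rightarrow> 'a \<Rightarrow> real" where
  "menu_value \<theta>\<^sub>0 x\<^sub>0 \<kappa> V q = Min ((\<lambda>a. inv_fisher \<theta>\<^sub>0 x\<^sub>0 \<kappa> q a) ` V)"

definition frontier_A ::
  "'a::metric_space set \<Rightarrow> real \<Rightarrow> real \<Rightarrow> real \<Rightarrow> real \<Rightarrow> nat \<Rightarrow> real" where
  "frontier_A M \<theta>\<^sub>0 x\<^sub>0 \<kappa> b k =
     (INF V\<in>menus M k. SUP q\<in>M. b\<^sup>2 * (menu_value \<theta>\<^sub>0 x\<^sub>0 \<kappa> V q - oracle_value \<theta>\<^sub>0 x\<^sub>0))"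

definition C2_near :: "(real \<Rightarrow> real) \<Rightarrow> real \<Rightarrow> bool" where
  "C2_near \<psi> t \<longleftrightarrow>
     (\<exists>U. open U \<and> t \<in> U \<and> \<psi> differentiable_on U \<and> deriv \<psi> differentiable_on U \<and>
          continuous_on U (deriv (deriv \<psi>)))"

text \<open>Joint law of \<open>n\<close> independent counts with mean \<open>\<theta> / x\<close>. It is discrete, so an estimator is an
  arbitrary real function of the counts. \<^const>\<open>poisson_pmf\<close> is specified for positive means
  only.\<close>

definition poisson_sample :: "nat \<Rightarrow> real \<Rightarrow> real \<Rightarrow> (nat \<Rightarrow> nat) pmf" where
  "poisson_sample n \<theta> x = Pi_pmf {..<n} 0 (\<lambda>_. poisson_pmf (\<theta> / x))"

definition local_psi :: "(real \<Rightarrow> real) \<Rightarrow> real \<Rightarrow> nat \<Rightarrow> real \<Rightarrow> real" where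
  "local_psi \<psi> \<theta>\<^sub>0 n h = sqrt n * (\<psi> (\<theta>\<^sub>0 + h / sqrt n) - \<psi> \<theta>\<^sub>0)"

text \<open>Risks are indexed by the inverse information \<open>v = \<theta>\<^sub>0 * x\<close>, so \<open>x\<close> is recovered as \<open>v / \<theta>\<^sub>0\<close>.
  They take values in \<^typ>\<open>ennreal\<close>, and the excesses below in \<^typ>\<open>ereal\<close>, so that an estimator
  with infinite mean squared error has risk \<open>\<infinity>\<close>.\<close>

definition local_risk ::
  "(real \<Rightarrow> real) \<Rightarrow> real \<Rightarrow> nat \<Rightarrow> real \<Rightarrow> real \<Rightarrow> ennreal" where
  "local_risk \<psi> \<theta>\<^sub>0 n H v =
     (INF T :: (nat \<Rightarrow> nat) \<Rightarrow> real. SUP h\<in>{h. \<bar>h\<bar> \<le> H}.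
        \<integral>\<^sup>+ y. ennreal ((T y - local_psi \<psi> \<theta>\<^sub>0 n h)\<^sup>2)
          \<partial>measure_pmf (poisson_sample n (\<theta>\<^sub>0 + h / sqrt n) (v / \<theta>\<^sub>0)))"

definition frontier_F ::
  "'a::metric_space set \<Rightarrow> (real \<Rightarrow> real) \<Rightarrow> real \<Rightarrow> real \<Rightarrow> real \<Rightarrow> nat \<Rightarrow> nat \<Rightarrow> real \<Rightarrow> ereal" where
  "frontier_F M \<psi> \<theta>\<^sub>0 x\<^sub>0 \<kappa> n k H =
     (INF V\<in>menus M k. SUP q\<in>M.
        enn2ereal (local_risk \<psi> \<theta>\<^sub>0 n H (menu_value \<theta>\<^sub>0 x\<^sub>0 \<kappa> V q)) -
        enn2ereal (local_risk \<psi> \<theta>\<^sub>0 n H (oracle_value \<theta>\<^sub>0 x\<^sub>0)))"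

text \<open>The same excess for estimating \<open>\<psi> \<theta>\<close> itself, over the parameter range
  \<open>\<theta> = \<theta>\<^sub>0 + h / sqrt n\<close>, \<open>\<bar>h\<bar> \<le> H\<close>.\<close>

definition orig_risk ::
  "(real \<Rightarrow> real) \<Rightarrow> real \<Rightarrow> nat \<Rightarrow> real \<Rightarrow> real \<Rightarrow> ennreal" where
  "orig_risk \<psi> \<theta>\<^sub>0 n H v =
     (INF S :: (nat \<Rightarrow> nat) \<Rightarrow> real. SUP \<theta>\<in>{\<theta>. \<bar>\<theta> - \<theta>\<^sub>0\<bar> \<le> H / sqrt n}.
        \<integral>\<^sup>+ y. ennreal ((S y - \<psi> \<theta>)\<^sup>2) \<partial>measure_pmf (poisson_sample n \<theta> (v / \<theta>\<^sub>0)))"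

definition orig_excess ::
  "'a::metric_space set \<Rightarrow> (real \<Rightarrow> real) \<Rightarrow> real \<Rightarrow> real \<Rightarrow> real \<Rightarrow> nat \<Rightarrow> nat \<Rightarrow> real \<Rightarrow> ereal" where
  "orig_excess M \<psi> \<theta>\<^sub>0 x\<^sub>0 \<kappa> n k H =
     (INF V\<in>menus M k. SUP q\<in>M.
        enn2ereal (orig_risk \<psi> \<theta>\<^sub>0 n H (menu_value \<theta>\<^sub>0 x\<^sub>0 \<kappa> V q)) -
        enn2ereal (orig_risk \<psi> \<theta>\<^sub>0 n H (oracle_value \<theta>\<^sub>0 x\<^sub>0)))"

end

theory Submission
  imports Defs
begin

text \<open>The total of the counts is sufficient, so the risk at scale \<open>x\<close> is the minimax risk \<open>R t\<close> of
  one Poisson count with mean \<open>\<theta> * t\<close>, \<open>t = n / x\<close>, over an interval of half-width \<open>H / sqrt n\<close>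
  about \<open>\<theta>\<^sub>0\<close>. The excess between two nearby exposures \<open>t' < t\<close> is controlled to first order by
  comparing estimators directly. Correcting an estimator at \<open>t'\<close> by the additional count gives
  a decrease of at least \<open>(1 - o(1)) b\<^sup>2 (x' - x) \<theta>\<^sub>0 / n\<close>, once \<open>R\<close> is known to be asymptotically at
  least \<open>b\<^sup>2 \<theta>\<^sub>0 / t\<close>, by Cramer--Rao and the mean value theorem. Conversely, dilating an estimator
  at \<open>t\<close> about the right end of the parameter interval shows that \<open>t * R t\<close> is nondecreasing
  in \<open>t\<close> up to a small error, so the increase is at most the one of \<open>b\<^sup>2 \<theta>\<^sub>0 / t\<close>. As the risk is
  monotone in \<open>x\<close>, the frontier is governed by the covering radius, which is of order
  \<open>k powr (- 1 / r)\<close> by packing and covering.\<close>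

section \<open>Poisson expectations\<close>

text \<open>The obstacle is that k grows at an arbitrary speed, so the excess may be far smaller
  than the error of any expansion of a single minimax risk, and subtracting two expansions would say
  nothing. Every error term must therefore carry a factor that vanishes with
  \<open>x - x\<^sub>0\<close>. In a Gaussian shift model of variance 1 / t the monotonicity of
  \<open>t * R t\<close> is exact: rescaling observation and parameter turns it into the growth of
  the minimax risk with the length of the interval. The Poisson family has no such rescaling, so the
  dilation is carried out in infinitesimal steps along ln t; its cost of second order in the step,
  however large for large exposures, disappears as the number of steps tends to infinity. In the
  other direction the weight of the additional count is \<open>z = (x - x\<^sub>0) / x\<close>. The
  gain is about 2 z n R and the price about
  \<open>z * b\<^sup>2 * \<theta>\<^sub>0 * x\<^sub>0\<close>, so a one-sided bound, n R at least
  about \<open>b\<^sup>2 * \<theta>\<^sub>0 * x\<^sub>0\<close>, already leaves the right multiple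
  of z.\<close>

abbreviation pois_exp :: "real \<Rightarrow> (nat \<Rightarrow> real) \<Rightarrow> real" where
  "pois_exp l f \<equiv> measure_pmf.expectation (poisson_pmf l) f"

lemma integrable_bounded_pmf:
  fixes f :: "'a \<Rightarrow> real"
  assumes "\<And>x. \<bar>f x\<bar> \<le> B"
  shows "integrable (measure_pmf p) f"
  by (rule measure_pmf.integrable_const_bound[where B = B]) (use assms in auto)

lemma expectation_le_bound:
  fixes f :: "'a \<Rightarrow> real"
  assumes "integrable (measure_pmf p) f" and "\<And>x. f x \<le> B"
  shows "measure_pmf.expectation p f \<le> B"
  using integral_mono[of "measure_pmf p" f "\<lambda>_. B"] assms by simp

lemma abs_expectation_le:
  fixes f :: "'a \<Rightarrow> real"
  assumes "\<And>x. \<bar>f x\<bar> \<le> B"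
  shows "\<bar>measure_pmf.expectation p f\<bar> \<le> B"
proof -
  have i: "integrable (measure_pmf p) f" by (rule integrable_bounded_pmf[OF assms])
  have "measure_pmf.expectation p f \<le> B"
    by (rule expectation_le_bound[OF i]) (use assms abs_le_iff in blast)
  moreover have "measure_pmf.expectation p (\<lambda>x. - f x) \<le> B"
    by (rule expectation_le_bound) (use i assms abs_le_iff in \<open>auto\<close>)
  ultimately show ?thesis by simp
qed

lemma poisson_expectation_sums:
  assumes "l > 0" and "integrable (measure_pmf (poisson_pmf l)) f"
  shows "(\<lambda>n. pmf (poisson_pmf l) n * f n) sums pois_exp l f"
proof -
  have "integrable (count_space UNIV) (\<lambda>n. pmf (poisson_pmf l) n * f n)"
    using assms(2) unfolding measure_pmf_eq_density
    by (subst (asm) integrable_density) auto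
  from sums_integral_count_space_nat[OF this] show ?thesis
    unfolding measure_pmf_eq_density by (subst integral_density) auto
qed

text \<open>The weights satisfy (k + 1) p(k + 1) = l p(k), and the term k = 0 drops out on the left.
  In \<open>ennreal\<close> the identity needs no integrability, so it can be used to prove
  it.\<close>

lemma poisson_nn_size_bias:
  assumes "l > 0"
  shows "(\<integral>\<^sup>+k. of_nat k * f k \<partial>measure_pmf (poisson_pmf l)) =
    ennreal l * (\<integral>\<^sup>+k. f (Suc k) \<partial>measure_pmf (poisson_pmf l))"
proof -
  let ?p = "\<lambda>k. ennreal (pmf (poisson_pmf l) k)"
  have eq: "?p (Suc k) * (of_nat (Suc k) * f (Suc k)) = ennreal l * (?p k * f (Suc k))" for k
  proof -
    have "?p (Suc k) * of_nat (Suc k) = ennreal (pmf (poisson_pmf l) (Suc k) * real (Suc k))"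
      by (simp add: ennreal_mult' ennreal_of_nat_eq_real_of_nat del: of_nat_Suc)
    also have "pmf (poisson_pmf l) (Suc k) * real (Suc k) = l * pmf (poisson_pmf l) k"
      using assms by (simp add: field_simps del: of_nat_Suc)
    also have "ennreal \<dots> = ennreal l * ?p k"
      using assms by (intro ennreal_mult) auto
    finally show ?thesis by (simp add: mult.assoc[symmetric])
  qed
  have "(\<integral>\<^sup>+k. of_nat k * f k \<partial>measure_pmf (poisson_pmf l)) = (\<Sum>k. ?p k * (of_nat k * f k))"
    by (simp add: nn_integral_measure_pmf nn_integral_count_space_nat)
  also have "\<dots> = (\<Sum>k. ?p (Suc k) * (of_nat (Suc k) * f (Suc k)))"
  proof (rule sums_unique[symmetric])
    have "(\<lambda>k. ?p (Suc k) * (of_nat (Suc k) * f (Suc k))) sums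
        (\<Sum>k. ?p (Suc k) * (of_nat (Suc k) * f (Suc k)))"
      by (rule summable_sums) (rule summableI)
    from sums_Suc[of "\<lambda>k. ?p k * (of_nat k * f k)", OF this]
    show "(\<lambda>k. ?p k * (of_nat k * f k)) sums (\<Sum>k. ?p (Suc k) * (of_nat (Suc k) * f (Suc k)))"
      by simp
  qed
  also have "\<dots> = (\<Sum>k. ennreal l * (?p k * f (Suc k)))" by (simp only: eq)
  also have "\<dots> = ennreal l * (\<Sum>k. ?p k * f (Suc k))" by (rule ennreal_suminf_cmult)
  also have "\<dots> = ennreal l * (\<integral>\<^sup>+k. f (Suc k) \<partial>measure_pmf (poisson_pmf l))"
    by (simp add: nn_integral_measure_pmf nn_integral_count_space_nat)
  finally show ?thesis .
qed

text \<open>The Stein-Chen identity. It yields the moments, the covariance with the score in the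
  Cramer-Rao bound, and the mean of the death part of the generator \<open>G\<close>.\<close>

lemma poisson_size_bias:
  fixes f :: "nat \<Rightarrow> real"
  assumes "l > 0" and int: "integrable (measure_pmf (poisson_pmf l)) (\<lambda>k. f (Suc k))"
  shows integrable_poisson_size_bias: "integrable (measure_pmf (poisson_pmf l)) (\<lambda>k. real k * f k)"
    and expectation_poisson_size_bias: "pois_exp l (\<lambda>k. real k * f k) = l * pois_exp l (\<lambda>k. f (Suc k))"
proof -
  have "(\<integral>\<^sup>+k. ennreal (norm (real k * f k)) \<partial>measure_pmf (poisson_pmf l)) =
     (\<integral>\<^sup>+k. of_nat k * ennreal (norm (f k)) \<partial>measure_pmf (poisson_pmf l))"
    by (simp add: abs_mult ennreal_mult' ennreal_of_nat_eq_real_of_nat)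
  also have "\<dots> = ennreal l * (\<integral>\<^sup>+k. ennreal (norm (f (Suc k))) \<partial>measure_pmf (poisson_pmf l))"
    by (rule poisson_nn_size_bias[OF assms(1)])
  also have "\<dots> < \<infinity>"
    using int unfolding integrable_iff_bounded by (simp add: ennreal_mult_less_top)
  finally show i: "integrable (measure_pmf (poisson_pmf l)) (\<lambda>k. real k * f k)"
    unfolding integrable_iff_bounded by simp
  have "(\<lambda>k. l * (pmf (poisson_pmf l) k * f (Suc k))) sums (l * pois_exp l (\<lambda>k. f (Suc k)))"
    by (intro sums_mult poisson_expectation_sums assms)
  also have "(\<lambda>k. l * (pmf (poisson_pmf l) k * f (Suc k))) =
      (\<lambda>k. pmf (poisson_pmf l) (Suc k) * (real (Suc k) * f (Suc k)))"
    using assms(1) by (simp add: field_simps fun_eq_iff del: of_nat_Suc)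
  finally have "(\<lambda>k. pmf (poisson_pmf l) k * (real k * f k)) sums (l * pois_exp l (\<lambda>k. f (Suc k)))"
    using sums_Suc[of "\<lambda>k. pmf (poisson_pmf l) k * (real k * f k)"] by simp
  with poisson_expectation_sums[OF assms(1) i]
  show "pois_exp l (\<lambda>k. real k * f k) = l * pois_exp l (\<lambda>k. f (Suc k))"
    by (rule sums_unique2)
qed

lemma poisson_moments:
  assumes "l > 0"
  shows integrable_poisson_id: "integrable (measure_pmf (poisson_pmf l)) real"
    and integrable_poisson_square: "integrable (measure_pmf (poisson_pmf l)) (\<lambda>k. (real k)\<^sup>2)"
    and expectation_poisson: "pois_exp l real = l"
    and expectation_poisson_square: "pois_exp l (\<lambda>k. (real k)\<^sup>2) = l\<^sup>2 + l"
proof -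
  show 1: "integrable (measure_pmf (poisson_pmf l)) real"
    using integrable_poisson_size_bias[OF assms, of "\<lambda>_. 1"] by simp
  show 2: "pois_exp l real = l"
    using expectation_poisson_size_bias[OF assms, of "\<lambda>_. 1"] by simp
  show "integrable (measure_pmf (poisson_pmf l)) (\<lambda>k. (real k)\<^sup>2)"
    using integrable_poisson_size_bias[OF assms, of real] 1 by (simp add: power2_eq_square)
  show "pois_exp l (\<lambda>k. (real k)\<^sup>2) = l\<^sup>2 + l"
    using expectation_poisson_size_bias[OF assms, of real] 1 2
    by (simp add: power2_eq_square algebra_simps)
qed

lemma expectation_poisson_affine_square:
  assumes "l > 0"
  shows "integrable (measure_pmf (poisson_pmf l)) (\<lambda>k. (a + c * (real k - l))\<^sup>2)"
    and "pois_exp l (\<lambda>k. (a + c * (real k - l))\<^sup>2) = a\<^sup>2 + c\<^sup>2 * l"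
proof -
  have eq: "(\<lambda>k. (a + c * (real k - l))\<^sup>2) =
      (\<lambda>k. (a - c * l)\<^sup>2 + (2 * c * (a - c * l)) * real k + c\<^sup>2 * (real k)\<^sup>2)"
    by (auto simp: fun_eq_iff power2_eq_square algebra_simps)
  note i = integrable_poisson_id[OF assms] integrable_poisson_square[OF assms]
  show "integrable (measure_pmf (poisson_pmf l)) (\<lambda>k. (a + c * (real k - l))\<^sup>2)"
    unfolding eq using i by auto
  show "pois_exp l (\<lambda>k. (a + c * (real k - l))\<^sup>2) = a\<^sup>2 + c\<^sup>2 * l"
    unfolding eq using i expectation_poisson[OF assms] expectation_poisson_square[OF assms]
    by (simp add: power2_eq_square algebra_simps)
qed

text \<open>Times exp l, the expectation is the power series with coefficients f n / n!. Its formal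
  derivative shifts f by one, and differentiating the factor exp (- l) subtracts the unshifted
  expectation.\<close>

lemma expectation_poisson_has_derivative:
  assumes "l > 0" and B: "\<And>k. \<bar>f k\<bar> \<le> B"
  shows "((\<lambda>l. pois_exp l f) has_real_derivative pois_exp l (\<lambda>k. f (Suc k) - f k)) (at l)"
proof -
  have i: "integrable (measure_pmf p) f" and i': "integrable (measure_pmf p) (\<lambda>k. f (Suc k))" for p
    by (rule integrable_bounded_pmf[OF B])+
  define c where "c = (\<lambda>n. f n / fact n)"
  have s0: "(\<lambda>n. c n * l ^ n) sums (exp l * pois_exp l f)" if "l > 0" for l
  proof -
    have "(\<lambda>n. exp l * (pmf (poisson_pmf l) n * f n)) sums (exp l * pois_exp l f)"
      by (intro sums_mult poisson_expectation_sums that i)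
    also have "(\<lambda>n. exp l * (pmf (poisson_pmf l) n * f n)) = (\<lambda>n. c n * l ^ n)"
      using that by (simp add: c_def fun_eq_iff exp_minus)
    finally show ?thesis .
  qed
  have s1: "(\<lambda>n. diffs c n * l ^ n) sums (exp l * pois_exp l (\<lambda>k. f (Suc k)))" if "l > 0" for l
  proof -
    have "(\<lambda>n. exp l * (pmf (poisson_pmf l) n * f (Suc n))) sums (exp l * pois_exp l (\<lambda>k. f (Suc k)))"
      by (intro sums_mult poisson_expectation_sums that i')
    also have "(\<lambda>n. exp l * (pmf (poisson_pmf l) n * f (Suc n))) = (\<lambda>n. diffs c n * l ^ n)"
      using that by (simp add: c_def diffs_def fun_eq_iff exp_minus field_simps del: of_nat_Suc)
    finally show ?thesis .
  qed
  \<comment> \<open>Convergence is known at positive arguments only; the one at |y| + 1 dominates y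
    of either sign.\<close>
  have "summable (\<lambda>n. c n * y ^ n)" for y
    by (rule powser_inside[OF sums_summable[OF s0[of "\<bar>y\<bar> + 1"]]]) auto
  then have "((\<lambda>x. \<Sum>n. c n * x ^ n) has_real_derivative (\<Sum>n. diffs c n * l ^ n)) (at l)"
    by (intro termdiffs_strong_converges_everywhere)
  moreover have "((\<lambda>x. exp (- x :: real)) has_real_derivative - exp (- l)) (at l)"
    by (auto intro!: derivative_eq_intros)
  ultimately have "((\<lambda>x. exp (- x) * (\<Sum>n. c n * x ^ n)) has_real_derivative
     - exp (- l) * (\<Sum>n. c n * l ^ n) + (\<Sum>n. diffs c n * l ^ n) * exp (- l)) (at l)"
    using DERIV_mult by blast
  also have "- exp (- l) * (\<Sum>n. c n * l ^ n) + (\<Sum>n. diffs c n * l ^ n) * exp (- l) =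
      pois_exp l (\<lambda>k. f (Suc k)) - pois_exp l f"
    unfolding sums_unique[OF s0[OF assms(1)], symmetric] sums_unique[OF s1[OF assms(1)], symmetric]
    by (simp add: exp_minus field_simps)
  finally have "((\<lambda>x. exp (- x) * (\<Sum>n. c n * x ^ n)) has_real_derivative
      pois_exp l (\<lambda>k. f (Suc k)) - pois_exp l f) (at l)" .
  moreover have "eventually (\<lambda>x. exp (- x) * (\<Sum>n. c n * x ^ n) = pois_exp x f) (nhds l)"
    using eventually_nhds_in_open[of "{0<..}" l] assms(1)
    by (auto elim!: eventually_mono simp: sums_unique[OF s0, symmetric] exp_minus)
  ultimately have "((\<lambda>l. pois_exp l f) has_real_derivative
      pois_exp l (\<lambda>k. f (Suc k)) - pois_exp l f) (at l)"
    by (simp add: DERIV_cong_ev[OF refl _ refl])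
  then show ?thesis using i i' by simp
qed

lemma expectation_poisson_lipschitz:
  assumes "l > 0" "m > 0" and B: "\<And>k. \<bar>f k\<bar> \<le> B"
  shows "\<bar>pois_exp m f - pois_exp l f\<bar> \<le> 2 * B * \<bar>m - l\<bar>"
proof -
  have d: "((\<lambda>l. pois_exp l f) has_real_derivative pois_exp x (\<lambda>k. f (Suc k) - f k)) (at x)"
    if "x > 0" for x by (rule expectation_poisson_has_derivative[OF that B])
  have bd: "\<bar>pois_exp x (\<lambda>k. f (Suc k) - f k)\<bar> \<le> 2 * B" for x
  proof (rule abs_expectation_le)
    fix k show "\<bar>f (Suc k) - f k\<bar> \<le> 2 * B" using B[of k] B[of "Suc k"] by linarith
  qed
  have "norm (pois_exp m f - pois_exp l f) \<le> 2 * B * norm (m - l)"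
  proof (rule field_differentiable_bound[of "{0<..}"])
    show "((\<lambda>l. pois_exp l f) has_field_derivative pois_exp x (\<lambda>k. f (Suc k) - f k)) (at x within {0<..})"
      if "x \<in> {0<..}" for x using d that by (auto intro: has_field_derivative_at_within)
  qed (use bd assms in auto)
  then show ?thesis by simp
qed

text \<open>Mean value inequality for the expectation minus its tangent at l: the derivative is
  again a Poisson expectation, of a function bounded by 2 B, hence Lipschitz with constant 4 B. The
  constant only affects terms of second order in \<epsilon> in
  \<open>achievable_less_data\<close>.\<close>

lemma expectation_poisson_taylor:
  assumes "l > 0" "m > 0" and B: "\<And>k. \<bar>f k\<bar> \<le> B"
  shows "\<bar>pois_exp m f - pois_exp l f - (m - l) * pois_exp l (\<lambda>k. f (Suc k) - f k)\<bar> \<le> 4 * B * (m - l)\<^sup>2"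
proof -
  define g where "g = (\<lambda>k. f (Suc k) - f k)"
  have gB: "\<bar>g k\<bar> \<le> 2 * B" for k
    using B[of k] B[of "Suc k"] unfolding g_def by linarith
  have B0: "0 \<le> B" using B[of 0] by linarith
  define h where "h = (\<lambda>x. pois_exp x f - x * pois_exp l g)"
  let ?S = "closed_segment l m"
  have pos: "x > 0" if "x \<in> ?S" for x using that assms closed_segment_eq_real_ivl[of l m] by (auto split: if_splits)
  have dist: "\<bar>x - l\<bar> \<le> \<bar>m - l\<bar>" if "x \<in> ?S" for x
    using that closed_segment_eq_real_ivl[of l m] by (auto split: if_splits)
  have "norm (h m - h l) \<le> (4 * B * \<bar>m - l\<bar>) * norm (m - l)"
  proof (rule field_differentiable_bound[of ?S])
    show "(h has_field_derivative (pois_exp x g - pois_exp l g)) (at x within ?S)" if "x \<in> ?S" for x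
    proof -
      have "((\<lambda>x. pois_exp x f) has_real_derivative pois_exp x g) (at x within ?S)"
        unfolding g_def
        by (rule has_field_derivative_at_within[OF expectation_poisson_has_derivative[OF pos[OF that] B]])
      moreover have "((\<lambda>x. x * pois_exp l g) has_real_derivative pois_exp l g) (at x within ?S)"
        by (auto intro!: derivative_eq_intros)
      ultimately show ?thesis unfolding h_def by (rule DERIV_diff)
    qed
    show "norm (pois_exp x g - pois_exp l g) \<le> 4 * B * \<bar>m - l\<bar>" if "x \<in> ?S" for x
    proof -
      have "\<bar>pois_exp x g - pois_exp l g\<bar> \<le> 2 * (2 * B) * \<bar>x - l\<bar>"
        by (rule expectation_poisson_lipschitz[OF assms(1) pos[OF that] gB])
      also have "\<dots> \<le> 2 * (2 * B) * \<bar>m - l\<bar>"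
        using dist[OF that] B0 by (intro mult_left_mono) auto
      finally show ?thesis by simp
    qed
  qed auto
  moreover have "h m - h l = pois_exp m f - pois_exp l f - (m - l) * pois_exp l g"
    unfolding h_def by (simp add: algebra_simps)
  moreover have "4 * B * \<bar>m - l\<bar> * norm (m - l) = 4 * B * (m - l)\<^sup>2"
    by (simp add: power2_eq_square mult.assoc)
  ultimately show ?thesis unfolding g_def real_norm_def by metis
qed

section \<open>Sufficiency\<close>

text \<open>By the factorisation hypothesis, conditioning \<open>P \<theta>\<close> on \<open>f\<close> gives a kernel that does not
  depend on \<open>\<theta>\<close>.\<close>

lemma rao_blackwell:
  fixes P :: "'t \<Rightarrow> 'a pmf" and f :: "'a \<Rightarrow> 'b" and T :: "'a \<Rightarrow> real"
  assumes factor: "\<And>\<theta> y. \<theta> \<in> \<Theta> \<Longrightarrow> pmf (P \<theta>) y = g \<theta> (f y) * pmf Q y"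
    and pos: "\<And>\<theta> s. \<theta> \<in> \<Theta> \<Longrightarrow> 0 < g \<theta> s"
  shows "\<exists>S. \<forall>\<theta>\<in>\<Theta>. \<forall>c. (\<integral>\<^sup>+s. ennreal ((S s - c)\<^sup>2) \<partial>measure_pmf (map_pmf f (P \<theta>)))
      \<le> (\<integral>\<^sup>+y. ennreal ((T y - c)\<^sup>2) \<partial>measure_pmf (P \<theta>))"
proof -
  \<comment> \<open>For s outside the image of the support this is some unspecified law. Jensen
    holds for it all the same, and \<open>kernel\<close> meets only s in that image.\<close>
  define K where "K s = cond_pmf Q {y. s = f y}" for s
  define S where "S s = measure_pmf.expectation (K s) T" for s
  have jensen: "ennreal ((S s - c)\<^sup>2) \<le> (\<integral>\<^sup>+y. ennreal ((T y - c)\<^sup>2) \<partial>measure_pmf (K s))" for s c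
  \<comment> \<open>A finite right side is what makes T integrable under \<open>K s\<close>.
    Otherwise the bound is trivial, whatever value the expectation takes by convention.\<close>
  proof (cases "(\<integral>\<^sup>+y. ennreal ((T y - c)\<^sup>2) \<partial>measure_pmf (K s)) < \<infinity>")
    case True
    then have i2: "integrable (measure_pmf (K s)) (\<lambda>y. (T y - c)\<^sup>2)"
      unfolding integrable_iff_bounded by simp
    then have i1: "integrable (measure_pmf (K s)) (\<lambda>y. T y - c)"
      by (rule measure_pmf.square_integrable_imp_integrable[rotated]) auto
    then have iT: "integrable (measure_pmf (K s)) T"
      using Bochner_Integration.integrable_add[of "measure_pmf (K s)" "\<lambda>y. T y - c" "\<lambda>_. c"] by simp
    have "0 \<le> measure_pmf.variance (K s) (\<lambda>y. T y - c)"
      by (rule measure_pmf.variance_positive)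
    also have "\<dots> = measure_pmf.expectation (K s) (\<lambda>y. (T y - c)\<^sup>2) -
        (measure_pmf.expectation (K s) (\<lambda>y. T y - c))\<^sup>2"
      by (rule measure_pmf.variance_eq[OF i1 i2])
    finally have "(S s - c)\<^sup>2 \<le> measure_pmf.expectation (K s) (\<lambda>y. (T y - c)\<^sup>2)"
      using iT by (simp add: S_def)
    then show ?thesis
      by (subst nn_integral_eq_integral[OF i2]) (auto intro: ennreal_leI)
  next
    case False
    then show ?thesis by (simp add: not_less top_unique)
  qed
  have kernel: "bind_pmf (map_pmf f (P \<theta>)) K = P \<theta>" if "\<theta> \<in> \<Theta>" for \<theta>
  proof -
    \<comment> \<open>Positivity of g makes the supports agree, so both laws can be conditioned on
      the same fibres. On a fibre the factor \<open>g \<theta> s\<close> cancels between a point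
      mass and the total mass.\<close>
    have set_eq: "set_pmf (P \<theta>) = set_pmf Q"
    proof -
      have "pmf (P \<theta>) y = 0 \<longleftrightarrow> pmf Q y = 0" for y
        using factor[OF that, of y] pos[OF that, of "f y"] by simp
      then show ?thesis by (simp add: set_pmf_eq)
    qed
    have meas: "measure (P \<theta>) {y. s = f y} = g \<theta> s * measure Q {y. s = f y}" for s
    proof -
      have "emeasure (P \<theta>) {y. s = f y} = (\<integral>\<^sup>+y\<in>{y. s = f y}. pmf (P \<theta>) y \<partial>count_space UNIV)"
        by (simp add: nn_integral_pmf[symmetric] nn_integral_count_space_indicator)
      also have "\<dots> = (\<integral>\<^sup>+y. ennreal (g \<theta> s) * (ennreal (pmf Q y) * indicator {y. s = f y} y) \<partial>count_space UNIV)"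
        using pos[OF that] factor[OF that]
        by (intro nn_integral_cong) (auto simp: indicator_def ennreal_mult less_imp_le)
      also have "\<dots> = ennreal (g \<theta> s) * emeasure Q {y. s = f y}"
        by (subst nn_integral_cmult)
          (auto simp: nn_integral_pmf[symmetric] nn_integral_count_space_indicator)
      finally show ?thesis
        using pos[OF that, of s] by (simp add: measure_pmf.emeasure_eq_measure ennreal_mult[symmetric])
    qed
    have cond: "cond_pmf (P \<theta>) {y. s = f y} = K s" if s: "s \<in> f ` set_pmf Q" for s
    proof (rule pmf_eqI)
      fix y
      have ne: "set_pmf (P \<theta>) \<inter> {y. s = f y} \<noteq> {}" "set_pmf Q \<inter> {y. s = f y} \<noteq> {}"
        using s set_eq by auto
      have "g \<theta> s > 0" by (rule pos[OF \<open>\<theta> \<in> \<Theta>\<close>])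
      then show "pmf (cond_pmf (P \<theta>) {y. s = f y}) y = pmf (K s) y"
        unfolding K_def using factor[OF \<open>\<theta> \<in> \<Theta>\<close>] meas
        by (auto simp: pmf_cond[OF ne(1)] pmf_cond[OF ne(2)])
    qed
    have "bind_pmf (map_pmf f (P \<theta>)) K = bind_pmf (map_pmf f (P \<theta>)) (\<lambda>s. cond_pmf (P \<theta>) {y. s = f y})"
      by (rule bind_pmf_cong) (use cond set_eq in auto)
    also have "\<dots> = P \<theta>"
      by (rule bind_cond_pmf_cancel) (auto simp: vimage_def intro!: arg_cong[where f = "measure _"])
    finally show ?thesis .
  qed
  show ?thesis
  proof (intro exI[of _ S] ballI allI)
    fix \<theta> c assume "\<theta> \<in> \<Theta>"
    have "(\<integral>\<^sup>+s. ennreal ((S s - c)\<^sup>2) \<partial>measure_pmf (map_pmf f (P \<theta>))) \<le>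
        (\<integral>\<^sup>+s. (\<integral>\<^sup>+y. ennreal ((T y - c)\<^sup>2) \<partial>measure_pmf (K s)) \<partial>measure_pmf (map_pmf f (P \<theta>)))"
      by (intro nn_integral_mono jensen)
    also have "\<dots> = (\<integral>\<^sup>+y. ennreal ((T y - c)\<^sup>2) \<partial>measure_pmf (bind_pmf (map_pmf f (P \<theta>)) K))"
      by simp
    finally show "(\<integral>\<^sup>+s. ennreal ((S s - c)\<^sup>2) \<partial>measure_pmf (map_pmf f (P \<theta>)))
      \<le> (\<integral>\<^sup>+y. ennreal ((T y - c)\<^sup>2) \<partial>measure_pmf (P \<theta>))"
      unfolding kernel[OF \<open>\<theta> \<in> \<Theta>\<close>] .
  qed
qed

lemma map_add_pair_poisson:
  assumes "a > 0" "c > 0"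
  shows "map_pmf (\<lambda>(i, j). i + j) (pair_pmf (poisson_pmf a) (poisson_pmf c)) = poisson_pmf (a + c)"
proof (rule pmf_eqI)
  fix k :: nat
  let ?p = "pair_pmf (poisson_pmf a) (poisson_pmf c)"
  have vim: "(\<lambda>(i, j). i + j) -` {k} = (\<lambda>i. (i, k - i)) ` {..k}"
    by (auto simp: image_iff)
  have "pmf (map_pmf (\<lambda>(i, j). i + j) ?p) k = measure ?p ((\<lambda>i. (i, k - i)) ` {..k})"
    by (simp add: pmf_map vim)
  also have "\<dots> = (\<Sum>i\<le>k. pmf (poisson_pmf a) i * pmf (poisson_pmf c) (k - i))"
    by (subst measure_measure_pmf_finite) (auto simp: sum.reindex inj_on_def pmf_pair)
  also have "\<dots> = (\<Sum>i\<le>k. (a ^ i /\<^sub>R fact i) * (c ^ (k - i) /\<^sub>R fact (k - i))) * exp (- (a + c))"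
    unfolding sum_distrib_right
  proof (rule sum.cong[OF refl])
    fix i
    have "exp (- (a + c)) = exp (- a) * exp (- c)" by (simp add: exp_add[symmetric])
    then show "pmf (poisson_pmf a) i * pmf (poisson_pmf c) (k - i) =
        (a ^ i /\<^sub>R fact i) * (c ^ (k - i) /\<^sub>R fact (k - i)) * exp (- (a + c))"
      using assms by (simp add: divide_inverse mult_ac)
  qed
  \<comment> \<open>This is the binomial theorem divided by k!.\<close>
  also have "\<dots> = (a + c) ^ k /\<^sub>R fact k * exp (- (a + c))"
    by (subst exp_series_add_commuting) (auto simp: mult.commute)
  also have "\<dots> = pmf (poisson_pmf (a + c)) k"
    using assms by (simp add: divide_inverse mult.commute)
  finally show "pmf (map_pmf (\<lambda>(i, j). i + j) ?p) k = pmf (poisson_pmf (a + c)) k" .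
qed

lemma map_sum_poisson_sample:
  assumes "n > 0" "\<theta> > 0" "x > 0"
  shows "map_pmf (\<lambda>y. \<Sum>i<n. y i) (poisson_sample n \<theta> x) = poisson_pmf (\<theta> * (real n / x))"
proof -
  \<comment> \<open>The induction starts with one count: an empty sample would call for the Poisson
    law of mean 0, which is not specified.\<close>
  have *: "map_pmf (\<lambda>y. \<Sum>i<Suc m. y i) (poisson_sample (Suc m) \<theta> x) = poisson_pmf (\<theta> * (real (Suc m) / x))" for m
  proof (induction m)
    case 0
    show ?case
      by (simp add: poisson_sample_def lessThan_Suc Pi_pmf_singleton map_pmf_comp)
  next
    case (Suc m)
    let ?N = "{..<Suc m}"
    have "map_pmf (\<lambda>y. \<Sum>i<Suc (Suc m). y i) (poisson_sample (Suc (Suc m)) \<theta> x) =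
        map_pmf (\<lambda>(k, y). k + (\<Sum>i\<in>?N. y i)) (pair_pmf (poisson_pmf (\<theta> / x)) (poisson_sample (Suc m) \<theta> x))"
      unfolding poisson_sample_def lessThan_Suc[of "Suc m"]
      by (subst Pi_pmf_insert) (auto simp: map_pmf_comp case_prod_unfold intro!: map_pmf_cong sum.cong)
    also have "\<dots> = map_pmf (\<lambda>(i, j). i + j) (map_pmf (apsnd (\<lambda>y. \<Sum>i\<in>?N. y i))
        (pair_pmf (poisson_pmf (\<theta> / x)) (poisson_sample (Suc m) \<theta> x)))"
      by (simp add: map_pmf_comp case_prod_unfold)
    also have "\<dots> = map_pmf (\<lambda>(i, j). i + j) (pair_pmf (poisson_pmf (\<theta> / x)) (poisson_pmf (\<theta> * (real (Suc m) / x))))"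
      by (simp only: pair_map_pmf2[symmetric] Suc.IH)
    also have "\<dots> = poisson_pmf (\<theta> / x + \<theta> * (real (Suc m) / x))"
      by (rule map_add_pair_poisson) (use assms in auto)
    also have "\<theta> / x + \<theta> * (real (Suc m) / x) = \<theta> * (real (Suc (Suc m)) / x)"
      by (simp add: distrib_left add_divide_distrib)
    finally show ?case .
  qed
  from *[of "n - 1"] assms(1) show ?thesis by simp
qed

text \<open>The factorisation that \<open>rao_blackwell\<close> asks for, with the law at parameter
  1 as common reference: \<theta> enters only through the total.\<close>

lemma pmf_poisson_sample:
  assumes "\<theta> > 0" "x > 0"
  shows "pmf (poisson_sample n \<theta> x) y =
    \<theta> ^ (\<Sum>i<n. y i) * exp (- ((\<theta> - 1) * (real n / x))) * pmf (poisson_sample n 1 x) y"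
proof (cases "\<forall>i. i \<notin> {..<n} \<longrightarrow> y i = 0")
  case True
  have "(\<Prod>i<n. (\<theta> / x) ^ y i / fact (y i) * exp (- (\<theta> / x))) =
     (\<Prod>i<n. \<theta> ^ y i * exp (- ((\<theta> - 1) / x)) * ((1 / x) ^ y i / fact (y i) * exp (- (1 / x))))"
  proof (rule prod.cong[OF refl])
    fix i
    have "exp (- (\<theta> / x)) = exp (- ((\<theta> - 1) / x)) * exp (- (1 / x))"
      unfolding exp_add[symmetric] by (simp add: diff_divide_distrib)
    moreover have "(\<theta> / x) ^ y i = \<theta> ^ y i * (1 / x) ^ y i"
      unfolding power_mult_distrib[symmetric] by simp
    ultimately show "(\<theta> / x) ^ y i / fact (y i) * exp (- (\<theta> / x)) =
        \<theta> ^ y i * exp (- ((\<theta> - 1) / x)) * ((1 / x) ^ y i / fact (y i) * exp (- (1 / x)))"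
      by simp
  qed
  also have "\<dots> = \<theta> ^ (\<Sum>i<n. y i) * exp (- ((\<theta> - 1) * (real n / x))) *
     (\<Prod>i<n. (1 / x) ^ y i / fact (y i) * exp (- (1 / x)))"
    by (simp only: prod.distrib power_sum[symmetric] prod_constant card_lessThan exp_of_nat_mult[symmetric])
      (simp add: field_simps)
  finally show ?thesis using True assms by (simp add: poisson_sample_def pmf_Pi)
next
  case False
  then show ?thesis by (auto simp: poisson_sample_def pmf_Pi)
qed

section \<open>Minimax risk of one Poisson count\<close>

definition clip :: "real \<Rightarrow> real \<Rightarrow> real" where
  "clip B x = max (- B) (min B x)"

lemma abs_clip_le: "0 \<le> B \<Longrightarrow> \<bar>clip B x\<bar> \<le> B"
  by (auto simp: clip_def)

lemma clip_square_le:
  assumes "\<bar>y\<bar> \<le> B"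
  shows "(clip B x - y)\<^sup>2 \<le> (x - y)\<^sup>2"
  using assms by (intro abs_le_square_iff[THEN iffD1]) (auto simp: clip_def)

text \<open>In the application \<open>\<phi> \<theta> = \<psi> \<theta> - \<psi> \<theta>\<^sub>0\<close>, \<open>\<eta> = H / sqrt n\<close> and \<open>\<omega>\<close> is a multiple of
  \<open>\<eta>\<close>. The total of \<open>n\<close> counts is sufficient and has law Poisson with mean \<open>\<theta> * t\<close>, \<open>t = n / x\<close>.\<close>

locale local_model =
  fixes \<phi> :: "real \<Rightarrow> real" and b \<omega> \<theta>\<^sub>0 \<eta> :: real
  assumes eta: "0 < \<eta>" "\<eta> < \<theta>\<^sub>0" and b_nonzero: "b \<noteq> 0" and omega: "0 \<le> \<omega>"
    and phi_base: "\<phi> \<theta>\<^sub>0 = 0"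
    and near_linear: "\<And>\<theta> \<theta>'. \<bar>\<theta> - \<theta>\<^sub>0\<bar> \<le> \<eta> \<Longrightarrow> \<bar>\<theta>' - \<theta>\<^sub>0\<bar> \<le> \<eta> \<Longrightarrow>
      \<bar>\<phi> \<theta> - \<phi> \<theta>' - b * (\<theta> - \<theta>')\<bar> \<le> \<omega> * \<bar>\<theta> - \<theta>'\<bar>"
begin

definition params :: "real set" where
  "params = {\<theta>. \<bar>\<theta> - \<theta>\<^sub>0\<bar> \<le> \<eta>}"

definition range_bound :: real where
  "range_bound = (\<bar>b\<bar> + \<omega>) * \<eta>"

text \<open>Restricting estimators to the range of \<open>\<phi>\<close> costs nothing, as clipping decreases the risk,
  and makes the error terms below uniform in the estimator.\<close>

definition achievable :: "real \<Rightarrow> real \<Rightarrow> bool" where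
  "achievable t A \<longleftrightarrow> (\<exists>S. (\<forall>k. \<bar>S k\<bar> \<le> range_bound) \<and>
     (\<forall>\<theta>\<in>params. pois_exp (\<theta> * t) (\<lambda>k. (S k - \<phi> \<theta>)\<^sup>2) \<le> A))"

text \<open>As an infimum over achievable bounds it concerns a set of reals that contains
  \<open>range_bound\<^sup>2\<close> and lies above 0, so no supremum over the parameters has to be
  shown finite.\<close>

definition minimax :: "real \<Rightarrow> real" where
  "minimax t = Inf {A. achievable t A}"

lemma range_bound_nonneg: "0 \<le> range_bound"
  using eta omega by (simp add: range_bound_def)

lemma params_pos: "\<theta> \<in> params \<Longrightarrow> 0 < \<theta>"
  using eta by (auto simp: params_def)

lemma params_bounds: "\<theta> \<in> params \<Longrightarrow> \<theta> \<le> \<theta>\<^sub>0 + \<eta>" "\<theta> \<in> params \<Longrightarrow> \<theta>\<^sub>0 - \<eta> \<le> \<theta>"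
  by (auto simp: params_def)

lemma base_in_params: "\<theta>\<^sub>0 \<in> params" and upper_in_params: "\<theta>\<^sub>0 + \<eta> \<in> params"
  and lower_in_params: "\<theta>\<^sub>0 - \<eta> \<in> params"
  using eta by (auto simp: params_def)

lemma linearisation_error:
  assumes "\<theta> \<in> params"
  shows "\<bar>\<phi> \<theta> - b * (\<theta> - \<theta>\<^sub>0)\<bar> \<le> \<omega> * \<eta>"
proof -
  have "\<bar>\<phi> \<theta> - b * (\<theta> - \<theta>\<^sub>0)\<bar> \<le> \<omega> * \<bar>\<theta> - \<theta>\<^sub>0\<bar>"
    using near_linear[of \<theta> \<theta>\<^sub>0] assms eta phi_base by (auto simp: params_def)
  also have "\<dots> \<le> \<omega> * \<eta>"
    using assms omega by (intro mult_left_mono) (auto simp: params_def)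
  finally show ?thesis .
qed

lemma phi_bound:
  assumes "\<theta> \<in> params"
  shows "\<bar>\<phi> \<theta>\<bar> \<le> range_bound"
proof -
  have "\<bar>b * (\<theta> - \<theta>\<^sub>0)\<bar> \<le> \<bar>b\<bar> * \<eta>"
    using assms by (auto simp: abs_mult params_def intro!: mult_left_mono)
  with linearisation_error[OF assms] show ?thesis
    unfolding range_bound_def distrib_right by linarith
qed

lemma error_bound:
  assumes "\<bar>s\<bar> \<le> range_bound" "\<theta> \<in> params"
  shows "\<bar>s - \<phi> \<theta>\<bar> \<le> 2 * range_bound"
  using phi_bound[OF assms(2)] assms(1) by linarith

lemma square_error_bound:
  assumes "\<bar>s\<bar> \<le> range_bound" "\<theta> \<in> params"
  shows "\<bar>(s - \<phi> \<theta>)\<^sup>2\<bar> \<le> 4 * range_bound\<^sup>2"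
  using power_mono[OF error_bound[OF assms], of 2] by (simp add: power_mult_distrib)

lemma integrable_square_error:
  assumes "\<And>k. \<bar>S k\<bar> \<le> range_bound" "\<theta> \<in> params"
  shows "integrable (measure_pmf p) (\<lambda>k. (S k - \<phi> \<theta>)\<^sup>2)"
  by (rule integrable_bounded_pmf[OF square_error_bound]) (use assms in auto)

text \<open>Accepts unbounded estimators with their risk in \<open>ennreal\<close>, the form in
  which Rao-Blackwell and the risk of the full sample deliver them; clipping repairs the
  bound.\<close>

lemma achievableI:
  assumes "0 \<le> A" and risk: "\<And>\<theta>. \<theta> \<in> params \<Longrightarrow>
    (\<integral>\<^sup>+k. ennreal ((T k - \<phi> \<theta>)\<^sup>2) \<partial>measure_pmf (poisson_pmf (\<theta> * t))) \<le> ennreal A"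
  shows "achievable t A"
  unfolding achievable_def
proof (intro exI conjI allI ballI)
  fix k show "\<bar>clip range_bound (T k)\<bar> \<le> range_bound"
    by (rule abs_clip_le[OF range_bound_nonneg])
next
  fix \<theta> assume \<theta>: "\<theta> \<in> params"
  let ?p = "measure_pmf (poisson_pmf (\<theta> * t))"
  have "ennreal (integral\<^sup>L ?p (\<lambda>k. (clip range_bound (T k) - \<phi> \<theta>)\<^sup>2)) =
      (\<integral>\<^sup>+k. ennreal ((clip range_bound (T k) - \<phi> \<theta>)\<^sup>2) \<partial>?p)"
    by (rule nn_integral_eq_integral[symmetric])
      (auto intro!: integrable_square_error \<theta> abs_clip_le range_bound_nonneg)
  also have "\<dots> \<le> (\<integral>\<^sup>+k. ennreal ((T k - \<phi> \<theta>)\<^sup>2) \<partial>?p)"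
    by (intro nn_integral_mono ennreal_leI clip_square_le phi_bound \<theta>)
  also have "\<dots> \<le> ennreal A" by (rule risk[OF \<theta>])
  finally show "integral\<^sup>L ?p (\<lambda>k. (clip range_bound (T k) - \<phi> \<theta>)\<^sup>2) \<le> A"
    using assms(1) by simp
qed

lemma achievableI_expectation:
  assumes int: "\<And>\<theta>. \<theta> \<in> params \<Longrightarrow>
      integrable (measure_pmf (poisson_pmf (\<theta> * t))) (\<lambda>k. (T k - \<phi> \<theta>)\<^sup>2)"
    and risk: "\<And>\<theta>. \<theta> \<in> params \<Longrightarrow> pois_exp (\<theta> * t) (\<lambda>k. (T k - \<phi> \<theta>)\<^sup>2) \<le> A"
  shows "achievable t A"
proof (rule achievableI[where T = T])
  have "0 \<le> pois_exp (\<theta>\<^sub>0 * t) (\<lambda>k. (T k - \<phi> \<theta>\<^sub>0)\<^sup>2)" by simp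
  also have "\<dots> \<le> A" by (rule risk[OF base_in_params])
  finally show "0 \<le> A" .
  fix \<theta> assume "\<theta> \<in> params"
  then show "(\<integral>\<^sup>+k. ennreal ((T k - \<phi> \<theta>)\<^sup>2) \<partial>measure_pmf (poisson_pmf (\<theta> * t))) \<le> ennreal A"
    by (subst nn_integral_eq_integral[OF int]) (auto intro: ennreal_leI risk)
qed

lemma achievable_nonneg:
  assumes "achievable t A"
  shows "0 \<le> A"
proof -
  from assms obtain S where "pois_exp (\<theta>\<^sub>0 * t) (\<lambda>k. (S k - \<phi> \<theta>\<^sub>0)\<^sup>2) \<le> A"
    unfolding achievable_def using base_in_params by blast
  moreover have "0 \<le> pois_exp (\<theta>\<^sub>0 * t) (\<lambda>k. (S k - \<phi> \<theta>\<^sub>0)\<^sup>2)" by simp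
  ultimately show ?thesis by linarith
qed

lemma achievable_mono: "achievable t A \<Longrightarrow> A \<le> A' \<Longrightarrow> achievable t A'"
  unfolding achievable_def by (blast intro: order_trans)

lemma achievable_range_bound: "achievable t (range_bound\<^sup>2)"
  unfolding achievable_def
proof (intro exI[of _ "\<lambda>_. 0"] conjI ballI allI)
  show "\<bar>0::real\<bar> \<le> range_bound" using range_bound_nonneg by simp
  fix \<theta> assume "\<theta> \<in> params"
  from power_mono[OF phi_bound[OF this], of 2]
  show "pois_exp (\<theta> * t) (\<lambda>k. (0 - \<phi> \<theta>)\<^sup>2) \<le> range_bound\<^sup>2" by simp
qed

lemma bdd_below_achievable: "bdd_below {A. achievable t A}"
  using achievable_nonneg by (intro bdd_belowI[of _ 0]) auto

lemma minimax_le: "achievable t A \<Longrightarrow> minimax t \<le> A"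
  unfolding minimax_def by (rule cInf_lower[OF _ bdd_below_achievable]) simp

lemma minimax_nonneg: "0 \<le> minimax t"
  unfolding minimax_def using achievable_range_bound achievable_nonneg
  by (intro cInf_greatest) auto

lemma achievable_of_less:
  assumes "minimax t < A"
  shows "achievable t A"
proof -
  have "{A. achievable t A} \<noteq> {}" using achievable_range_bound by blast
  from cInf_lessD[OF this assms[unfolded minimax_def]] show ?thesis
    using achievable_mono[OF _ less_imp_le] by blast
qed

text \<open>The infimum need not be attained, so the hypothesis is applied slightly above it and the
  slack is removed afterwards.\<close>

lemma minimax_transfer:
  assumes "0 \<le> \<alpha>" and "\<And>A. achievable t' A \<Longrightarrow> achievable t (\<alpha> * A + \<beta>)"
  shows "minimax t \<le> \<alpha> * minimax t' + \<beta>"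
proof (rule field_le_epsilon)
  fix e :: real assume "e > 0"
  \<comment> \<open>The denominator \<alpha> + 1 instead of \<alpha> covers \<alpha> = 0.\<close>
  let ?d = "e / (\<alpha> + 1)"
  have "?d > 0" using \<open>e > 0\<close> assms(1) by simp
  then have "minimax t \<le> \<alpha> * (minimax t' + ?d) + \<beta>"
    by (intro minimax_le assms(2) achievable_of_less) simp
  also have "\<alpha> * ?d \<le> e" using \<open>e > 0\<close> assms(1) by (simp add: field_simps)
  then have "\<alpha> * (minimax t' + ?d) + \<beta> \<le> \<alpha> * minimax t' + \<beta> + e" by (simp add: algebra_simps)
  finally show "minimax t \<le> \<alpha> * minimax t' + \<beta> + e" .
qed

section \<open>Bounds for the minimax risk and comparison of exposures\<close>

text \<open>The natural estimator \<open>b * (k / t - \<theta>\<^sub>0)\<close> has variance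
  \<open>b\<^sup>2 * \<theta> / t\<close>, and its bias is exactly the linearisation error.\<close>

lemma minimax_le_unbiased:
  assumes "t > 0"
  shows "minimax t \<le> b\<^sup>2 * (\<theta>\<^sub>0 + \<eta>) / t + \<omega>\<^sup>2 * \<eta>\<^sup>2"
proof (intro minimax_le achievableI_expectation)
  fix \<theta> assume \<theta>: "\<theta> \<in> params"
  let ?T = "\<lambda>k. b * (real k / t - \<theta>\<^sub>0)"
  define g where "g = \<phi> \<theta> - b * (\<theta> - \<theta>\<^sub>0)"
  have pos: "\<theta> * t > 0" using assms params_pos[OF \<theta>] by simp
  have eq: "(\<lambda>k. (?T k - \<phi> \<theta>)\<^sup>2) = (\<lambda>k. (- g + b / t * (real k - \<theta> * t))\<^sup>2)"
  proof
    fix k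
    have "b / t * (real k - \<theta> * t) = b * (real k / t) - b * \<theta>"
      using assms by (simp add: right_diff_distrib)
    then have "?T k - \<phi> \<theta> = - g + b / t * (real k - \<theta> * t)"
      by (simp add: g_def right_diff_distrib)
    then show "(?T k - \<phi> \<theta>)\<^sup>2 = (- g + b / t * (real k - \<theta> * t))\<^sup>2" by simp
  qed
  show "integrable (measure_pmf (poisson_pmf (\<theta> * t))) (\<lambda>k. (?T k - \<phi> \<theta>)\<^sup>2)"
    unfolding eq by (rule expectation_poisson_affine_square[OF pos])
  have "pois_exp (\<theta> * t) (\<lambda>k. (?T k - \<phi> \<theta>)\<^sup>2) = g\<^sup>2 + b\<^sup>2 * \<theta> / t"
    unfolding eq expectation_poisson_affine_square[OF pos] using assms
    by (simp add: power2_eq_square field_simps)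
  also have "g\<^sup>2 \<le> (\<omega> * \<eta>)\<^sup>2"
    using linearisation_error[OF \<theta>] power_mono[of "\<bar>g\<bar>" "\<omega> * \<eta>" 2] by (simp add: g_def)
  also have "b\<^sup>2 * \<theta> / t \<le> b\<^sup>2 * (\<theta>\<^sub>0 + \<eta>) / t"
    using params_bounds[OF \<theta>] assms by (intro divide_right_mono mult_left_mono) auto
  finally show "pois_exp (\<theta> * t) (\<lambda>k. (?T k - \<phi> \<theta>)\<^sup>2) \<le> b\<^sup>2 * (\<theta>\<^sub>0 + \<eta>) / t + \<omega>\<^sup>2 * \<eta>\<^sup>2"
    by (simp add: power_mult_distrib)
qed

text \<open>The extra count \<open>d\<close> enters through \<open>S + w * (d - D * (\<theta>\<^sub>0 + S / b))\<close>, where the expected extra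
  count is estimated from \<open>S\<close> itself, so that the error of \<open>S\<close> shrinks by the factor
  \<open>1 - z\<close>, \<open>z = w * D / b\<close>.\<close>

lemma achievable_more_data:
  assumes "0 < t'" "t' < t" "0 \<le> z" "z \<le> 1" and ach: "achievable t' A"
  shows "achievable t ((1 - z)\<^sup>2 * A + (4 * z * \<omega> * \<eta> * range_bound + z\<^sup>2 * \<omega>\<^sup>2 * \<eta>\<^sup>2 +
    z\<^sup>2 * b\<^sup>2 * (\<theta>\<^sub>0 + \<eta>) / (t - t')))"
    (is "achievable t (?q * A + ?c)")
proof -
  define D where "D = t - t'"
  have D: "D > 0" using assms by (simp add: D_def)
  define w where "w = z * b / D"
  from ach obtain S where S: "\<And>k. \<bar>S k\<bar> \<le> range_bound"
    and risk: "\<And>\<theta>. \<theta> \<in> params \<Longrightarrow> pois_exp (\<theta> * t') (\<lambda>k. (S k - \<phi> \<theta>)\<^sup>2) \<le> A"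
    unfolding achievable_def by blast
  have A0: "0 \<le> A" by (rule achievable_nonneg[OF ach])
  define T where "T = (\<lambda>(k, d). S k + w * (real d - D * (\<theta>\<^sub>0 + S k / b)))"
  define P where "P \<theta> = pair_pmf (poisson_pmf (\<theta> * t')) (poisson_pmf (\<theta> * D))" for \<theta>
  have fac: "pmf (P \<theta>) y = \<theta> ^ (case y of (i, j) \<Rightarrow> i + j) * exp (t - \<theta> * t) * pmf (P 1) y"
    if "\<theta> \<in> params" for \<theta> y
  proof (cases y)
    case (Pair i j)
    have "exp (- (\<theta> * t')) * exp (- (\<theta> * D)) = exp (t - \<theta> * t) * (exp (- t') * exp (- D))"
      unfolding exp_add[symmetric] by (simp add: D_def algebra_simps)
    then show ?thesis
      using params_pos[OF that] D assms(1)
      by (simp add: Pair P_def pmf_pair power_add power_mult_distrib)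
  qed
  \<comment> \<open>\<open>T\<close> uses the pair of counts at exposures t' and D. Their sum is
    sufficient and is one count at exposure t, so \<open>T\<close> can be replaced by an estimator
    based on the sum.\<close>
  have "\<exists>S'. \<forall>\<theta>\<in>params. \<forall>c.
      (\<integral>\<^sup>+s. ennreal ((S' s - c)\<^sup>2) \<partial>measure_pmf (map_pmf (\<lambda>(i, j). i + j) (P \<theta>)))
      \<le> (\<integral>\<^sup>+y. ennreal ((T y - c)\<^sup>2) \<partial>measure_pmf (P \<theta>))"
    by (rule rao_blackwell[where g = "\<lambda>\<theta> s. \<theta> ^ s * exp (t - \<theta> * t)", OF fac])
      (use params_pos in simp_all)
  then obtain S' where S': "\<And>\<theta> c. \<theta> \<in> params \<Longrightarrow>
      (\<integral>\<^sup>+s. ennreal ((S' s - c)\<^sup>2) \<partial>measure_pmf (map_pmf (\<lambda>(i, j). i + j) (P \<theta>)))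
      \<le> (\<integral>\<^sup>+y. ennreal ((T y - c)\<^sup>2) \<partial>measure_pmf (P \<theta>))"
    by blast
  have c0: "0 \<le> ?c"
    using assms omega eta range_bound_nonneg by (intro add_nonneg_nonneg mult_nonneg_nonneg divide_nonneg_nonneg) auto
  show ?thesis
  proof (rule achievableI[where T = S'])
    show "0 \<le> ?q * A + ?c" using A0 c0 by simp
    fix \<theta> assume \<theta>: "\<theta> \<in> params"
    define g where "g = \<phi> \<theta> - b * (\<theta> - \<theta>\<^sub>0)"
    have g: "\<bar>g\<bar> \<le> \<omega> * \<eta>" using linearisation_error[OF \<theta>] by (simp add: g_def)
    have intS: "integrable (measure_pmf p) (\<lambda>k. (S k - \<phi> \<theta>)\<^sup>2)" for p
      by (rule integrable_square_error) (use S \<theta> in auto)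
    have posD: "\<theta> * D > 0" and post: "\<theta> * t' > 0" using params_pos[OF \<theta>] D assms by auto
    have "map_pmf (\<lambda>(i, j). i + j) (P \<theta>) = poisson_pmf (\<theta> * t' + \<theta> * D)"
      unfolding P_def by (rule map_add_pair_poisson[OF post posD])
    also have "\<theta> * t' + \<theta> * D = \<theta> * t" by (simp add: D_def algebra_simps)
    finally have map: "map_pmf (\<lambda>(i, j). i + j) (P \<theta>) = poisson_pmf (\<theta> * t)" .
    have inner: "(\<integral>\<^sup>+d. ennreal ((T (k, d) - \<phi> \<theta>)\<^sup>2) \<partial>measure_pmf (poisson_pmf (\<theta> * D)))
        \<le> ennreal (?q * (S k - \<phi> \<theta>)\<^sup>2 + ?c)" for k
    proof -
      define u where "u = S k - \<phi> \<theta>"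
      have u: "\<bar>u\<bar> \<le> 2 * range_bound" unfolding u_def by (rule error_bound[OF S \<theta>])
      have wD: "w * D = z * b" using D by (simp add: w_def)
      \<comment> \<open>Since
        \<open>b * (\<theta> - \<theta>\<^sub>0) = \<phi> \<theta> - g\<close>, the correction
        contributes - z u - z g. The last term is centred, so no cross term with it survives
        integration over d.\<close>
      have "T (k, d) - \<phi> \<theta> = (1 - z) * u - z * g + w * (real d - \<theta> * D)" for d
      proof -
        have "T (k, d) - \<phi> \<theta> = u + w * (real d - \<theta> * D) + (w * D) * (\<theta> - \<theta>\<^sub>0) - (w * D) * (S k / b)"
          by (simp add: T_def u_def algebra_simps)
        also have "\<dots> = u + w * (real d - \<theta> * D) + z * (b * (\<theta> - \<theta>\<^sub>0)) - z * S k"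
          unfolding wD using b_nonzero by simp
        finally show ?thesis by (simp add: u_def g_def algebra_simps)
      qed
      then have "(\<integral>\<^sup>+d. ennreal ((T (k, d) - \<phi> \<theta>)\<^sup>2) \<partial>measure_pmf (poisson_pmf (\<theta> * D))) =
          ennreal (((1 - z) * u - z * g)\<^sup>2 + w\<^sup>2 * (\<theta> * D))"
        by (simp add: nn_integral_eq_integral expectation_poisson_affine_square[OF posD])
      also have "\<dots> \<le> ennreal (?q * u\<^sup>2 + ?c)"
      proof (rule ennreal_leI)
        have e1: "((1 - z) * u - z * g)\<^sup>2 = ?q * u\<^sup>2 - 2 * z * (1 - z) * (u * g) + z\<^sup>2 * g\<^sup>2"
          by (simp add: power2_eq_square algebra_simps)
        \<comment> \<open>The cross term has no sign. Its uniform bound keeps the factor z, on which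
          \<open>excess_lower\<close> relies.\<close>
        have e2: "- (2 * z * (1 - z) * (u * g)) \<le> 4 * z * \<omega> * \<eta> * range_bound"
        proof -
          have "- (u * g) \<le> \<bar>u\<bar> * \<bar>g\<bar>" by (metis abs_ge_minus_self abs_mult)
          also have "\<dots> \<le> 2 * range_bound * (\<omega> * \<eta>)"
            using u g range_bound_nonneg by (intro mult_mono) auto
          finally have "2 * z * (1 - z) * (- (u * g)) \<le> 2 * z * 1 * (2 * range_bound * (\<omega> * \<eta>))"
            using assms range_bound_nonneg omega eta
            by (intro order_trans[OF mult_left_mono mult_right_mono]) (auto intro!: mult_left_mono)
          then show ?thesis by (simp add: mult_ac)
        qed
        have "g\<^sup>2 \<le> \<omega>\<^sup>2 * \<eta>\<^sup>2"
          using power_mono[OF g, of 2] by (simp add: power_mult_distrib)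
        then have e3: "z\<^sup>2 * g\<^sup>2 \<le> z\<^sup>2 * \<omega>\<^sup>2 * \<eta>\<^sup>2"
          by (simp add: mult_left_mono mult.assoc)
        have e4: "w\<^sup>2 * (\<theta> * D) \<le> z\<^sup>2 * b\<^sup>2 * (\<theta>\<^sub>0 + \<eta>) / D"
        proof -
          have "w\<^sup>2 * (\<theta> * D) = z\<^sup>2 * b\<^sup>2 * \<theta> / D"
            using D by (simp add: w_def power2_eq_square)
          also have "\<dots> \<le> z\<^sup>2 * b\<^sup>2 * (\<theta>\<^sub>0 + \<eta>) / D"
            using params_bounds[OF \<theta>] D by (intro divide_right_mono mult_left_mono) auto
          finally show ?thesis .
        qed
        show "((1 - z) * u - z * g)\<^sup>2 + w\<^sup>2 * (\<theta> * D) \<le> ?q * u\<^sup>2 + ?c"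
          using e1 e2 e3 e4 unfolding D_def by linarith
      qed
      finally show ?thesis unfolding u_def .
    qed
    have "(\<integral>\<^sup>+k. ennreal ((S' k - \<phi> \<theta>)\<^sup>2) \<partial>measure_pmf (poisson_pmf (\<theta> * t))) \<le>
        (\<integral>\<^sup>+y. ennreal ((T y - \<phi> \<theta>)\<^sup>2) \<partial>measure_pmf (P \<theta>))"
      using S'[OF \<theta>, of "\<phi> \<theta>"] unfolding map .
    also have "\<dots> = (\<integral>\<^sup>+k. (\<integral>\<^sup>+d. ennreal ((T (k, d) - \<phi> \<theta>)\<^sup>2) \<partial>measure_pmf (poisson_pmf (\<theta> * D)))
        \<partial>measure_pmf (poisson_pmf (\<theta> * t')))"
      unfolding P_def by (rule nn_integral_pair_pmf')
    also have "\<dots> \<le> (\<integral>\<^sup>+k. ennreal (?q * (S k - \<phi> \<theta>)\<^sup>2 + ?c) \<partial>measure_pmf (poisson_pmf (\<theta> * t')))"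
      by (intro nn_integral_mono inner)
    also have "\<dots> = ennreal (pois_exp (\<theta> * t') (\<lambda>k. ?q * (S k - \<phi> \<theta>)\<^sup>2 + ?c))"
      by (rule nn_integral_eq_integral) (use intS c0 in \<open>auto intro!: AE_I2 add_nonneg_nonneg mult_nonneg_nonneg\<close>)
    also have "\<dots> = ennreal (?q * pois_exp (\<theta> * t') (\<lambda>k. (S k - \<phi> \<theta>)\<^sup>2) + ?c)"
      using intS by simp
    also have "\<dots> \<le> ennreal (?q * A + ?c)"
      using risk[OF \<theta>] by (intro ennreal_leI add_right_mono mult_left_mono) auto
    finally show "(\<integral>\<^sup>+k. ennreal ((S' k - \<phi> \<theta>)\<^sup>2) \<partial>measure_pmf (poisson_pmf (\<theta> * t))) \<le>
       ennreal (?q * A + ?c)" .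
  qed
qed

lemma minimax_more_data:
  assumes "0 < t'" "t' < t" "0 \<le> z" "z \<le> 1"
  shows "minimax t \<le> (1 - z)\<^sup>2 * minimax t' + (4 * z * \<omega> * \<eta> * range_bound + z\<^sup>2 * \<omega>\<^sup>2 * \<eta>\<^sup>2 +
    z\<^sup>2 * b\<^sup>2 * (\<theta>\<^sub>0 + \<eta>) / (t - t'))"
  by (rule minimax_transfer[OF _ achievable_more_data[OF assms]]) simp

lemma minimax_antimono:
  assumes "0 < t'" "t' \<le> t"
  shows "minimax t \<le> minimax t'"
  \<comment> \<open>The weight z = 0 ignores the additional count.\<close>
  using minimax_more_data[of t' t 0] assms by (cases "t' = t") auto

text \<open>Cramer--Rao for an estimator \<open>S\<close> with small risk everywhere bounds the slope of its mean
  \<open>m\<close>, so that \<open>m\<close> cannot follow \<open>\<phi>\<close> across the whole parameter interval.\<close>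

lemma achievable_lower_bound:
  assumes "t > 0" and ach: "achievable t A"
  shows "\<bar>b\<bar> - \<omega> \<le> sqrt A * (1 / \<eta> + sqrt (t / (\<theta>\<^sub>0 - \<eta>)))"
proof -
  from ach obtain S where S: "\<And>k. \<bar>S k\<bar> \<le> range_bound"
    and risk: "\<And>\<theta>. \<theta> \<in> params \<Longrightarrow> pois_exp (\<theta> * t) (\<lambda>k. (S k - \<phi> \<theta>)\<^sup>2) \<le> A"
    unfolding achievable_def by blast
  have A0: "0 \<le> A" by (rule achievable_nonneg[OF ach])
  define m where "m \<theta> = pois_exp (\<theta> * t) S" for \<theta>
  define d where "d \<theta> = pois_exp (\<theta> * t) (\<lambda>k. S (Suc k) - S k)" for \<theta>
  define c where "c = sqrt (t * A / (\<theta>\<^sub>0 - \<eta>))"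
  have iS: "integrable (measure_pmf p) (\<lambda>k. S k)" "integrable (measure_pmf p) (\<lambda>k. S (Suc k))" for p
    by (rule integrable_bounded_pmf[OF S])+
  have bias: "\<bar>m \<theta> - \<phi> \<theta>\<bar> \<le> sqrt A" if \<theta>: "\<theta> \<in> params" for \<theta>
  proof -
    let ?u = "\<lambda>k. S k - \<phi> \<theta>"
    have i1: "integrable (measure_pmf (poisson_pmf (\<theta> * t))) ?u" using iS by simp
    have i2: "integrable (measure_pmf (poisson_pmf (\<theta> * t))) (\<lambda>k. (?u k)\<^sup>2)"
      by (rule integrable_square_error) (use S \<theta> in auto)
    have "0 \<le> measure_pmf.variance (poisson_pmf (\<theta> * t)) ?u"
      by (rule measure_pmf.variance_positive)
    also have "\<dots> = pois_exp (\<theta> * t) (\<lambda>k. (?u k)\<^sup>2) - (pois_exp (\<theta> * t) ?u)\<^sup>2"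
      by (rule measure_pmf.variance_eq[OF i1 i2])
    finally have "(m \<theta> - \<phi> \<theta>)\<^sup>2 \<le> A"
      using risk[OF \<theta>] iS by (simp add: m_def)
    then show ?thesis by (rule real_le_rsqrt[of "\<bar>m \<theta> - \<phi> \<theta>\<bar>", simplified])
  qed
  have deriv: "(m has_real_derivative d \<theta> * t) (at \<theta>)" if \<theta>: "\<theta> \<in> params" for \<theta>
  proof -
    have "((\<lambda>l. pois_exp l S) has_real_derivative d \<theta>) (at (\<theta> * t))"
      unfolding d_def by (rule expectation_poisson_has_derivative[OF _ S]) (use params_pos[OF \<theta>] assms(1) in simp)
    moreover have "((\<lambda>\<theta>. \<theta> * t) has_real_derivative t) (at \<theta>)"
      by (auto intro!: derivative_eq_intros)
    ultimately show ?thesis unfolding m_def by (rule DERIV_chain2)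
  qed
  have slope: "\<bar>d \<theta> * t\<bar> \<le> c" if \<theta>: "\<theta> \<in> params" for \<theta>
  proof -
    define l where "l = \<theta> * t"
    have l: "l > 0" using params_pos[OF \<theta>] assms(1) by (simp add: l_def)
    let ?u = "\<lambda>k. S k - \<phi> \<theta>" and ?E = "pois_exp l"
    have i2: "integrable (measure_pmf (poisson_pmf l)) (\<lambda>k. (?u k)\<^sup>2)"
      by (rule integrable_square_error) (use S \<theta> in auto)
    have ik: "integrable (measure_pmf (poisson_pmf l)) (\<lambda>k. real k * ?u k)"
      by (rule integrable_poisson_size_bias[OF l]) (use iS in simp)
    have ck: "?E (\<lambda>k. real k * ?u k) = l * ?E (\<lambda>k. ?u (Suc k))"
      by (rule expectation_poisson_size_bias[OF l]) (use iS in simp)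
    have dl: "d \<theta> = ?E (\<lambda>k. ?u (Suc k)) - ?E ?u"
      using iS by (simp add: d_def l_def)
    note iq = expectation_poisson_affine_square[OF l, of 0 "d \<theta>"]
    have eq: "(\<lambda>k. (?u k - d \<theta> * (real k - l))\<^sup>2) =
       (\<lambda>k. (?u k)\<^sup>2 - 2 * d \<theta> * (real k * ?u k - l * ?u k) + (0 + d \<theta> * (real k - l))\<^sup>2)"
      by (rule ext) (simp add: power2_eq_square algebra_simps)
    \<comment> \<open>Cauchy-Schwarz, as the nonnegative residual of u after projection onto the
      centred count: by size bias the covariance is l times \<open>d \<theta>\<close>, and the
      variance is l, so \<open>d \<theta>\<close> is the optimal coefficient.\<close>
    have "0 \<le> ?E (\<lambda>k. (?u k - d \<theta> * (real k - l))\<^sup>2)" by simp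
    also have "\<dots> = ?E (\<lambda>k. (?u k)\<^sup>2) - 2 * d \<theta> * (?E (\<lambda>k. real k * ?u k) - l * ?E ?u) + (d \<theta>)\<^sup>2 * l"
      unfolding eq using i2 ik iq iS by simp
    also have "\<dots> = ?E (\<lambda>k. (?u k)\<^sup>2) - (d \<theta>)\<^sup>2 * l"
      unfolding ck dl by (simp add: power2_eq_square algebra_simps)
    finally have "(d \<theta>)\<^sup>2 * l \<le> A" using risk[OF \<theta>] unfolding l_def by linarith
    then have "(d \<theta> * t)\<^sup>2 \<le> t * A / \<theta>"
      using params_pos[OF \<theta>] assms(1)
      by (simp add: l_def power2_eq_square field_simps)
    also have "\<dots> \<le> t * A / (\<theta>\<^sub>0 - \<eta>)"
      using params_bounds[OF \<theta>] eta A0 assms(1) by (intro divide_left_mono) auto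
    finally show ?thesis
      unfolding c_def by (intro real_le_rsqrt) simp
  qed
  have "norm (m (\<theta>\<^sub>0 + \<eta>) - m (\<theta>\<^sub>0 - \<eta>)) \<le> c * norm ((\<theta>\<^sub>0 + \<eta>) - (\<theta>\<^sub>0 - \<eta>))"
  proof (rule field_differentiable_bound[of params])
    show "convex params"
    proof -
      have "params = {\<theta>\<^sub>0 - \<eta>..\<theta>\<^sub>0 + \<eta>}" by (auto simp: params_def)
      then show ?thesis by simp
    qed
  qed (use deriv slope upper_in_params lower_in_params in \<open>auto intro: has_field_derivative_at_within\<close>)
  then have "\<bar>m (\<theta>\<^sub>0 + \<eta>) - m (\<theta>\<^sub>0 - \<eta>)\<bar> \<le> c * (2 * \<eta>)" using eta by simp
  moreover have "\<bar>\<phi> (\<theta>\<^sub>0 + \<eta>) - \<phi> (\<theta>\<^sub>0 - \<eta>) - b * (2 * \<eta>)\<bar> \<le> \<omega> * (2 * \<eta>)"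
    using near_linear[of "\<theta>\<^sub>0 + \<eta>" "\<theta>\<^sub>0 - \<eta>"] eta by simp
  moreover have "\<bar>b * (2 * \<eta>)\<bar> = \<bar>b\<bar> * (2 * \<eta>)" using eta by (simp add: abs_mult)
  \<comment> \<open>The bias at each end costs sqrt A. Divided by the length of the interval, these
    two losses become the term 1 / \<eta>.\<close>
  ultimately have "\<bar>b\<bar> * (2 * \<eta>) \<le> \<omega> * (2 * \<eta>) + c * (2 * \<eta>) + 2 * sqrt A"
    using bias[OF upper_in_params] bias[OF lower_in_params] by linarith
  then have "(\<bar>b\<bar> - \<omega>) * (2 * \<eta>) \<le> (c + sqrt A / \<eta>) * (2 * \<eta>)"
    using eta by (simp add: algebra_simps)
  then have "\<bar>b\<bar> - \<omega> \<le> c + sqrt A / \<eta>"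
    using eta by simp
  also have "c = sqrt A * sqrt (t / (\<theta>\<^sub>0 - \<eta>))"
    by (simp add: c_def real_sqrt_mult[symmetric] mult.commute)
  finally show ?thesis by (simp add: algebra_simps)
qed

lemma minimax_lower_bound:
  assumes "t > 0" "\<omega> \<le> \<bar>b\<bar>"
  shows "((\<bar>b\<bar> - \<omega>) / (1 / \<eta> + sqrt (t / (\<theta>\<^sub>0 - \<eta>))))\<^sup>2 \<le> minimax t"
proof (rule dense_ge)
  fix A assume "minimax t < A"
  then have ach: "achievable t A" by (rule achievable_of_less)
  let ?y = "1 / \<eta> + sqrt (t / (\<theta>\<^sub>0 - \<eta>))"
  have y: "?y > 0" using eta assms by (intro add_pos_nonneg) auto
  have "(\<bar>b\<bar> - \<omega>) / ?y \<le> sqrt A"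
    using achievable_lower_bound[OF assms(1) ach] y by (simp add: pos_divide_le_eq)
  moreover have "0 \<le> (\<bar>b\<bar> - \<omega>) / ?y" using y assms(2) by simp
  ultimately have "((\<bar>b\<bar> - \<omega>) / ?y)\<^sup>2 \<le> (sqrt A)\<^sup>2" by (intro power_mono)
  then show "((\<bar>b\<bar> - \<omega>) / ?y)\<^sup>2 \<le> A" using achievable_nonneg[OF ach] by simp
qed

text \<open>The estimator at the smaller exposure \<open>t * (1 - 2 * \<epsilon>)\<close> is the given one, dilated by
  \<open>1 + \<epsilon>\<close> about the right end \<open>\<theta>\<^sub>0 + \<eta>\<close> of the parameter interval and corrected by the signed
  birth and death generator \<open>G\<close>. To first order in \<open>\<epsilon>\<close> the change of the law and the correction
  cancel up to \<open>(\<lambda> - \<lambda>\<^sub>*) E (S (k + 1) - S k)\<^sup>2\<close>, which is nonpositive because the dilation is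
  centred at the right end.\<close>

lemma achievable_less_data:
  assumes "0 < t" and ach: "achievable t A" and eps: "0 < \<epsilon>" "\<epsilon> < 1/2"
    and L: "(\<theta>\<^sub>0 + \<eta>) * t \<le> L"
    and K: "K = range_bound\<^sup>2 * (296 * L\<^sup>2 + 48 * L) + 16 * \<omega> * \<eta> * range_bound + 32 * \<omega>\<^sup>2 * \<eta>\<^sup>2"
  shows "achievable (t * (1 - 2 * \<epsilon>)) ((A + (16 * \<epsilon> * \<omega> * \<eta> * range_bound + K * \<epsilon>\<^sup>2)) / (1 - 2 * \<epsilon>))"
proof -
  let ?B = range_bound
  define \<theta>s where "\<theta>s = \<theta>\<^sub>0 + \<eta>"
  define ls where "ls = \<theta>s * t"
  from ach obtain S where S: "\<And>k. \<bar>S k\<bar> \<le> ?B"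
    and risk: "\<And>\<theta>. \<theta> \<in> params \<Longrightarrow> pois_exp (\<theta> * t) (\<lambda>k. (S k - \<phi> \<theta>)\<^sup>2) \<le> A"
    unfolding achievable_def by blast
  have A0: "0 \<le> A" by (rule achievable_nonneg[OF ach])
  have B0: "0 \<le> ?B" by (rule range_bound_nonneg)
  have \<theta>s: "\<theta>s \<in> params" unfolding \<theta>s_def by (rule upper_in_params)
  have ls: "0 < ls" "ls \<le> L" using params_pos[OF \<theta>s] assms(1) L by (auto simp: ls_def \<theta>s_def)
  define D where "D k = S (Suc k) - S k" for k
  \<comment> \<open>At k = 0 the truncated \<open>k - 1\<close> is harmless, since its weight is 0.
    A genuine birth and death generator has the opposite sign in the second term.\<close>
  define G where "G k = ls * D k + real k * (S k - S (k - 1))" for k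
  \<comment> \<open>Subtracting \<open>\<epsilon> * \<phi> \<theta>s\<close> makes \<theta>s the
    fixed point of the dilation: for affine \<phi> the target satisfies \<open>\<phi> \<theta> = (1
    + \<epsilon>) * \<phi> \<theta>' - \<epsilon> * \<phi> \<theta>s\<close>.\<close>
  define T where "T k = (1 + \<epsilon>) * (S k + \<epsilon> * G k) - \<epsilon> * \<phi> \<theta>s" for k
  have D: "\<bar>D k\<bar> \<le> 2 * ?B" for k using S[of k] S[of "Suc k"] unfolding D_def by linarith
  have D': "\<bar>S k - S (k - 1)\<bar> \<le> 2 * ?B" for k using S[of k] S[of "k - 1"] by linarith
  show ?thesis
  proof (rule achievableI_expectation[where T = T])
    fix \<theta> assume \<theta>: "\<theta> \<in> params"
    \<comment> \<open>The preimage of \<theta> under the dilation. It is a convex combination of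
      \<theta> and \<theta>s and hence a parameter, at which the risk of S is controlled.\<close>
    define \<theta>' where "\<theta>' = (\<theta> + \<epsilon> * \<theta>s) / (1 + \<epsilon>)"
    have e1: "1 + \<epsilon> > 0" using eps by simp
    have \<theta>'_eq: "(1 + \<epsilon>) * \<theta>' = \<theta> + \<epsilon> * \<theta>s" using e1 by (simp add: \<theta>'_def)
    then have \<theta>eq: "\<theta> = \<theta>' + \<epsilon> * (\<theta>' - \<theta>s)" by (simp add: algebra_simps)
    have \<theta>': "\<theta>' \<in> params"
    proof -
      have "\<theta>' - \<theta>\<^sub>0 = ((\<theta> - \<theta>\<^sub>0) + \<epsilon> * (\<theta>s - \<theta>\<^sub>0)) / (1 + \<epsilon>)"
        using e1 \<theta>'_eq by (simp add: eq_divide_eq algebra_simps)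
      also have "\<bar>\<dots>\<bar> \<le> (\<eta> + \<epsilon> * \<eta>) / (1 + \<epsilon>)"
      proof -
        have "\<bar>(\<theta> - \<theta>\<^sub>0) + \<epsilon> * (\<theta>s - \<theta>\<^sub>0)\<bar> \<le> \<bar>\<theta> - \<theta>\<^sub>0\<bar> + \<epsilon> * \<bar>\<theta>s - \<theta>\<^sub>0\<bar>"
          using eps by (metis abs_mult abs_of_pos abs_triangle_ineq)
        also have "\<dots> \<le> \<eta> + \<epsilon> * \<eta>"
          using \<theta> \<theta>s eps by (intro add_mono mult_left_mono) (auto simp: params_def)
        finally show ?thesis using e1 by (simp add: divide_right_mono)
      qed
      also have "\<dots> = \<eta>" using e1 by (simp add: field_simps)
      finally show ?thesis by (simp add: params_def)
    qed
    define l where "l = \<theta>' * t"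
    define l' where "l' = \<theta> * (t * (1 - 2 * \<epsilon>))"
    have l: "0 < l" "l \<le> ls"
      using params_pos[OF \<theta>'] params_bounds[OF \<theta>'] assms(1) by (auto simp: l_def ls_def \<theta>s_def)
    have l': "0 < l'" using params_pos[OF \<theta>] assms(1) eps by (simp add: l'_def)
    have l'L: "l' \<le> L"
    proof -
      have "l' \<le> \<theta>s * (t * 1)"
        unfolding l'_def using params_bounds[OF \<theta>] params_pos[OF \<theta>] assms(1) eps
        by (intro mult_mono) (auto simp: \<theta>s_def)
      then show ?thesis using ls by (simp add: ls_def)
    qed
    \<comment> \<open>To first order the dilation moves the mean by \<epsilon> (l - ls) and the lost
      exposure by - 2 \<epsilon> l.\<close>
    have ldiff: "l' - l = - \<epsilon> * (l + ls) + 2 * \<epsilon>\<^sup>2 * (ls - l)"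
      unfolding l_def l'_def ls_def by (subst \<theta>eq) (simp add: power2_eq_square algebra_simps)
    have ldist: "\<bar>l' - l\<bar> \<le> 3 * \<epsilon> * L"
    proof -
      have "\<epsilon>\<^sup>2 * (ls - l) \<le> \<epsilon> * (1/2) * L"
        unfolding power2_eq_square using eps l ls by (intro mult_mono) auto
      moreover have "0 \<le> \<epsilon>\<^sup>2 * (ls - l)" using l by simp
      moreover have "0 \<le> \<epsilon> * (l + ls)" using eps l ls by simp
      moreover have "\<epsilon> * (l + ls) \<le> \<epsilon> * (2 * L)" using eps l ls by (intro mult_left_mono) auto
      moreover have "0 \<le> \<epsilon> * L" using eps ls by simp
      ultimately show ?thesis unfolding ldiff by simp
    qed
    let ?E = "pois_exp l" and ?E' = "pois_exp l'"
    define u where "u k = S k - \<phi> \<theta>'" for k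
    define v where "v k = u (Suc k) * D k" for k
    define q where "q k = (u k)\<^sup>2" for k
    have u: "\<bar>u k\<bar> \<le> 2 * ?B" for k unfolding u_def by (rule error_bound[OF S \<theta>'])
    have q: "\<bar>q k\<bar> \<le> 4 * ?B\<^sup>2" for k unfolding q_def u_def by (rule square_error_bound[OF S \<theta>'])
    have uD: "\<bar>u k * D k\<bar> \<le> 4 * ?B\<^sup>2" for k
      using mult_mono[OF u[of k] D[of k]] B0 by (simp add: abs_mult power2_eq_square)
    have v: "\<bar>v k\<bar> \<le> 4 * ?B\<^sup>2" for k
      using mult_mono[OF u[of "Suc k"] D[of k]] B0 by (simp add: v_def abs_mult power2_eq_square)
    have int: "integrable (measure_pmf p) q" "integrable (measure_pmf p) (\<lambda>k. q (Suc k))"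
      "integrable (measure_pmf p) (\<lambda>k. u k * D k)" "integrable (measure_pmf p) v" for p
      by (rule integrable_bounded_pmf, rule q uD v)+
    \<comment> \<open>The failure of \<phi> to be affine along \<theta>', \<theta>, \<theta>s. Both
      differences are at most \<open>near_linear\<close> on a distance of 2 \<eta>, with a factor
      \<epsilon>, which gives the 4.\<close>
    define r where "r = \<phi> \<theta> - (1 + \<epsilon>) * \<phi> \<theta>' + \<epsilon> * \<phi> \<theta>s"
    have r: "\<bar>r\<bar> \<le> 4 * \<epsilon> * \<omega> * \<eta>"
    proof -
      have "r = (\<phi> \<theta> - \<phi> \<theta>' - b * (\<theta> - \<theta>')) - \<epsilon> * (\<phi> \<theta>' - \<phi> \<theta>s - b * (\<theta>' - \<theta>s))"
      proof -
        have "\<theta> - \<theta>' = \<epsilon> * (\<theta>' - \<theta>s)" using \<theta>eq by simp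
        then have "b * (\<theta> - \<theta>') = \<epsilon> * (b * (\<theta>' - \<theta>s))" by simp
        then show ?thesis unfolding r_def
          by (simp only:) (simp add: algebra_simps)
      qed
      also have "\<bar>\<dots>\<bar> \<le> \<bar>\<phi> \<theta> - \<phi> \<theta>' - b * (\<theta> - \<theta>')\<bar> + \<epsilon> * \<bar>\<phi> \<theta>' - \<phi> \<theta>s - b * (\<theta>' - \<theta>s)\<bar>"
        using eps by (metis abs_mult abs_of_pos abs_triangle_ineq4)
      also have "\<dots> \<le> \<omega> * \<bar>\<theta> - \<theta>'\<bar> + \<epsilon> * (\<omega> * \<bar>\<theta>' - \<theta>s\<bar>)"
        using near_linear \<theta> \<theta>' \<theta>s eps by (intro add_mono mult_left_mono) (auto simp: params_def)
      also have "\<theta> - \<theta>' = \<epsilon> * (\<theta>' - \<theta>s)" using \<theta>eq by simp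
      also have "\<omega> * \<bar>\<epsilon> * (\<theta>' - \<theta>s)\<bar> + \<epsilon> * (\<omega> * \<bar>\<theta>' - \<theta>s\<bar>) = 2 * \<epsilon> * \<omega> * \<bar>\<theta>' - \<theta>s\<bar>"
        using eps by (simp add: abs_mult)
      also have "\<dots> \<le> 2 * \<epsilon> * \<omega> * (2 * \<eta>)"
        using \<theta>' \<theta>s eps omega by (intro mult_left_mono) (auto simp: params_def)
      finally show ?thesis by simp
    qed
    have Terr: "T k - \<phi> \<theta> = (1 + \<epsilon>) * (u k + \<epsilon> * G k) - r" for k
      by (simp add: T_def r_def u_def algebra_simps)
    have iG: "integrable (measure_pmf (poisson_pmf l')) (\<lambda>k. (G k)\<^sup>2)"
      and EG: "?E' (\<lambda>k. (G k)\<^sup>2) \<le> 8 * ?B\<^sup>2 * (2 * L\<^sup>2 + L)"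
    proof -
      have Gb: "(G k)\<^sup>2 \<le> 8 * ?B\<^sup>2 * (ls\<^sup>2 + (real k)\<^sup>2)" for k
      proof -
        have "(G k)\<^sup>2 \<le> 2 * (ls * D k)\<^sup>2 + 2 * (real k * (S k - S (k - 1)))\<^sup>2"
          unfolding G_def using sum_squares_bound[of "ls * D k" "real k * (S k - S (k - 1))"]
          by (simp add: power2_sum)
        also have "\<dots> = 2 * ls\<^sup>2 * (D k)\<^sup>2 + 2 * (real k)\<^sup>2 * (S k - S (k - 1))\<^sup>2"
          by (simp add: power_mult_distrib)
        also have "\<dots> \<le> 2 * ls\<^sup>2 * (2 * ?B)\<^sup>2 + 2 * (real k)\<^sup>2 * (2 * ?B)\<^sup>2"
          using D D' B0 by (intro add_mono mult_left_mono abs_le_square_iff[THEN iffD1]) auto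
        finally show ?thesis by (simp add: power_mult_distrib algebra_simps)
      qed
      have ib: "integrable (measure_pmf (poisson_pmf l')) (\<lambda>k. 8 * ?B\<^sup>2 * (ls\<^sup>2 + (real k)\<^sup>2))"
        using integrable_poisson_square[OF l'] by simp
      show iG: "integrable (measure_pmf (poisson_pmf l')) (\<lambda>k. (G k)\<^sup>2)"
        by (rule Bochner_Integration.integrable_bound[OF ib]) (use Gb in \<open>auto simp: abs_mult\<close>)
      have "?E' (\<lambda>k. (G k)\<^sup>2) \<le> ?E' (\<lambda>k. 8 * ?B\<^sup>2 * (ls\<^sup>2 + (real k)\<^sup>2))"
        by (rule integral_mono[OF iG ib]) (use Gb in auto)
      also have "\<dots> = 8 * ?B\<^sup>2 * (ls\<^sup>2 + (l'\<^sup>2 + l'))"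
        using integrable_poisson_square[OF l'] expectation_poisson_square[OF l'] by simp
      also have "\<dots> \<le> 8 * ?B\<^sup>2 * (L\<^sup>2 + (L\<^sup>2 + L))"
        using ls l' l'L by (intro mult_left_mono add_mono power_mono) auto
      finally show "?E' (\<lambda>k. (G k)\<^sup>2) \<le> 8 * ?B\<^sup>2 * (2 * L\<^sup>2 + L)" by simp
    qed
    have ikv: "integrable (measure_pmf (poisson_pmf l')) (\<lambda>k. real k * (u k * (S k - S (k - 1))))"
      and ekv: "?E' (\<lambda>k. real k * (u k * (S k - S (k - 1)))) = l' * ?E' v"
    proof -
      have eq: "(\<lambda>k. u (Suc k) * (S (Suc k) - S (Suc k - 1))) = v"
        by (simp add: v_def D_def fun_eq_iff)
      have i: "integrable (measure_pmf (poisson_pmf l')) (\<lambda>k. u (Suc k) * (S (Suc k) - S (Suc k - 1)))"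
        unfolding eq by (rule int)
      show "integrable (measure_pmf (poisson_pmf l')) (\<lambda>k. real k * (u k * (S k - S (k - 1))))"
        by (rule integrable_poisson_size_bias[OF l' i])
      show "?E' (\<lambda>k. real k * (u k * (S k - S (k - 1)))) = l' * ?E' v"
        using expectation_poisson_size_bias[OF l' i] unfolding eq .
    qed
    have uGeq: "(\<lambda>k. u k * G k) = (\<lambda>k. ls * (u k * D k) + real k * (u k * (S k - S (k - 1))))"
      by (simp add: G_def fun_eq_iff algebra_simps)
    have iuG: "integrable (measure_pmf (poisson_pmf l')) (\<lambda>k. u k * G k)"
      unfolding uGeq using ikv int by simp
    have EuG: "?E' (\<lambda>k. u k * G k) = ls * ?E' (\<lambda>k. u k * D k) + l' * ?E' v"
      unfolding uGeq using ikv int ekv by simp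
    \<comment> \<open>\<open>X1\<close>, \<open>X2\<close> and \<open>X3\<close> move the
      expectations from mean l' back to mean l. For q the first-order term has to be kept; the other
      two will be multiplied by \<epsilon>, so a Lipschitz bound is enough.\<close>
    have X1: "?E' q \<le> ?E q + (l' - l) * ?E (\<lambda>k. q (Suc k) - q k) + 144 * ?B\<^sup>2 * L\<^sup>2 * \<epsilon>\<^sup>2"
    proof -
      have "(l' - l)\<^sup>2 \<le> (3 * \<epsilon> * L)\<^sup>2" using ldist power_mono[OF ldist, of 2] by simp
      then have "4 * (4 * ?B\<^sup>2) * (l' - l)\<^sup>2 \<le> 4 * (4 * ?B\<^sup>2) * (3 * \<epsilon> * L)\<^sup>2"
        by (rule mult_left_mono) simp
      also have "\<dots> = 144 * ?B\<^sup>2 * L\<^sup>2 * \<epsilon>\<^sup>2" by (simp add: power_mult_distrib)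
      finally show ?thesis using expectation_poisson_taylor[where f = q, OF l(1) l' q] by linarith
    qed
    have lip: "2 * (4 * ?B\<^sup>2) * \<bar>l' - l\<bar> \<le> 24 * ?B\<^sup>2 * L * \<epsilon>"
      using mult_left_mono[OF ldist, of "2 * (4 * ?B\<^sup>2)"] by (simp add: mult_ac)
    have X2: "ls * ?E' (\<lambda>k. u k * D k) \<le> ls * ?E (\<lambda>k. u k * D k) + 24 * ?B\<^sup>2 * L\<^sup>2 * \<epsilon>"
    proof -
      have "?E' (\<lambda>k. u k * D k) - ?E (\<lambda>k. u k * D k) \<le> 24 * ?B\<^sup>2 * L * \<epsilon>"
        using expectation_poisson_lipschitz[where f = "\<lambda>k. u k * D k", OF l(1) l' uD] lip by linarith
      then have "ls * (?E' (\<lambda>k. u k * D k) - ?E (\<lambda>k. u k * D k)) \<le> ls * (24 * ?B\<^sup>2 * L * \<epsilon>)"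
        using ls by (intro mult_left_mono) auto
      also have "\<dots> \<le> L * (24 * ?B\<^sup>2 * L * \<epsilon>)"
        using ls eps by (intro mult_right_mono) auto
      finally show ?thesis by (simp add: power2_eq_square algebra_simps)
    qed
    have X3: "l' * ?E' v \<le> l * ?E v + 24 * ?B\<^sup>2 * L\<^sup>2 * \<epsilon> + 12 * ?B\<^sup>2 * L * \<epsilon>"
    proof -
      have "?E' v - ?E v \<le> 24 * ?B\<^sup>2 * L * \<epsilon>"
        using expectation_poisson_lipschitz[where f = v, OF l(1) l' v] lip by linarith
      then have "l' * (?E' v - ?E v) \<le> l' * (24 * ?B\<^sup>2 * L * \<epsilon>)"
        using l' by (intro mult_left_mono) auto
      also have "\<dots> \<le> L * (24 * ?B\<^sup>2 * L * \<epsilon>)"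
        using l'L ls eps by (intro mult_right_mono) auto
      finally have 1: "l' * (?E' v - ?E v) \<le> 24 * ?B\<^sup>2 * L\<^sup>2 * \<epsilon>" by (simp add: power2_eq_square mult_ac)
      have "(l' - l) * ?E v \<le> \<bar>l' - l\<bar> * \<bar>?E v\<bar>" by (metis abs_ge_self abs_mult)
      also have "\<dots> \<le> (3 * \<epsilon> * L) * (4 * ?B\<^sup>2)"
        using ldist abs_expectation_le[where f = v, OF v] eps ls by (intro mult_mono) auto
      finally have 2: "(l' - l) * ?E v \<le> 12 * ?B\<^sup>2 * L * \<epsilon>" by (simp add: mult_ac)
      have "l' * ?E' v = l * ?E v + l' * (?E' v - ?E v) + (l' - l) * ?E v" by (simp add: algebra_simps)
      with 1 2 show ?thesis by linarith
    qed
    \<comment> \<open>The signs in \<open>G\<close> are chosen for this: the increment of q is D (u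
      k + u (k + 1)), so both sides differ by (ls - l) D^2, and l \<le> ls because no parameter
      exceeds \<theta>s.\<close>
    have X4: "2 * (ls * ?E (\<lambda>k. u k * D k) + l * ?E v) \<le> (ls + l) * ?E (\<lambda>k. q (Suc k) - q k)"
    proof -
      have "?E (\<lambda>k. 2 * (ls * (u k * D k) + l * v k)) \<le> ?E (\<lambda>k. (ls + l) * (q (Suc k) - q k))"
      proof (rule integral_mono)
        fix k
        have "(ls + l) * (q (Suc k) - q k) - 2 * (ls * (u k * D k) + l * v k) = (ls - l) * (D k)\<^sup>2"
          by (simp add: q_def v_def u_def D_def power2_eq_square algebra_simps)
        moreover have "0 \<le> (ls - l) * (D k)\<^sup>2" using l by simp
        ultimately show "2 * (ls * (u k * D k) + l * v k) \<le> (ls + l) * (q (Suc k) - q k)" by linarith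
      qed (use int in auto)
      moreover have "?E (\<lambda>k. 2 * (ls * (u k * D k) + l * v k)) = 2 * (ls * ?E (\<lambda>k. u k * D k) + l * ?E v)"
        using int by simp
      moreover have "?E (\<lambda>k. (ls + l) * (q (Suc k) - q k)) = (ls + l) * ?E (\<lambda>k. q (Suc k) - q k)" by simp
      ultimately show ?thesis by simp
    qed
    have main: "?E' q + 2 * \<epsilon> * ?E' (\<lambda>k. u k * G k) \<le> A + ?B\<^sup>2 * (264 * L\<^sup>2 + 32 * L) * \<epsilon>\<^sup>2"
    proof -
      let ?g = "?E (\<lambda>k. q (Suc k) - q k)"
      have "\<bar>?g\<bar> \<le> 4 * ?B\<^sup>2"
      proof (rule abs_expectation_le)
        fix k
        have "0 \<le> q k" "0 \<le> q (Suc k)" by (auto simp: q_def)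
        then show "\<bar>q (Suc k) - q k\<bar> \<le> 4 * ?B\<^sup>2" using q[of k] q[of "Suc k"] by linarith
      qed
      then have "(ls - l) * ?g \<le> (ls - l) * (4 * ?B\<^sup>2)"
        using l by (intro mult_left_mono) auto
      also have "\<dots> \<le> L * (4 * ?B\<^sup>2)"
        using ls l by (intro mult_right_mono) auto
      finally have "(ls - l) * ?g \<le> L * (4 * ?B\<^sup>2)" .
      then have "2 * \<epsilon>\<^sup>2 * ((ls - l) * ?g) \<le> 2 * \<epsilon>\<^sup>2 * (L * (4 * ?B\<^sup>2))"
        by (rule mult_left_mono) simp
      then have G1: "2 * \<epsilon>\<^sup>2 * ((ls - l) * ?g) \<le> 8 * ?B\<^sup>2 * L * \<epsilon>\<^sup>2" by (simp add: mult_ac)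
      have "2 * \<epsilon> * ?E' (\<lambda>k. u k * G k) \<le>
          2 * \<epsilon> * (ls * ?E (\<lambda>k. u k * D k) + l * ?E v + 48 * ?B\<^sup>2 * L\<^sup>2 * \<epsilon> + 12 * ?B\<^sup>2 * L * \<epsilon>)"
        using X2 X3 eps unfolding EuG by (intro mult_left_mono) auto
      also have "\<dots> = \<epsilon> * (2 * (ls * ?E (\<lambda>k. u k * D k) + l * ?E v)) + 96 * ?B\<^sup>2 * L\<^sup>2 * \<epsilon>\<^sup>2 + 24 * ?B\<^sup>2 * L * \<epsilon>\<^sup>2"
        by (simp add: power2_eq_square algebra_simps)
      also have "\<dots> \<le> \<epsilon> * ((ls + l) * ?g) + 96 * ?B\<^sup>2 * L\<^sup>2 * \<epsilon>\<^sup>2 + 24 * ?B\<^sup>2 * L * \<epsilon>\<^sup>2"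
        using X4 eps by (intro add_right_mono mult_left_mono) auto
      finally have G2: "2 * \<epsilon> * ?E' (\<lambda>k. u k * G k) \<le> \<epsilon> * ((ls + l) * ?g) + 96 * ?B\<^sup>2 * L\<^sup>2 * \<epsilon>\<^sup>2 + 24 * ?B\<^sup>2 * L * \<epsilon>\<^sup>2" .
      have G3: "(l' - l) * ?g = - (\<epsilon> * ((ls + l) * ?g)) + 2 * \<epsilon>\<^sup>2 * ((ls - l) * ?g)"
        unfolding ldiff by (simp add: algebra_simps)
      have G4: "?E q \<le> A" using risk[OF \<theta>'] by (simp add: q_def[abs_def] u_def l_def)
      \<comment> \<open>The 144 is from \<open>X1\<close>, the 96 and the first 24 from
        \<open>X2\<close> and \<open>X3\<close> times 2 \<epsilon>, the 8 from \<open>G1\<close>;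
        the last term is padding.\<close>
      have G5: "?B\<^sup>2 * (264 * L\<^sup>2 + 32 * L) * \<epsilon>\<^sup>2 =
        144 * ?B\<^sup>2 * L\<^sup>2 * \<epsilon>\<^sup>2 + 96 * ?B\<^sup>2 * L\<^sup>2 * \<epsilon>\<^sup>2 + 24 * ?B\<^sup>2 * L * \<epsilon>\<^sup>2 + 8 * ?B\<^sup>2 * L * \<epsilon>\<^sup>2 + 24 * ?B\<^sup>2 * L\<^sup>2 * \<epsilon>\<^sup>2"
        by (simp add: algebra_simps)
      have G6: "0 \<le> 24 * ?B\<^sup>2 * L\<^sup>2 * \<epsilon>\<^sup>2" by simp
      show ?thesis using X1 G1 G2 G3 G4 G5 G6 by linarith
    qed
    define C where "C = 16 * (1 + \<epsilon>) * \<epsilon> * \<omega> * \<eta> * ?B + 32 * \<epsilon>\<^sup>2 * \<omega>\<^sup>2 * \<eta>\<^sup>2"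
    \<comment> \<open>A majorant of the squared error without r: the cross term of r with u is
      bounded uniformly, the rest by (a - r)^2 \<le> 2 a^2 + 2 r^2. The constant C collects both
      costs.\<close>
    define R where "R k = (1 + \<epsilon>)\<^sup>2 * (q k + 2 * \<epsilon> * (u k * G k) + 2 * \<epsilon>\<^sup>2 * (G k)\<^sup>2) + C" for k
    have TR: "(T k - \<phi> \<theta>)\<^sup>2 \<le> R k" for k
    proof -
      have "(T k - \<phi> \<theta>)\<^sup>2 = ((1 + \<epsilon>) * u k)\<^sup>2 + 2 * ((1 + \<epsilon>) * u k) * ((1 + \<epsilon>) * (\<epsilon> * G k)) -
          2 * ((1 + \<epsilon>) * u k) * r + ((1 + \<epsilon>) * (\<epsilon> * G k) - r)\<^sup>2"
        unfolding Terr by (simp add: power2_eq_square algebra_simps)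
      moreover have "((1 + \<epsilon>) * (\<epsilon> * G k) - r)\<^sup>2 \<le> 2 * ((1 + \<epsilon>) * (\<epsilon> * G k))\<^sup>2 + 2 * r\<^sup>2"
        using zero_le_power2[of "(1 + \<epsilon>) * (\<epsilon> * G k) + r"] by (simp add: power2_sum power2_diff)
      moreover have "r\<^sup>2 \<le> 16 * \<epsilon>\<^sup>2 * \<omega>\<^sup>2 * \<eta>\<^sup>2"
        using power_mono[OF r, of 2] by (simp add: power_mult_distrib)
      moreover have "- (2 * ((1 + \<epsilon>) * u k) * r) \<le> 16 * (1 + \<epsilon>) * \<epsilon> * \<omega> * \<eta> * ?B"
      proof -
        have "- (u k * r) \<le> \<bar>u k\<bar> * \<bar>r\<bar>" by (metis abs_ge_minus_self abs_mult)
        also have "\<dots> \<le> (2 * ?B) * (4 * \<epsilon> * \<omega> * \<eta>)"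
          using u r B0 by (intro mult_mono) auto
        finally have "2 * (1 + \<epsilon>) * (- (u k * r)) \<le> 2 * (1 + \<epsilon>) * ((2 * ?B) * (4 * \<epsilon> * \<omega> * \<eta>))"
          using e1 by (intro mult_left_mono) auto
        then show ?thesis by (simp add: mult_ac)
      qed
      moreover have "R k = ((1 + \<epsilon>) * u k)\<^sup>2 + 2 * ((1 + \<epsilon>) * u k) * ((1 + \<epsilon>) * (\<epsilon> * G k)) +
          2 * ((1 + \<epsilon>) * (\<epsilon> * G k))\<^sup>2 + C"
        by (simp add: R_def q_def power2_eq_square algebra_simps)
      ultimately show ?thesis unfolding C_def by linarith
    qed
    have iR: "integrable (measure_pmf (poisson_pmf l')) R"
      unfolding R_def using int iuG iG by simp
    have iT: "integrable (measure_pmf (poisson_pmf l')) (\<lambda>k. (T k - \<phi> \<theta>)\<^sup>2)"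
    proof (rule Bochner_Integration.integrable_bound[OF iR])
      show "AE k in measure_pmf (poisson_pmf l'). norm ((T k - \<phi> \<theta>)\<^sup>2) \<le> norm (R k)"
        using TR by (intro AE_I2) (auto intro: order_trans[OF _ abs_ge_self])
    qed simp
    then show "integrable (measure_pmf (poisson_pmf (\<theta> * (t * (1 - 2 * \<epsilon>))))) (\<lambda>k. (T k - \<phi> \<theta>)\<^sup>2)"
      unfolding l'_def .
    have "?E' (\<lambda>k. (T k - \<phi> \<theta>)\<^sup>2) \<le> ?E' R" by (rule integral_mono[OF iT iR TR])
    also have "\<dots> = (1 + \<epsilon>)\<^sup>2 * (?E' q + 2 * \<epsilon> * ?E' (\<lambda>k. u k * G k) + 2 * \<epsilon>\<^sup>2 * ?E' (\<lambda>k. (G k)\<^sup>2)) + C"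
      unfolding R_def using int iuG iG by simp
    also have "\<dots> \<le> (1 + \<epsilon>)\<^sup>2 * (A + ?B\<^sup>2 * (264 * L\<^sup>2 + 32 * L) * \<epsilon>\<^sup>2 + 2 * \<epsilon>\<^sup>2 * (8 * ?B\<^sup>2 * (2 * L\<^sup>2 + L))) + C"
      using EG by (intro add_right_mono mult_left_mono add_mono[OF main]) auto
    also have "A + ?B\<^sup>2 * (264 * L\<^sup>2 + 32 * L) * \<epsilon>\<^sup>2 + 2 * \<epsilon>\<^sup>2 * (8 * ?B\<^sup>2 * (2 * L\<^sup>2 + L)) =
        A + ?B\<^sup>2 * (296 * L\<^sup>2 + 48 * L) * \<epsilon>\<^sup>2"
      by (simp add: algebra_simps)
    finally have risk_bound: "?E' (\<lambda>k. (T k - \<phi> \<theta>)\<^sup>2) \<le> (1 + \<epsilon>)\<^sup>2 * (A + ?B\<^sup>2 * (296 * L\<^sup>2 + 48 * L) * \<epsilon>\<^sup>2) + C" .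
    have p: "0 < 1 - 2 * \<epsilon>" using eps by simp
    let ?Q = "A + ?B\<^sup>2 * (296 * L\<^sup>2 + 48 * L) * \<epsilon>\<^sup>2"
    have Q0: "0 \<le> ?Q" using A0 ls by simp
    have C0: "0 \<le> C" unfolding C_def using eps omega eta B0 by simp
    \<comment> \<open>Dilation inflates the risk by (1 + \<epsilon>)^2. The exposure is cut by 1 - 2
      \<epsilon> precisely to offset this to first order, so exposure times risk does not
      grow.\<close>
    have "(1 + \<epsilon>)\<^sup>2 * (1 - 2 * \<epsilon>) = 1 - (3 * \<epsilon>\<^sup>2 + 2 * \<epsilon>\<^sup>2 * \<epsilon>)"
      by (simp add: power2_eq_square algebra_simps)
    also have "\<dots> \<le> 1"
    proof -
      have "0 \<le> 3 * \<epsilon>\<^sup>2 + 2 * \<epsilon>\<^sup>2 * \<epsilon>" using eps by (intro add_nonneg_nonneg mult_nonneg_nonneg) auto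
      then show ?thesis by linarith
    qed
    finally have "((1 + \<epsilon>)\<^sup>2 * (1 - 2 * \<epsilon>)) * ?Q \<le> 1 * ?Q" using Q0 by (rule mult_right_mono)
    moreover have "C * (1 - 2 * \<epsilon>) \<le> C * 1" using C0 eps by (intro mult_left_mono) auto
    moreover have "?Q + C = A + (16 * \<epsilon> * \<omega> * \<eta> * ?B + K * \<epsilon>\<^sup>2)"
      unfolding K C_def by (simp add: power2_eq_square algebra_simps)
    ultimately have "((1 + \<epsilon>)\<^sup>2 * ?Q + C) * (1 - 2 * \<epsilon>) \<le> A + (16 * \<epsilon> * \<omega> * \<eta> * ?B + K * \<epsilon>\<^sup>2)"
      by (simp add: algebra_simps)
    then have "(1 + \<epsilon>)\<^sup>2 * ?Q + C \<le> (A + (16 * \<epsilon> * \<omega> * \<eta> * ?B + K * \<epsilon>\<^sup>2)) / (1 - 2 * \<epsilon>)"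
      using p by (simp add: pos_le_divide_eq)
    with risk_bound show "pois_exp (\<theta> * (t * (1 - 2 * \<epsilon>))) (\<lambda>k. (T k - \<phi> \<theta>)\<^sup>2) \<le>
      (A + (16 * \<epsilon> * \<omega> * \<eta> * ?B + K * \<epsilon>\<^sup>2)) / (1 - 2 * \<epsilon>)"
      unfolding l'_def by (rule order_trans)
  qed
qed

text \<open>One step in terms of exposure times risk. Its error refers to the upper end
  \<open>t\<^sub>1\<close>, so that a single pair L, K serves every step of the iteration.\<close>

lemma minimax_less_data_step:
  assumes "0 < t" "t \<le> t\<^sub>1" "0 < \<epsilon>" "\<epsilon> < 1/2" and L: "L = (\<theta>\<^sub>0 + \<eta>) * t\<^sub>1"
    and K: "K = range_bound\<^sup>2 * (296 * L\<^sup>2 + 48 * L) + 16 * \<omega> * \<eta> * range_bound + 32 * \<omega>\<^sup>2 * \<eta>\<^sup>2"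
  shows "t * (1 - 2 * \<epsilon>) * minimax (t * (1 - 2 * \<epsilon>)) \<le>
    t * minimax t + t\<^sub>1 * (16 * \<epsilon> * \<omega> * \<eta> * range_bound + K * \<epsilon>\<^sup>2)"
proof -
  let ?c = "16 * \<epsilon> * \<omega> * \<eta> * range_bound + K * \<epsilon>\<^sup>2"
  have p: "0 < 1 - 2 * \<epsilon>" using assms by simp
  have "(\<theta>\<^sub>0 + \<eta>) * t \<le> L" using assms eta by (auto intro: mult_left_mono)
  then have "achievable (t * (1 - 2 * \<epsilon>)) (1 / (1 - 2 * \<epsilon>) * A + ?c / (1 - 2 * \<epsilon>))"
    if "achievable t A" for A
    using achievable_less_data[OF assms(1) that assms(3,4) _ K] by (simp add: add_divide_distrib)
  then have "minimax (t * (1 - 2 * \<epsilon>)) \<le> 1 / (1 - 2 * \<epsilon>) * minimax t + ?c / (1 - 2 * \<epsilon>)"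
    using p by (intro minimax_transfer) auto
  then have "(1 - 2 * \<epsilon>) * minimax (t * (1 - 2 * \<epsilon>)) \<le> minimax t + ?c"
    using p by (simp add: add_divide_distrib[symmetric] pos_le_divide_eq mult.commute)
  then have "t * ((1 - 2 * \<epsilon>) * minimax (t * (1 - 2 * \<epsilon>))) \<le> t * (minimax t + ?c)"
    using assms(1) by (intro mult_left_mono) auto
  also have "\<dots> \<le> t * minimax t + t\<^sub>1 * ?c"
  proof -
    have "0 \<le> L" using L assms eta by simp
    then have "0 \<le> ?c" unfolding K using assms omega eta range_bound_nonneg
      by (intro add_nonneg_nonneg mult_nonneg_nonneg) auto
    with assms(2) have "t * ?c \<le> t\<^sub>1 * ?c" by (rule mult_right_mono)
    then show ?thesis by (simp only: distrib_left[of t "minimax t"] add_left_mono)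
  qed
  finally show ?thesis by (simp add: mult.assoc)
qed

text \<open>With J equal steps on the scale of ln t, the errors linear in \<epsilon> add up to a
  multiple of ln (t / t'), while those quadratic in \<epsilon> add up to order 1 / J. Letting J tend
  to infinity removes K, which grows with the exposure.\<close>

lemma minimax_less_data:
  assumes "0 < t'" "t' < t"
  shows "t' * minimax t' \<le> t * minimax t + 8 * t * ln (t / t') * \<omega> * \<eta> * range_bound"
proof -
  define \<tau> where "\<tau> = ln (t / t')"
  have \<tau>: "\<tau> > 0" using assms by (simp add: \<tau>_def)
  define L where "L = (\<theta>\<^sub>0 + \<eta>) * t"
  define K where "K = range_bound\<^sup>2 * (296 * L\<^sup>2 + 48 * L) + 16 * \<omega> * \<eta> * range_bound + 32 * \<omega>\<^sup>2 * \<eta>\<^sup>2"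
  have L0: "0 \<le> L" using assms eta by (simp add: L_def)
  have K0: "0 \<le> K" unfolding K_def using L0 omega eta range_bound_nonneg by simp
  let ?w = "\<omega> * \<eta> * range_bound"
  have w0: "0 \<le> ?w" using omega eta range_bound_nonneg by simp
  have bound: "t' * minimax t' \<le> t * minimax t + (8 * t * \<tau> * ?w + t * K * \<tau>\<^sup>2 / 4 * (1 / real (Suc n)))" for n
  proof -
    define J where "J = Suc n"
    define \<delta> where "\<delta> = \<tau> / real J"
    have J: "real J > 0" by (simp add: J_def)
    have \<delta>: "\<delta> > 0" using \<tau> J by (simp add: \<delta>_def)
    \<comment> \<open>Then 1 - 2 \<epsilon> = exp (- \<delta>), so that J steps multiply t by
      exactly t' / t, and \<epsilon> stays below 1/2.\<close>
    define \<epsilon> where "\<epsilon> = (1 - exp (- \<delta>)) / 2"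
    have eps: "0 < \<epsilon>" "\<epsilon> < 1/2" using \<delta> by (auto simp: \<epsilon>_def)
    have eps\<delta>: "\<epsilon> \<le> \<delta> / 2" using exp_ge_add_one_self[of "- \<delta>"] by (simp add: \<epsilon>_def)
    have eq: "1 - 2 * \<epsilon> = exp (- \<delta>)" by (simp add: \<epsilon>_def diff_divide_distrib)
    define e where "e = t * (16 * \<epsilon> * \<omega> * \<eta> * range_bound + K * \<epsilon>\<^sup>2)"
    have iter: "t * exp (- (real j * \<delta>)) * minimax (t * exp (- (real j * \<delta>))) \<le> t * minimax t + real j * e" for j
    proof (induction j)
      case (Suc j)
      let ?s = "t * exp (- (real j * \<delta>))"
      have s: "0 < ?s" "?s \<le> t" using assms \<delta> by auto
      have step: "?s * (1 - 2 * \<epsilon>) = t * exp (- (real (Suc j) * \<delta>))"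
        unfolding eq mult.assoc exp_add[symmetric] by (simp add: algebra_simps)
      have "?s * (1 - 2 * \<epsilon>) * minimax (?s * (1 - 2 * \<epsilon>)) \<le> ?s * minimax ?s + e"
        unfolding e_def by (rule minimax_less_data_step[OF s eps L_def K_def])
      with Suc show ?case unfolding step by (simp add: algebra_simps)
    qed simp
    have "t * exp (- (real J * \<delta>)) = t'"
      using J assms by (simp add: \<delta>_def \<tau>_def exp_minus)
    with iter[of J] have "t' * minimax t' \<le> t * minimax t + real J * e" by simp
    also have "real J * e \<le> real J * (t * (16 * (\<delta> / 2) * ?w + K * (\<delta> / 2)\<^sup>2))"
    proof -
      have "16 * \<epsilon> * ?w + K * \<epsilon>\<^sup>2 \<le> 16 * (\<delta> / 2) * ?w + K * (\<delta> / 2)\<^sup>2"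
        using eps eps\<delta> K0 omega eta range_bound_nonneg by (intro add_mono mult_mono power_mono) auto
      then show ?thesis unfolding e_def using J assms
        by (intro mult_left_mono) (auto simp: mult.assoc)
    qed
    also have "\<dots> = 8 * t * (real J * \<delta>) * ?w + t * K * (real J * \<delta>)\<^sup>2 / 4 * (1 / real J)"
      using J by (simp add: power2_eq_square field_simps)
    also have "real J * \<delta> = \<tau>" using J by (simp add: \<delta>_def)
    finally show ?thesis by (simp add: J_def)
  qed
  have "(\<lambda>n. t * minimax t + (8 * t * \<tau> * ?w + t * K * \<tau>\<^sup>2 / 4 * (1 / real (Suc n)))) \<longlonglongrightarrow>
      t * minimax t + (8 * t * \<tau> * ?w + t * K * \<tau>\<^sup>2 / 4 * 0)"
    by (intro tendsto_intros lim_1_over_n[THEN LIMSEQ_Suc])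
  then have "t' * minimax t' \<le> t * minimax t + (8 * t * \<tau> * ?w + t * K * \<tau>\<^sup>2 / 4 * 0)"
    by (rule LIMSEQ_le_const) (use bound in auto)
  then show ?thesis by (simp add: \<tau>_def mult.assoc)
qed

section \<open>From n counts to one count\<close>

text \<open>The affine target covers both scales: c = sqrt n, d = 0 for the local risk, and c = 1,
  \<open>d = \<psi> \<theta>\<^sub>0\<close> for the original one. An estimator from one count is
  applied to the total; conversely Rao-Blackwell reduces any estimator to the total.\<close>

lemma sample_minimax_risk:
  assumes "n > 0" "x > 0" "c > 0"
  shows "(INF T :: (nat \<Rightarrow> nat) \<Rightarrow> real. SUP \<theta>\<in>params.
      \<integral>\<^sup>+ y. ennreal ((T y - (c * \<phi> \<theta> + d))\<^sup>2) \<partial>measure_pmf (poisson_sample n \<theta> x)) =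
    ennreal (c\<^sup>2 * minimax (real n / x))"
    (is "(INF T. SUP \<theta>\<in>_. ?R T \<theta>) = ennreal (_ * minimax ?t)")
proof (rule antisym)
  let ?f = "\<lambda>y :: nat \<Rightarrow> nat. \<Sum>i<n. y i"
  have law: "map_pmf ?f (poisson_sample n \<theta> x) = poisson_pmf (\<theta> * ?t)" if "\<theta> \<in> params" for \<theta>
    by (rule map_sum_poisson_sample) (use assms params_pos[OF that] in auto)
  show "(INF T. SUP \<theta>\<in>params. ?R T \<theta>) \<le> ennreal (c\<^sup>2 * minimax ?t)"
  proof (rule ennreal_le_epsilon)
    fix e :: real assume "e > 0"
    define A where "A = minimax ?t + e / c\<^sup>2"
    have "achievable ?t A"
      by (rule achievable_of_less) (use \<open>e > 0\<close> assms in \<open>simp add: A_def\<close>)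
    then obtain S where S: "\<And>k. \<bar>S k\<bar> \<le> range_bound"
      and risk: "\<And>\<theta>. \<theta> \<in> params \<Longrightarrow> pois_exp (\<theta> * ?t) (\<lambda>k. (S k - \<phi> \<theta>)\<^sup>2) \<le> A"
      unfolding achievable_def by blast
    have "?R (\<lambda>y. c * S (?f y) + d) \<theta> \<le> ennreal (c\<^sup>2 * A)" if \<theta>: "\<theta> \<in> params" for \<theta>
    proof -
      have i: "integrable (measure_pmf p) (\<lambda>k. (S k - \<phi> \<theta>)\<^sup>2)" for p
        by (rule integrable_square_error) (use S \<theta> in auto)
      have "?R (\<lambda>y. c * S (?f y) + d) \<theta> =
          (\<integral>\<^sup>+k. ennreal (c\<^sup>2 * (S k - \<phi> \<theta>)\<^sup>2) \<partial>measure_pmf (map_pmf ?f (poisson_sample n \<theta> x)))"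
        by (simp add: power_mult_distrib[symmetric] right_diff_distrib)
      also have "\<dots> = ennreal (pois_exp (\<theta> * ?t) (\<lambda>k. c\<^sup>2 * (S k - \<phi> \<theta>)\<^sup>2))"
        unfolding law[OF \<theta>] using i by (intro nn_integral_eq_integral) auto
      also have "\<dots> \<le> ennreal (c\<^sup>2 * A)"
        using risk[OF \<theta>] by (intro ennreal_leI) (simp add: mult_left_mono)
      finally show ?thesis .
    qed
    then have "(SUP \<theta>\<in>params. ?R (\<lambda>y. c * S (?f y) + d) \<theta>) \<le> ennreal (c\<^sup>2 * A)"
      by (rule SUP_least)
    then have "(INF T. SUP \<theta>\<in>params. ?R T \<theta>) \<le> ennreal (c\<^sup>2 * A)"
      by (rule INF_lower2[of "\<lambda>y. c * S (?f y) + d" UNIV, OF UNIV_I])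
    also have "c\<^sup>2 * A = c\<^sup>2 * minimax ?t + e" using assms by (simp add: A_def distrib_left)
    also have "ennreal \<dots> = ennreal (c\<^sup>2 * minimax ?t) + ennreal e"
      using \<open>e > 0\<close> minimax_nonneg by (intro ennreal_plus) auto
    finally show "(INF T. SUP \<theta>\<in>params. ?R T \<theta>) \<le> ennreal (c\<^sup>2 * minimax ?t) + ennreal e" .
  qed
  show "ennreal (c\<^sup>2 * minimax ?t) \<le> (INF T. SUP \<theta>\<in>params. ?R T \<theta>)"
  proof (rule INF_greatest)
    fix T :: "(nat \<Rightarrow> nat) \<Rightarrow> real"
    show "ennreal (c\<^sup>2 * minimax ?t) \<le> (SUP \<theta>\<in>params. ?R T \<theta>)"
    \<comment> \<open>An estimator of infinite worst-case risk respects every lower bound.\<close>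
    proof (cases "SUP \<theta>\<in>params. ?R T \<theta>")
      case (real A)
      have "\<exists>S. \<forall>\<theta>\<in>params. \<forall>a.
          (\<integral>\<^sup>+s. ennreal ((S s - a)\<^sup>2) \<partial>measure_pmf (map_pmf ?f (poisson_sample n \<theta> x)))
          \<le> (\<integral>\<^sup>+y. ennreal ((T y - a)\<^sup>2) \<partial>measure_pmf (poisson_sample n \<theta> x))"
        by (rule rao_blackwell[where g = "\<lambda>\<theta> s. \<theta> ^ s * exp (- ((\<theta> - 1) * (real n / x)))",
              OF pmf_poisson_sample]) (use params_pos assms in simp_all)
      then obtain S where S: "\<And>\<theta> a. \<theta> \<in> params \<Longrightarrow>
          (\<integral>\<^sup>+s. ennreal ((S s - a)\<^sup>2) \<partial>measure_pmf (map_pmf ?f (poisson_sample n \<theta> x)))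
          \<le> (\<integral>\<^sup>+y. ennreal ((T y - a)\<^sup>2) \<partial>measure_pmf (poisson_sample n \<theta> x))"
        by blast
      have "achievable ?t (A / c\<^sup>2)"
      proof (rule achievableI[where T = "\<lambda>k. (S k - d) / c"])
        show "0 \<le> A / c\<^sup>2" using real by simp
        fix \<theta> assume \<theta>: "\<theta> \<in> params"
        have "(\<integral>\<^sup>+k. ennreal ((S k - (c * \<phi> \<theta> + d))\<^sup>2) \<partial>measure_pmf (poisson_pmf (\<theta> * ?t))) \<le> ?R T \<theta>"
          using S[OF \<theta>] unfolding law[OF \<theta>] .
        also have "\<dots> \<le> (SUP \<theta>\<in>params. ?R T \<theta>)" by (rule SUP_upper[OF \<theta>])
        finally have le: "(\<integral>\<^sup>+k. ennreal ((S k - (c * \<phi> \<theta> + d))\<^sup>2) \<partial>measure_pmf (poisson_pmf (\<theta> * ?t))) \<le> ennreal A"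
          using real by simp
        have "((S k - d) / c - \<phi> \<theta>)\<^sup>2 = 1 / c\<^sup>2 * (S k - (c * \<phi> \<theta> + d))\<^sup>2" for k
        proof -
          have "(S k - d) / c - \<phi> \<theta> = (S k - (c * \<phi> \<theta> + d)) / c"
            using assms by (simp add: diff_divide_distrib add_divide_distrib)
          then show ?thesis by (simp add: power_divide)
        qed
        then have "(\<integral>\<^sup>+k. ennreal (((S k - d) / c - \<phi> \<theta>)\<^sup>2) \<partial>measure_pmf (poisson_pmf (\<theta> * ?t))) =
            ennreal (1 / c\<^sup>2) * (\<integral>\<^sup>+k. ennreal ((S k - (c * \<phi> \<theta> + d))\<^sup>2) \<partial>measure_pmf (poisson_pmf (\<theta> * ?t)))"
          by (simp add: ennreal_mult nn_integral_cmult del: times_divide_eq_left)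
        also have "\<dots> \<le> ennreal (1 / c\<^sup>2) * ennreal A" by (rule mult_left_mono[OF le]) simp
        also have "\<dots> = ennreal (A / c\<^sup>2)" using real by (simp add: ennreal_mult[symmetric])
        finally show "(\<integral>\<^sup>+k. ennreal (((S k - d) / c - \<phi> \<theta>)\<^sup>2) \<partial>measure_pmf (poisson_pmf (\<theta> * ?t)))
            \<le> ennreal (A / c\<^sup>2)" .
      qed
      then have "minimax ?t \<le> A / c\<^sup>2" by (rule minimax_le)
      then have "c\<^sup>2 * minimax ?t \<le> A" using assms by (simp add: pos_le_divide_eq mult.commute)
      with real show ?thesis by (simp add: ennreal_leI)
    next
      case top
      then show ?thesis by (simp only: top_greatest)
    qed
  qed
qed

lemma orig_risk_eq:
  assumes "n > 0" "x > 0" and \<phi>: "\<And>\<theta>. \<phi> \<theta> = \<psi> \<theta> - \<psi> \<theta>\<^sub>0" and H: "\<eta> = H / sqrt n"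
  shows "orig_risk \<psi> \<theta>\<^sub>0 n H (\<theta>\<^sub>0 * x) = ennreal (minimax (real n / x))"
  using sample_minimax_risk[OF assms(1,2), of 1 "\<psi> \<theta>\<^sub>0"] eta
  by (simp add: orig_risk_def params_def \<phi> H[symmetric])

lemma local_risk_eq:
  assumes "n > 0" "x > 0" and \<phi>: "\<And>\<theta>. \<phi> \<theta> = \<psi> \<theta> - \<psi> \<theta>\<^sub>0" and H: "\<eta> = H / sqrt n"
  shows "local_risk \<psi> \<theta>\<^sub>0 n H (\<theta>\<^sub>0 * x) = ennreal (real n * minimax (real n / x))"
proof -
  have img: "(\<lambda>h. \<theta>\<^sub>0 + h / sqrt n) ` {h. \<bar>h\<bar> \<le> H} = params"
  proof (intro equalityI subsetI)
    fix \<theta> assume "\<theta> \<in> params"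
    then have "\<bar>\<theta> - \<theta>\<^sub>0\<bar> \<le> H / sqrt n" by (simp add: params_def H[symmetric])
    then have "\<bar>(\<theta> - \<theta>\<^sub>0) * sqrt n\<bar> \<le> H" "\<theta> = \<theta>\<^sub>0 + ((\<theta> - \<theta>\<^sub>0) * sqrt n) / sqrt n"
      using assms(1) by (simp_all add: abs_mult pos_le_divide_eq)
    then show "\<theta> \<in> (\<lambda>h. \<theta>\<^sub>0 + h / sqrt n) ` {h. \<bar>h\<bar> \<le> H}" by blast
  qed (use assms(1) in \<open>auto simp: params_def, simp add: H divide_right_mono\<close>)
  have "local_risk \<psi> \<theta>\<^sub>0 n H (\<theta>\<^sub>0 * x) = (INF T. SUP \<theta>\<in>params.
      \<integral>\<^sup>+ y. ennreal ((T y - (sqrt n * \<phi> \<theta> + 0))\<^sup>2) \<partial>measure_pmf (poisson_sample n \<theta> x))"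
    unfolding local_risk_def img[symmetric] using eta by (simp add: local_psi_def \<phi> image_image)
  also have "\<dots> = ennreal ((sqrt n)\<^sup>2 * minimax (real n / x))"
    by (rule sample_minimax_risk) (use assms in auto)
  finally show ?thesis by simp
qed

end

section \<open>Covering radius\<close>

abbreviation menu_dist :: "'a::metric_space set \<Rightarrow> 'a \<Rightarrow> real" where
  "menu_dist V s \<equiv> Min ((\<lambda>z. dist s z) ` V)"

lemma menusD:
  assumes "V \<in> menus M k"
  shows "finite V" "V \<noteq> {}" "V \<subseteq> M" "card V \<le> k"
  using assms by (auto simp: menus_def intro!: card_ge_0_finite)

lemma menus_nonempty:
  assumes "M \<noteq> {}" "1 \<le> k"
  shows "menus M k \<noteq> {}"
proof -
  from assms(1) obtain z where "z \<in> M" by blast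
  then have "{z} \<in> menus M k" using assms(2) by (simp add: menus_def)
  then show ?thesis by blast
qed

lemma menu_dist_nonneg: "finite V \<Longrightarrow> V \<noteq> {} \<Longrightarrow> 0 \<le> menu_dist V s"
  by simp

lemma menu_value_eq:
  assumes "finite V" "V \<noteq> {}" "0 < \<theta>\<^sub>0" "0 < \<kappa>"
  shows "menu_value \<theta>\<^sub>0 x\<^sub>0 \<kappa> V q = \<theta>\<^sub>0 * (x\<^sub>0 + \<kappa> * (menu_dist V q)\<^sup>2)"
proof -
  \<comment> \<open>Truncation at 0 makes the quadratic monotone on the whole line, so that it
    commutes with \<open>Min\<close>; distances do not feel it.\<close>
  define f where "f = (\<lambda>d::real. \<theta>\<^sub>0 * (x\<^sub>0 + \<kappa> * (max 0 d)\<^sup>2))"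
  have "mono f" unfolding f_def using assms
    by (intro monoI mult_left_mono add_left_mono power_mono) auto
  then have "f (menu_dist V q) = Min (f ` (\<lambda>z. dist q z) ` V)"
    using assms by (intro mono_Min_commute) auto
  also have "f ` (\<lambda>z. dist q z) ` V = (\<lambda>a. inv_fisher \<theta>\<^sub>0 x\<^sub>0 \<kappa> q a) ` V"
    by (auto simp: image_image f_def inv_fisher_def calib_scale_def max_absorb2)
  finally show ?thesis
    using menu_dist_nonneg[OF assms(1,2)] by (simp add: f_def menu_value_def max_absorb2)
qed

context
  fixes M :: "'a::metric_space set"
  assumes M_nonempty: "M \<noteq> {}" and M_compact: "compact M"
begin

lemma dist_bounded: "\<exists>D>0. \<forall>x\<in>M. \<forall>y\<in>M. dist x y \<le> D"
proof -
  from compact_imp_bounded[OF M_compact] obtain a e where e: "\<And>y. y \<in> M \<Longrightarrow> dist a y \<le> e"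
    unfolding bounded_def by blast
  have "dist x y \<le> max 1 (2 * e)" if "x \<in> M" "y \<in> M" for x y
    using e[OF that(1)] e[OF that(2)] dist_triangle2[of x y a] by (simp add: dist_commute)
  then show ?thesis by (intro exI[of _ "max 1 (2 * e)"]) auto
qed

lemma menu_dist_bdd_above:
  assumes "V \<in> menus M k"
  shows "bdd_above ((\<lambda>s. menu_dist V s) ` M)"
proof -
  note V = menusD[OF assms]
  obtain D where D: "\<And>x y. x \<in> M \<Longrightarrow> y \<in> M \<Longrightarrow> dist x y \<le> D" using dist_bounded by blast
  obtain z where z: "z \<in> V" using V by blast
  have "menu_dist V s \<le> D" if "s \<in> M" for s
  proof -
    have "menu_dist V s \<le> dist s z" using V z by simp
    also have "\<dots> \<le> D" using D that z V by blast
    finally show ?thesis .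
  qed
  then show ?thesis by (intro bdd_aboveI2)
qed

lemma sup_menu_dist_nonneg:
  assumes "V \<in> menus M k"
  shows "0 \<le> (SUP s\<in>M. menu_dist V s)"
proof -
  from M_nonempty obtain s where s: "s \<in> M" by blast
  have "0 \<le> menu_dist V s" using menusD[OF assms] by (intro menu_dist_nonneg)
  also have "\<dots> \<le> (SUP s\<in>M. menu_dist V s)" by (rule cSUP_upper[OF s menu_dist_bdd_above[OF assms]])
  finally show ?thesis .
qed

lemma sup_menu_dist_bdd_below: "bdd_below ((\<lambda>V. SUP s\<in>M. menu_dist V s) ` menus M k)"
  using sup_menu_dist_nonneg by (intro bdd_belowI2[where m = 0])

lemma covering_radius_nonneg: "1 \<le> k \<Longrightarrow> 0 \<le> covering_radius M k"
  unfolding covering_radius_def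
  by (intro cINF_greatest menus_nonempty M_nonempty sup_menu_dist_nonneg)

text \<open>Neither the infimum over menus nor the supremum over contexts need be attained, hence
  the strict slack here and in \<open>covering_radius_lower\<close>.\<close>

lemma covering_radius_upper:
  assumes "1 \<le> k" "covering_radius M k < \<gamma>"
  obtains V where "V \<in> menus M k" "\<And>q. q \<in> M \<Longrightarrow> menu_dist V q \<le> \<gamma>"
proof -
  from assms(2) obtain V where V: "V \<in> menus M k" and lt: "(SUP s\<in>M. menu_dist V s) < \<gamma>"
    unfolding covering_radius_def
    by (subst (asm) cINF_less_iff[OF menus_nonempty[OF M_nonempty assms(1)] sup_menu_dist_bdd_below]) blast
  have "menu_dist V q \<le> \<gamma>" if "q \<in> M" for q
    using cSUP_upper[OF that menu_dist_bdd_above[OF V]] lt by linarith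
  with V that show ?thesis by blast
qed

lemma covering_radius_lower:
  assumes "V \<in> menus M k" "\<gamma> < covering_radius M k"
  obtains q where "q \<in> M" "\<gamma> < menu_dist V q"
proof -
  have "\<gamma> < (SUP s\<in>M. menu_dist V s)"
    using assms(2) cINF_lower[OF sup_menu_dist_bdd_below assms(1)] unfolding covering_radius_def by linarith
  then show ?thesis
    using that less_cSUP_iff[OF M_nonempty menu_dist_bdd_above[OF assms(1)]] by blast
qed

lemma covering_radius_le:
  assumes "V \<in> menus M k" "\<And>q. q \<in> M \<Longrightarrow> menu_dist V q \<le> \<gamma>"
  shows "covering_radius M k \<le> \<gamma>"
proof (rule ccontr)
  assume "\<not> covering_radius M k \<le> \<gamma>"
  then obtain q where "q \<in> M" "\<gamma> < menu_dist V q"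
    using covering_radius_lower[OF assms(1), of \<gamma>] by force
  with assms(2)[of q] show False by linarith
qed

text \<open>The regret is one continuous monotone function of the distance to the menu, and such a
  function commutes with supremum and infimum. Truncation at 0 again provides monotonicity on the
  line.\<close>

lemma frontier_A_eq:
  assumes "1 \<le> k" "0 < \<theta>\<^sub>0" "0 < \<kappa>"
  shows "frontier_A M \<theta>\<^sub>0 x\<^sub>0 \<kappa> b k = b\<^sup>2 * \<theta>\<^sub>0 * \<kappa> * (covering_radius M k)\<^sup>2"
proof -
  define f where "f = (\<lambda>d::real. b\<^sup>2 * \<theta>\<^sub>0 * \<kappa> * (max 0 d)\<^sup>2)"
  have mono: "mono f" unfolding f_def using assms
    by (intro monoI mult_left_mono power_mono) auto
  have cont: "continuous (at x within S) f" for x S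
    unfolding f_def by (intro continuous_intros)
  have f_eq: "f d = b\<^sup>2 * \<theta>\<^sub>0 * \<kappa> * d\<^sup>2" if "0 \<le> d" for d
    using that by (simp add: f_def max_absorb2)
  have sup: "(SUP q\<in>M. b\<^sup>2 * (menu_value \<theta>\<^sub>0 x\<^sub>0 \<kappa> V q - oracle_value \<theta>\<^sub>0 x\<^sub>0)) =
      f (SUP s\<in>M. menu_dist V s)" if V: "V \<in> menus M k" for V
  proof -
    have "f (Sup ((\<lambda>s. menu_dist V s) ` M)) = (SUP d\<in>(\<lambda>s. menu_dist V s) ` M. f d)"
      by (rule continuous_at_Sup_mono[OF mono cont]) (use M_nonempty menu_dist_bdd_above[OF V] in auto)
    also have "\<dots> = (SUP q\<in>M. b\<^sup>2 * (menu_value \<theta>\<^sub>0 x\<^sub>0 \<kappa> V q - oracle_value \<theta>\<^sub>0 x\<^sub>0))"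
      unfolding image_image
    proof (rule SUP_cong[OF refl])
      fix q
      show "f (menu_dist V q) = b\<^sup>2 * (menu_value \<theta>\<^sub>0 x\<^sub>0 \<kappa> V q - oracle_value \<theta>\<^sub>0 x\<^sub>0)"
        using menusD[OF V] assms
        by (subst f_eq) (auto simp: menu_value_eq oracle_value_def algebra_simps)
    qed
    finally show ?thesis ..
  qed
  have "frontier_A M \<theta>\<^sub>0 x\<^sub>0 \<kappa> b k = (INF V\<in>menus M k. f (SUP s\<in>M. menu_dist V s))"
    unfolding frontier_A_def by (rule INF_cong[OF refl sup])
  also have "\<dots> = (INF d\<in>(\<lambda>V. SUP s\<in>M. menu_dist V s) ` menus M k. f d)"
    by (simp add: image_image)
  also have "\<dots> = f (Inf ((\<lambda>V. SUP s\<in>M. menu_dist V s) ` menus M k))"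
    by (rule continuous_at_Inf_mono[OF mono cont, symmetric])
      (use menus_nonempty[OF M_nonempty assms(1)] sup_menu_dist_bdd_below in auto)
  also have "\<dots> = f (covering_radius M k)" by (simp add: covering_radius_def)
  also have "\<dots> = b\<^sup>2 * \<theta>\<^sub>0 * \<kappa> * (covering_radius M k)\<^sup>2"
    by (rule f_eq[OF covering_radius_nonneg[OF assms(1)]])
  finally show ?thesis .
qed

section \<open>Covering and packing under Ahlfors regularity\<close>

context
  fixes \<mu> :: "'a measure" and r c C R\<^sub>0 :: real
  assumes r: "0 < r" and sets_\<mu>: "sets \<mu> = sets (restrict_space borel M)"
    and const_pos: "0 < c" "c \<le> C" "0 < R\<^sub>0"
    and lower: "\<And>s R. s \<in> M \<Longrightarrow> 0 < R \<Longrightarrow> R < R\<^sub>0 \<Longrightarrow> ennreal (c * R powr r) \<le> emeasure \<mu> (ball s R \<inter> M)"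
    and upper: "\<And>s R. s \<in> M \<Longrightarrow> 0 < R \<Longrightarrow> R < R\<^sub>0 \<Longrightarrow> emeasure \<mu> (ball s R \<inter> M) \<le> ennreal (C * R powr r)"
begin

lemma ball_sets: "ball s R \<inter> M \<in> sets \<mu>"
  unfolding sets_\<mu> sets_restrict_space by (intro image_eqI[of _ _ "ball s R"]) auto

lemma M_sets: "M \<in> sets \<mu>"
  unfolding sets_\<mu> sets_restrict_space by (intro image_eqI[of _ _ UNIV]) auto

text \<open>By volume: k balls of radius 2 \<gamma> cover M and so carry at least the mass of one
  fixed ball, while each has mass at most C (2 \<gamma>)^r.\<close>

lemma covering_radius_rate_lower:
  "\<exists>a>0. \<forall>k\<ge>1. a * real k powr (- 1 / r) \<le> covering_radius M k"
proof -
  define m where "m = c * (R\<^sub>0 / 2) powr r"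
  have m: "m > 0" using const_pos by (simp add: m_def)
  have C: "C > 0" using const_pos by simp
  \<comment> \<open>The first argument serves radii too large for the regularity bounds, where
    \<open>k powr (- 1 / r)\<close> \<le> 1 suffices; the second comes from the volume
    count.\<close>
  define a where "a = min (R\<^sub>0 / 2) ((m / C) powr (1 / r) / 2)"
  have a: "a > 0" using const_pos m C by (simp add: a_def)
  have "a * real k powr (- 1 / r) \<le> \<gamma>" if k: "k \<ge> 1" and g: "covering_radius M k < \<gamma>" for k \<gamma>
  proof -
    have g0: "0 < \<gamma>" using covering_radius_nonneg[OF k] g by linarith
    have k1: "real k powr (- 1 / r) \<le> 1"
      using powr_mono[of "- 1 / r" 0 "real k"] k r by simp
    show ?thesis
    proof (cases "2 * \<gamma> < R\<^sub>0")
      case True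
      obtain V where V: "V \<in> menus M k" and near: "\<And>q. q \<in> M \<Longrightarrow> menu_dist V q \<le> \<gamma>"
        using covering_radius_upper[OF k g] by blast
      note V' = menusD[OF V]
      from M_nonempty obtain s where s: "s \<in> M" by blast
      \<comment> \<open>The radius is doubled because balls are open, whereas the menu is only known
        to lie within distance \<le> \<gamma>.\<close>
      have cover: "M \<subseteq> (\<Union>z\<in>V. ball z (2 * \<gamma>) \<inter> M)"
      proof
        fix q assume q: "q \<in> M"
        have "menu_dist V q \<in> (\<lambda>z. dist q z) ` V" using V' by (intro Min_in) auto
        then obtain z where "z \<in> V" "dist q z \<le> \<gamma>" using near[OF q] by auto
        then show "q \<in> (\<Union>z\<in>V. ball z (2 * \<gamma>) \<inter> M)" using q g0 by (auto simp: dist_commute intro!: bexI[of _ z])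
      qed
      have "ennreal m \<le> emeasure \<mu> (ball s (R\<^sub>0 / 2) \<inter> M)"
        unfolding m_def using const_pos s by (intro lower) auto
      also have "\<dots> \<le> emeasure \<mu> (\<Union>z\<in>V. ball z (2 * \<gamma>) \<inter> M)"
        using cover V' by (intro emeasure_mono sets.finite_UN ball_sets) auto
      also have "\<dots> \<le> (\<Sum>z\<in>V. emeasure \<mu> (ball z (2 * \<gamma>) \<inter> M))"
        using V' ball_sets by (intro emeasure_subadditive_finite) auto
      also have "\<dots> \<le> (\<Sum>z\<in>V. ennreal (C * (2 * \<gamma>) powr r))"
        using V' g0 True by (intro sum_mono upper) auto
      also have "\<dots> = ennreal (real (card V) * (C * (2 * \<gamma>) powr r))"
        using C by (simp add: ennreal_mult ennreal_of_nat_eq_real_of_nat)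
      also have "\<dots> \<le> ennreal (real k * (C * (2 * \<gamma>) powr r))"
        using V' C by (intro ennreal_leI mult_right_mono) auto
      finally have "m \<le> real k * (C * (2 * \<gamma>) powr r)"
        using C by (subst (asm) ennreal_le_iff) auto
      then have "m / C / real k \<le> (2 * \<gamma>) powr r"
        using C k by (simp add: field_simps)
      then have "(m / C / real k) powr (1 / r) \<le> ((2 * \<gamma>) powr r) powr (1 / r)"
        using m C r by (intro powr_mono2) auto
      also have "\<dots> = 2 * \<gamma>" using r g0 by (simp add: powr_powr)
      also have "(m / C / real k) powr (1 / r) = (m / C) powr (1 / r) * real k powr (- 1 / r)"
        using m C k by (simp add: powr_divide powr_mult powr_minus_divide)
      finally have "(m / C) powr (1 / r) / 2 * real k powr (- 1 / r) \<le> \<gamma>" by simp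
      moreover have "a * real k powr (- 1 / r) \<le> (m / C) powr (1 / r) / 2 * real k powr (- 1 / r)"
        by (intro mult_right_mono) (auto simp: a_def)
      ultimately show ?thesis by linarith
    next
      case False
      have "a * real k powr (- 1 / r) \<le> R\<^sub>0 / 2 * 1"
        using a k1 by (intro mult_mono) (auto simp: a_def)
      with False show ?thesis by linarith
    qed
  qed
  then have "\<forall>k\<ge>1. a * real k powr (- 1 / r) \<le> covering_radius M k"
    by (blast intro: dense_ge)
  with a show ?thesis by blast
qed

text \<open>Regularity bounds only small balls; compactness reduces M to finitely many of
  them.\<close>

lemma finite_total: obtains m where "0 < m" "emeasure \<mu> M \<le> ennreal m"
proof -
  have "M \<subseteq> (\<Union>z\<in>M. ball z (R\<^sub>0 / 2))" using const_pos by auto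
  then obtain F where F: "F \<subseteq> M" "finite F" "M \<subseteq> (\<Union>z\<in>F. ball z (R\<^sub>0 / 2))"
    using compactE_image[OF M_compact, of M "\<lambda>z. ball z (R\<^sub>0 / 2)"] by auto
  have "emeasure \<mu> M \<le> emeasure \<mu> (\<Union>z\<in>F. ball z (R\<^sub>0 / 2) \<inter> M)"
    using F by (intro emeasure_mono sets.finite_UN ball_sets) auto
  also have "\<dots> \<le> (\<Sum>z\<in>F. emeasure \<mu> (ball z (R\<^sub>0 / 2) \<inter> M))"
    using F ball_sets by (intro emeasure_subadditive_finite) auto
  also have "\<dots> \<le> (\<Sum>z\<in>F. ennreal (C * (R\<^sub>0 / 2) powr r))"
    using F const_pos by (intro sum_mono upper) auto
  also have "\<dots> = ennreal (real (card F) * (C * (R\<^sub>0 / 2) powr r))"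
    using const_pos by (simp add: ennreal_mult ennreal_of_nat_eq_real_of_nat)
  \<comment> \<open>The added 1 only makes the bound positive.\<close>
  also have "\<dots> \<le> ennreal (real (card F) * (C * (R\<^sub>0 / 2) powr r) + 1)"
    by (intro ennreal_leI) simp
  finally show ?thesis using const_pos by (intro that[of "real (card F) * (C * (R\<^sub>0 / 2) powr r) + 1"]) (auto intro!: add_nonneg_pos)
qed

text \<open>A largest \<epsilon>-separated set is an \<epsilon>-net, and its size is limited because
  the balls of radius \<epsilon> / 2 about its points are disjoint.\<close>

lemma covering_radius_rate_upper:
  "\<exists>a>0. \<forall>k\<ge>1. covering_radius M k \<le> a * real k powr (- 1 / r)"
proof -
  obtain m where m: "0 < m" "emeasure \<mu> M \<le> ennreal m" by (rule finite_total)
  obtain D where D: "0 < D" "\<And>x y. x \<in> M \<Longrightarrow> y \<in> M \<Longrightarrow> dist x y \<le> D"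
    using dist_bounded by blast
  define K where "K = m / c * 2 powr r"
  have K: "K > 0" using m const_pos by (simp add: K_def)
  define sep where "sep \<epsilon> P \<longleftrightarrow> finite P \<and> P \<subseteq> M \<and> (\<forall>x\<in>P. \<forall>y\<in>P. x \<noteq> y \<longrightarrow> \<epsilon> \<le> dist x y)" for \<epsilon> P
  have packing: "real (card P) * \<epsilon> powr r \<le> K" if eps: "0 < \<epsilon>" "\<epsilon> < R\<^sub>0" and P: "sep \<epsilon> P" for P \<epsilon>
  proof -
    have disj: "disjoint_family_on (\<lambda>z. ball z (\<epsilon> / 2) \<inter> M) P"
      unfolding disjoint_family_on_def
    proof (intro ballI impI)
      fix x y assume xy: "x \<in> P" "y \<in> P" "x \<noteq> y"
      then have "\<epsilon> \<le> dist x y" using P by (simp add: sep_def)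
      then have "ball x (\<epsilon> / 2) \<inter> ball y (\<epsilon> / 2) = {}"
        by (intro disjoint_ballI) simp
      then show "ball x (\<epsilon> / 2) \<inter> M \<inter> (ball y (\<epsilon> / 2) \<inter> M) = {}" by blast
    qed
    have "ennreal (real (card P) * (c * (\<epsilon> / 2) powr r)) = (\<Sum>z\<in>P. ennreal (c * (\<epsilon> / 2) powr r))"
      using const_pos by (simp add: ennreal_mult ennreal_of_nat_eq_real_of_nat)
    also have "\<dots> \<le> (\<Sum>z\<in>P. emeasure \<mu> (ball z (\<epsilon> / 2) \<inter> M))"
      using P eps by (intro sum_mono lower) (auto simp: sep_def)
    also have "\<dots> = emeasure \<mu> (\<Union>z\<in>P. ball z (\<epsilon> / 2) \<inter> M)"
      using P ball_sets disj by (intro sum_emeasure) (auto simp: sep_def)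
    also have "\<dots> \<le> emeasure \<mu> M" by (intro emeasure_mono M_sets) auto
    also have "\<dots> \<le> ennreal m" by (rule m)
    finally have "real (card P) * (c * (\<epsilon> / 2) powr r) \<le> m"
      using m by (subst (asm) ennreal_le_iff) auto
    then have "real (card P) * (c * (\<epsilon> powr r / 2 powr r)) \<le> m"
      using eps by (simp add: powr_divide)
    then show ?thesis using const_pos by (simp add: K_def field_simps)
  qed
  have cover: "covering_radius M k \<le> \<epsilon>" if k: "k \<ge> 1" and eps: "0 < \<epsilon>" "\<epsilon> < R\<^sub>0" "K \<le> real k * \<epsilon> powr r" for k \<epsilon>
  proof -
    have card_le: "card P \<le> k" if "sep \<epsilon> P" for P
    proof -
      have "real (card P) * \<epsilon> powr r \<le> real k * \<epsilon> powr r"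
        using packing[OF eps(1,2) that] eps(3) by linarith
      then show ?thesis using eps by simp
    qed
    from M_nonempty obtain s where s: "s \<in> M" by blast
    have "sep \<epsilon> {s}" using s by (simp add: sep_def)
    \<comment> \<open>A largest separated set exists since \<open>packing\<close> bounds all their
      cardinalities by k. A point farther than \<epsilon> from it could be added.\<close>
    then obtain P where P: "sep \<epsilon> P" and maxi: "\<And>P'. sep \<epsilon> P' \<Longrightarrow> card P' \<le> card P"
      using ex_has_greatest_nat[of "sep \<epsilon>" "{s}" card "Suc k"] card_le by (meson le_imp_less_Suc)
    have P1: "1 \<le> card P" using maxi[OF \<open>sep \<epsilon> {s}\<close>] by simp
    then have V: "P \<in> menus M k" using P card_le[OF P] by (simp add: menus_def sep_def)
    show ?thesis
    proof (rule covering_radius_le[OF V])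
      fix q assume q: "q \<in> M"
      have "\<exists>z\<in>P. dist q z \<le> \<epsilon>"
      proof (rule ccontr)
        assume "\<not> (\<exists>z\<in>P. dist q z \<le> \<epsilon>)"
        then have far: "\<And>z. z \<in> P \<Longrightarrow> \<epsilon> < dist q z" by force
        then have "q \<notin> P" using eps by force
        moreover have "sep \<epsilon> (insert q P)"
          using P q far by (auto simp: sep_def dist_commute less_imp_le)
        ultimately show False using maxi[of "insert q P"] P by (simp add: sep_def)
      qed
      then obtain z where "z \<in> P" "dist q z \<le> \<epsilon>" by blast
      moreover have "menu_dist P q \<le> dist q z" using \<open>z \<in> P\<close> menusD[OF V] by simp
      ultimately show "menu_dist P q \<le> \<epsilon>" by linarith
    qed
  qed
  \<comment> \<open>The summand \<open>D / R\<^sub>0\<close> handles \<epsilon> \<ge>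
    \<open>R\<^sub>0\<close>: there one point covers M within
    \<open>D \<le> D / R\<^sub>0 * \<epsilon>\<close>.\<close>
  define a where "a = (1 + D / R\<^sub>0) * K powr (1 / r)"
  have a: "a > 0" using D K const_pos by (simp add: a_def add_pos_pos)
  have "covering_radius M k \<le> a * real k powr (- 1 / r)" if k: "k \<ge> 1" for k
  proof -
    define \<epsilon> where "\<epsilon> = (K / real k) powr (1 / r)"
    have eps: "0 < \<epsilon>" using K k by (simp add: \<epsilon>_def)
    have "\<epsilon> = K powr (1 / r) * real k powr (- 1 / r)"
      using K k by (simp add: \<epsilon>_def powr_divide powr_minus_divide)
    then have a_eq: "a * real k powr (- 1 / r) = \<epsilon> + D / R\<^sub>0 * \<epsilon>"
      by (simp add: a_def algebra_simps)
    show ?thesis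
    proof (cases "\<epsilon> < R\<^sub>0")
      case True
      have "\<epsilon> powr r = K / real k" using K k r by (simp add: \<epsilon>_def powr_powr)
      then have "K \<le> real k * \<epsilon> powr r" using k by simp
      from cover[OF k eps True this] have "covering_radius M k \<le> \<epsilon>" .
      moreover have "0 \<le> D / R\<^sub>0 * \<epsilon>" using D const_pos eps by simp
      ultimately show ?thesis unfolding a_eq by linarith
    next
      case False
      from M_nonempty obtain s where s: "s \<in> M" by blast
      have "covering_radius M k \<le> D"
        by (rule covering_radius_le[of "{s}"]) (use s D k in \<open>auto simp: menus_def\<close>)
      also have "D = D / R\<^sub>0 * R\<^sub>0" using const_pos by simp
      also have "\<dots> \<le> D / R\<^sub>0 * \<epsilon>" using False D const_pos by (intro mult_left_mono) auto
      finally show ?thesis unfolding a_eq using eps by linarith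
    qed
  qed
  with a show ?thesis by blast
qed

end

lemma covering_radius_rate:
  assumes "0 < r" "ahlfors_regular M r"
  shows "\<exists>a>0. \<exists>a'>0. \<forall>k\<ge>1. a * real k powr (- 1 / r) \<le> covering_radius M k \<and>
    covering_radius M k \<le> a' * real k powr (- 1 / r)"
proof -
  from assms(2) obtain \<mu> :: "'a measure" and c C R\<^sub>0 where
    *: "sets \<mu> = sets (restrict_space borel M)" "0 < c" "c \<le> C" "0 < R\<^sub>0"
      "\<And>s R. s \<in> M \<Longrightarrow> 0 < R \<Longrightarrow> R < R\<^sub>0 \<Longrightarrow> ennreal (c * R powr r) \<le> emeasure \<mu> (ball s R \<inter> M)"
      "\<And>s R. s \<in> M \<Longrightarrow> 0 < R \<Longrightarrow> R < R\<^sub>0 \<Longrightarrow> emeasure \<mu> (ball s R \<inter> M) \<le> ennreal (C * R powr r)"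
    unfolding ahlfors_regular_def by blast
  from covering_radius_rate_lower[OF assms(1) *] covering_radius_rate_upper[OF assms(1) *]
  show ?thesis by blast
qed

lemma frontier_A_rate:
  assumes "0 < r" "ahlfors_regular M r" "0 < \<theta>\<^sub>0" "0 < \<kappa>" "b \<noteq> 0"
  shows "\<exists>c C. 0 < c \<and> 0 < C \<and> (\<forall>k\<ge>1. c * real k powr (- 2 / r) \<le> frontier_A M \<theta>\<^sub>0 x\<^sub>0 \<kappa> b k \<and>
    frontier_A M \<theta>\<^sub>0 x\<^sub>0 \<kappa> b k \<le> C * real k powr (- 2 / r))"
proof -
  let ?B = "b\<^sup>2 * \<theta>\<^sub>0 * \<kappa>"
  have B: "?B > 0" using assms by simp
  obtain a a' where a: "a > 0" "a' > 0" and
    rate: "\<And>k. k \<ge> 1 \<Longrightarrow> a * real k powr (- 1 / r) \<le> covering_radius M k"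
      "\<And>k. k \<ge> 1 \<Longrightarrow> covering_radius M k \<le> a' * real k powr (- 1 / r)"
    using covering_radius_rate[OF assms(1,2)] by blast
  have sq: "(x * real k powr (- 1 / r))\<^sup>2 = x\<^sup>2 * real k powr (- 2 / r)" if "k \<ge> 1" for x :: real and k :: nat
    using that by (simp add: power_mult_distrib power2_eq_square[of "_ powr _"] powr_add[symmetric])
  have "?B * a\<^sup>2 * real k powr (- 2 / r) \<le> frontier_A M \<theta>\<^sub>0 x\<^sub>0 \<kappa> b k \<and>
      frontier_A M \<theta>\<^sub>0 x\<^sub>0 \<kappa> b k \<le> ?B * a'\<^sup>2 * real k powr (- 2 / r)" if k: "k \<ge> 1" for k
  proof -
    have "(a * real k powr (- 1 / r))\<^sup>2 \<le> (covering_radius M k)\<^sup>2"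
      using rate(1)[OF k] a by (intro power_mono) auto
    moreover have "(covering_radius M k)\<^sup>2 \<le> (a' * real k powr (- 1 / r))\<^sup>2"
      using rate(2)[OF k] covering_radius_nonneg[OF k] by (intro power_mono) auto
    ultimately show ?thesis
      unfolding sq[OF k] frontier_A_eq[OF k assms(3,4)] mult.assoc[of ?B]
      using B by (auto intro!: mult_left_mono)
  qed
  then show ?thesis
    using B a by (intro exI[of _ "?B * a\<^sup>2"] exI[of _ "?B * a'\<^sup>2"]) auto
qed

end

section \<open>Excess risk and the frontier\<close>

text \<open>The derivative of \<psi> is itself differentiable at \<open>\<theta>\<^sub>0\<close>, so
  it differs from b by at most C \<eta> on the interval; the mean value inequality turns this into
  \<open>near_linear\<close>.\<close>

lemma C2_near_local_model:
  assumes "C2_near \<psi> \<theta>\<^sub>0" "0 < \<theta>\<^sub>0" "deriv \<psi> \<theta>\<^sub>0 \<noteq> 0"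
  shows "\<exists>C \<delta>. 0 < C \<and> 0 < \<delta> \<and>
    (\<forall>\<eta>. 0 < \<eta> \<longrightarrow> \<eta> < \<delta> \<longrightarrow> local_model (\<lambda>\<theta>. \<psi> \<theta> - \<psi> \<theta>\<^sub>0) (deriv \<psi> \<theta>\<^sub>0) (C * \<eta>) \<theta>\<^sub>0 \<eta>)"
proof -
  let ?b = "deriv \<psi> \<theta>\<^sub>0"
  from assms(1) obtain U where U: "open U" "\<theta>\<^sub>0 \<in> U" "\<psi> differentiable_on U" "deriv \<psi> differentiable_on U"
    unfolding C2_near_def by blast
  have d1: "(\<psi> has_real_derivative deriv \<psi> \<theta>) (at \<theta>)" if "\<theta> \<in> U" for \<theta>
    using U(1,3) that by (metis DERIV_deriv_iff_real_differentiable at_within_open differentiable_on_def)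
  have "deriv \<psi> differentiable (at \<theta>\<^sub>0)"
    using U by (metis at_within_open differentiable_on_def)
  then obtain d where "(deriv \<psi> has_real_derivative d) (at \<theta>\<^sub>0)"
    using real_differentiable_def by blast
  then have "((\<lambda>\<theta>. (deriv \<psi> \<theta> - ?b) / (\<theta> - \<theta>\<^sub>0)) \<longlongrightarrow> d) (at \<theta>\<^sub>0)"
    by (simp add: has_field_derivative_iff)
  then have "((\<lambda>\<theta>. \<bar>(deriv \<psi> \<theta> - ?b) / (\<theta> - \<theta>\<^sub>0)\<bar>) \<longlongrightarrow> \<bar>d\<bar>) (at \<theta>\<^sub>0)"
    by (rule tendsto_rabs)
  then have "\<forall>\<^sub>F \<theta> in at \<theta>\<^sub>0. \<bar>(deriv \<psi> \<theta> - ?b) / (\<theta> - \<theta>\<^sub>0)\<bar> < \<bar>d\<bar> + 1"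
    by (rule order_tendstoD) simp
  then obtain \<delta>1 where \<delta>1: "\<delta>1 > 0"
      "\<And>\<theta>. \<theta> \<noteq> \<theta>\<^sub>0 \<Longrightarrow> dist \<theta> \<theta>\<^sub>0 < \<delta>1 \<Longrightarrow> \<bar>(deriv \<psi> \<theta> - ?b) / (\<theta> - \<theta>\<^sub>0)\<bar> < \<bar>d\<bar> + 1"
    unfolding eventually_at by auto
  define C where "C = \<bar>d\<bar> + 1"
  have C: "C > 0" by (simp add: C_def)
  have slope: "\<bar>deriv \<psi> \<theta> - ?b\<bar> \<le> C * \<bar>\<theta> - \<theta>\<^sub>0\<bar>" if "\<bar>\<theta> - \<theta>\<^sub>0\<bar> < \<delta>1" for \<theta>
  proof (cases "\<theta> = \<theta>\<^sub>0")
    case False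
    then have "\<bar>deriv \<psi> \<theta> - ?b\<bar> / \<bar>\<theta> - \<theta>\<^sub>0\<bar> < C"
      using \<delta>1(2)[of \<theta>] that by (simp add: dist_real_def C_def abs_divide)
    then show ?thesis using False by (simp add: pos_divide_less_eq)
  qed simp
  from U obtain \<delta>2 where \<delta>2: "\<delta>2 > 0" "ball \<theta>\<^sub>0 \<delta>2 \<subseteq> U"
    using open_contains_ball by blast
  \<comment> \<open>The bound by \<open>\<theta>\<^sub>0\<close> keeps all parameters
    positive.\<close>
  define \<delta> where "\<delta> = min \<theta>\<^sub>0 (min \<delta>1 \<delta>2)"
  have \<delta>: "\<delta> > 0" using assms \<delta>1 \<delta>2 by (simp add: \<delta>_def)
  have "local_model (\<lambda>\<theta>. \<psi> \<theta> - \<psi> \<theta>\<^sub>0) ?b (C * \<eta>) \<theta>\<^sub>0 \<eta>" if \<eta>: "0 < \<eta>" "\<eta> < \<delta>" for \<eta>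
  proof
    fix \<theta> \<theta>' assume near: "\<bar>\<theta> - \<theta>\<^sub>0\<bar> \<le> \<eta>" "\<bar>\<theta>' - \<theta>\<^sub>0\<bar> \<le> \<eta>"
    let ?I = "{\<theta>\<^sub>0 - \<eta>..\<theta>\<^sub>0 + \<eta>}"
    have "norm ((\<psi> \<theta> - ?b * \<theta>) - (\<psi> \<theta>' - ?b * \<theta>')) \<le> (C * \<eta>) * norm (\<theta> - \<theta>')"
    proof (rule field_differentiable_bound[of ?I])
      fix z assume "z \<in> ?I"
      then have z: "\<bar>z - \<theta>\<^sub>0\<bar> \<le> \<eta>" by auto
      then have "z \<in> U" using \<delta>2 \<eta> by (auto simp: \<delta>_def dist_real_def intro!: subsetD[OF \<delta>2(2)])
      from d1[OF this] show "((\<lambda>\<theta>. \<psi> \<theta> - ?b * \<theta>) has_field_derivative (deriv \<psi> z - ?b)) (at z within ?I)"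
        by (auto intro!: derivative_eq_intros intro: has_field_derivative_at_within)
      have "\<bar>deriv \<psi> z - ?b\<bar> \<le> C * \<bar>z - \<theta>\<^sub>0\<bar>" using slope z \<eta> by (simp add: \<delta>_def)
      also have "\<dots> \<le> C * \<eta>" using z C by (intro mult_left_mono) auto
      finally show "norm (deriv \<psi> z - ?b) \<le> C * \<eta>" by simp
    qed (use near in auto)
    then show "\<bar>(\<psi> \<theta> - \<psi> \<theta>\<^sub>0) - (\<psi> \<theta>' - \<psi> \<theta>\<^sub>0) - ?b * (\<theta> - \<theta>')\<bar> \<le> C * \<eta> * \<bar>\<theta> - \<theta>'\<bar>"
      by (simp add: algebra_simps)
  qed (use \<eta> C assms in \<open>auto simp: \<delta>_def\<close>)
  with C \<delta> show ?thesis by blast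
qed

section \<open>Excess risk between two scales\<close>

context local_model
begin

definition excess :: "nat \<Rightarrow> real \<Rightarrow> real \<Rightarrow> real" where
  "excess n x\<^sub>0 x = real n * (minimax (real n / x) - minimax (real n / x\<^sub>0))"

lemma excess_mono:
  assumes "0 < n" "0 < x" "x \<le> x'"
  shows "excess n x\<^sub>0 x \<le> excess n x\<^sub>0 x'"
proof -
  have "minimax (real n / x) \<le> minimax (real n / x')"
    using assms by (intro minimax_antimono) (auto intro!: divide_left_mono)
  then show ?thesis using assms(1) by (simp add: excess_def)
qed

text \<open>Multiplied by x, \<open>minimax_less_data\<close> says that n R grows at most by the
  factor \<open>x / x\<^sub>0\<close>; the growth is evaluated with the unbiased estimator at
  \<open>x\<^sub>0\<close>. The bound x \<le> \<open>2 * x\<^sub>0\<close> tames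
  \<open>x / x\<^sub>0\<close> in the logarithmic term and turns 8 into 16.\<close>

lemma excess_upper:
  assumes "0 < n" "0 < x\<^sub>0" "x\<^sub>0 \<le> x" "x \<le> 2 * x\<^sub>0"
  shows "excess n x\<^sub>0 x \<le> (x - x\<^sub>0) * (b\<^sup>2 * (\<theta>\<^sub>0 + \<eta>) +
    (real n * \<omega>\<^sup>2 * \<eta>\<^sup>2 + 16 * (real n * \<omega> * \<eta> * range_bound)) / x\<^sub>0)"
proof (cases "x = x\<^sub>0")
  case True
  then show ?thesis by (simp add: excess_def)
next
  case False
  let ?t = "real n / x\<^sub>0" and ?t' = "real n / x" and ?w = "real n * \<omega> * \<eta> * range_bound"
  have x: "x > 0" "x\<^sub>0 < x" using assms False by auto
  have w0: "0 \<le> ?w" using omega eta range_bound_nonneg by simp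
  have t: "0 < ?t'" "?t' < ?t" using assms x by (auto simp: divide_strict_left_mono)
  have "?t' * minimax ?t' \<le> ?t * minimax ?t + 8 * ?t * ln (?t / ?t') * \<omega> * \<eta> * range_bound"
    by (rule minimax_less_data[OF t])
  then have "x * (?t' * minimax ?t') \<le> x * (?t * minimax ?t + 8 * ?t * ln (?t / ?t') * \<omega> * \<eta> * range_bound)"
    using x by (intro mult_left_mono) auto
  then have 1: "real n * minimax ?t' \<le> x / x\<^sub>0 * (real n * minimax ?t) + 8 * (x / x\<^sub>0 * ln (x / x\<^sub>0)) * ?w"
    using x assms by (simp add: field_simps)
  have "ln (x / x\<^sub>0) \<le> x / x\<^sub>0 - 1" using x assms by (intro ln_le_minus_one) auto
  also have "\<dots> = (x - x\<^sub>0) / x\<^sub>0" using assms by (simp add: diff_divide_distrib)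
  finally have ln: "ln (x / x\<^sub>0) \<le> (x - x\<^sub>0) / x\<^sub>0" .
  have "x / x\<^sub>0 * ln (x / x\<^sub>0) \<le> 2 * ((x - x\<^sub>0) / x\<^sub>0)"
    using ln assms x by (intro mult_mono) (auto simp: pos_divide_le_eq)
  then have 2: "8 * (x / x\<^sub>0 * ln (x / x\<^sub>0)) * ?w \<le> 8 * (2 * ((x - x\<^sub>0) / x\<^sub>0)) * ?w"
    by (intro mult_right_mono[OF _ w0] mult_left_mono) auto
  have "real n * minimax ?t \<le> real n * (b\<^sup>2 * (\<theta>\<^sub>0 + \<eta>) / ?t + \<omega>\<^sup>2 * \<eta>\<^sup>2)"
    using assms by (intro mult_left_mono minimax_le_unbiased) auto
  also have "\<dots> = b\<^sup>2 * (\<theta>\<^sub>0 + \<eta>) * x\<^sub>0 + real n * \<omega>\<^sup>2 * \<eta>\<^sup>2"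
    using assms by (simp add: distrib_left)
  finally have "(x - x\<^sub>0) / x\<^sub>0 * (real n * minimax ?t) \<le>
      (x - x\<^sub>0) / x\<^sub>0 * (b\<^sup>2 * (\<theta>\<^sub>0 + \<eta>) * x\<^sub>0 + real n * \<omega>\<^sup>2 * \<eta>\<^sup>2)"
    using x assms by (intro mult_left_mono) auto
  moreover have "excess n x\<^sub>0 x \<le> (x - x\<^sub>0) / x\<^sub>0 * (real n * minimax ?t) + 8 * (2 * ((x - x\<^sub>0) / x\<^sub>0)) * ?w"
  proof -
    have "x / x\<^sub>0 * (real n * minimax ?t) = (x - x\<^sub>0) / x\<^sub>0 * (real n * minimax ?t) + real n * minimax ?t"
      using assms by (simp add: field_simps)
    with 1 2 show ?thesis by (simp add: excess_def right_diff_distrib)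
  qed
  ultimately have "excess n x\<^sub>0 x \<le> (x - x\<^sub>0) / x\<^sub>0 * (b\<^sup>2 * (\<theta>\<^sub>0 + \<eta>) * x\<^sub>0 + real n * \<omega>\<^sup>2 * \<eta>\<^sup>2) +
      8 * (2 * ((x - x\<^sub>0) / x\<^sub>0)) * ?w" by linarith
  also have "\<dots> = (x - x\<^sub>0) * (b\<^sup>2 * (\<theta>\<^sub>0 + \<eta>) + (real n * \<omega>\<^sup>2 * \<eta>\<^sup>2 + 16 * ?w) / x\<^sub>0)"
    using assms by (simp add: field_simps)
  finally show ?thesis .
qed

text \<open>The weight \<open>z = (x - x\<^sub>0) / x\<close> is (t - t') / t, which minimises (1 -
  z)^2 / t' + z^2 / (t - t'), the risk that \<open>minimax_more_data\<close> gives for an efficient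
  estimator at t'. The excess is then at least z (2 - z) n R minus z times the price of the
  correction.\<close>

lemma excess_lower:
  assumes "0 < n" "0 < x\<^sub>0" "x\<^sub>0 \<le> x" "\<omega> \<le> \<bar>b\<bar>"
  shows "(x - x\<^sub>0) * (((1 + x\<^sub>0 / x) * ((\<bar>b\<bar> - \<omega>) / (1 / (sqrt n * \<eta>) + sqrt (1 / (x\<^sub>0 * (\<theta>\<^sub>0 - \<eta>)))))\<^sup>2
     - (4 * (real n * \<omega> * \<eta> * range_bound) + real n * \<omega>\<^sup>2 * \<eta>\<^sup>2 + b\<^sup>2 * (\<theta>\<^sub>0 + \<eta>) * x\<^sub>0)) / x)
     \<le> excess n x\<^sub>0 x" (is "(x - x\<^sub>0) * ((_ * ?l\<^sup>2 - ?e) / x) \<le> _")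
proof (cases "x = x\<^sub>0")
  case True
  then show ?thesis by (simp add: excess_def)
next
  case False
  let ?t = "real n / x\<^sub>0" and ?t' = "real n / x"
  have x: "x > 0" "x\<^sub>0 < x" using assms False by auto
  have t: "0 < ?t'" "?t' < ?t" using assms x by (auto simp: divide_strict_left_mono)
  define z where "z = (x - x\<^sub>0) / x"
  have z: "0 \<le> z" "z \<le> 1" using assms x by (auto simp: z_def)
  have z2: "z\<^sup>2 \<le> z" using z by (simp add: power2_eq_square mult_left_le)
  have e1: "0 \<le> real n * \<omega>\<^sup>2 * \<eta>\<^sup>2" using assms by simp
  have sn: "0 < sqrt n" using assms by simp
  have "minimax ?t \<le> (1 - z)\<^sup>2 * minimax ?t' + (4 * z * \<omega> * \<eta> * range_bound + z\<^sup>2 * \<omega>\<^sup>2 * \<eta>\<^sup>2 +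
      z\<^sup>2 * b\<^sup>2 * (\<theta>\<^sub>0 + \<eta>) / (?t - ?t'))"
    by (rule minimax_more_data[OF t z])
  then have "real n * minimax ?t \<le> real n * ((1 - z)\<^sup>2 * minimax ?t' + (4 * z * \<omega> * \<eta> * range_bound + z\<^sup>2 * \<omega>\<^sup>2 * \<eta>\<^sup>2 +
      z\<^sup>2 * b\<^sup>2 * (\<theta>\<^sub>0 + \<eta>) / (?t - ?t')))"
    using assms by (intro mult_left_mono) auto
  also have "\<dots> = (1 - z)\<^sup>2 * (real n * minimax ?t') + z * (4 * (real n * \<omega> * \<eta> * range_bound)) +
      z\<^sup>2 * (real n * \<omega>\<^sup>2 * \<eta>\<^sup>2) + z * (b\<^sup>2 * (\<theta>\<^sub>0 + \<eta>) * x\<^sub>0)"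
  proof -
    have "?t - ?t' = real n * (x - x\<^sub>0) / (x * x\<^sub>0)" using x assms by (simp add: field_simps)
    then have "real n * (z\<^sup>2 * b\<^sup>2 * (\<theta>\<^sub>0 + \<eta>) / (?t - ?t')) = z * (b\<^sup>2 * (\<theta>\<^sub>0 + \<eta>) * x\<^sub>0)"
      using x assms by (simp add: z_def power2_eq_square)
    then show ?thesis by (simp add: algebra_simps)
  qed
  also have "\<dots> \<le> (1 - z)\<^sup>2 * (real n * minimax ?t') + z * ?e"
    using mult_right_mono[OF z2 e1] by (simp add: algebra_simps)
  finally have "(1 - (1 - z)\<^sup>2) * (real n * minimax ?t') - z * ?e \<le> excess n x\<^sub>0 x"
    by (simp add: excess_def algebra_simps)
  moreover have "z * ((2 - z) * ?l\<^sup>2) \<le> (1 - (1 - z)\<^sup>2) * (real n * minimax ?t')"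
  proof -
    \<comment> \<open>The Cramer-Rao bound is taken at t and carried to t' by monotonicity, so that
      it involves only the fixed \<open>x\<^sub>0\<close>.\<close>
    have "((\<bar>b\<bar> - \<omega>) / (1 / \<eta> + sqrt (?t / (\<theta>\<^sub>0 - \<eta>))))\<^sup>2 \<le> minimax ?t"
      using t assms by (intro minimax_lower_bound) auto
    also have "\<dots> \<le> minimax ?t'" using t by (intro minimax_antimono) auto
    finally have "real n * ((\<bar>b\<bar> - \<omega>) / (1 / \<eta> + sqrt (?t / (\<theta>\<^sub>0 - \<eta>))))\<^sup>2 \<le> real n * minimax ?t'"
      by (intro mult_left_mono) auto
    moreover have "?l\<^sup>2 = real n * ((\<bar>b\<bar> - \<omega>) / (1 / \<eta> + sqrt (?t / (\<theta>\<^sub>0 - \<eta>))))\<^sup>2"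
    proof -
      have "sqrt (?t / (\<theta>\<^sub>0 - \<eta>)) = sqrt n * sqrt (1 / (x\<^sub>0 * (\<theta>\<^sub>0 - \<eta>)))"
        by (simp add: real_sqrt_mult[symmetric])
      then have "1 / \<eta> + sqrt (?t / (\<theta>\<^sub>0 - \<eta>)) = sqrt n * (1 / (sqrt n * \<eta>) + sqrt (1 / (x\<^sub>0 * (\<theta>\<^sub>0 - \<eta>))))"
        using sn by (simp add: distrib_left)
      then show ?thesis using sn assms by (simp add: power_divide power_mult_distrib)
    qed
    ultimately have "z * (2 - z) * ?l\<^sup>2 \<le> z * (2 - z) * (real n * minimax ?t')"
      using z by (intro mult_left_mono) auto
    then show ?thesis by (simp add: power2_eq_square algebra_simps)
  qed
  moreover have "(x - x\<^sub>0) * (((1 + x\<^sub>0 / x) * ?l\<^sup>2 - ?e) / x) = z * ((2 - z) * ?l\<^sup>2) - z * ?e"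
  proof -
    have "1 + x\<^sub>0 / x = 2 - z" using x by (simp add: z_def diff_divide_distrib)
    moreover have "(x - x\<^sub>0) * ((P - E) / x) = z * P - z * E" for P E
      unfolding right_diff_distrib[symmetric] by (simp add: z_def)
    ultimately show ?thesis by simp
  qed
  ultimately show ?thesis by linarith
qed

end

lemma ereal_INF_SUP_cmult:
  fixes f :: "'a \<Rightarrow> 'b \<Rightarrow> ereal"
  assumes "0 < c" "N \<noteq> {}"
  shows "(INF V\<in>W. SUP q\<in>N. ereal c * f V q) = ereal c * (INF V\<in>W. SUP q\<in>N. f V q)"
proof -
  have "(INF V\<in>W. SUP q\<in>N. ereal c * f V q) = (INF V\<in>W. ereal c * (SUP q\<in>N. f V q))"
    using assms by (simp add: Sup_ereal_mult_left')
  also have "\<dots> = Inf {ereal c * y |y. y \<in> (\<lambda>V. SUP q\<in>N. f V q) ` W}"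
    by (rule arg_cong[where f = Inf]) auto
  also have "\<dots> = ereal c * (INF V\<in>W. SUP q\<in>N. f V q)"
    by (simp add: ereal_Inf_cmult[OF assms(1)])
  finally show ?thesis .
qed

section \<open>From excess risk to the frontier\<close>

context local_model
begin

context
  fixes M :: "'a::metric_space set" and \<psi> :: "real \<Rightarrow> real" and x\<^sub>0 \<kappa> H :: real and n k :: nat
  assumes M: "M \<noteq> {}" "compact M" and pos: "0 < n" "0 < x\<^sub>0" "0 < \<kappa>" and k: "1 \<le> k"
    and \<phi>_eq: "\<And>\<theta>. \<phi> \<theta> = \<psi> \<theta> - \<psi> \<theta>\<^sub>0" and \<eta>_eq: "\<eta> = H / sqrt n"
begin

text \<open>Both risks are finite, so the \<open>ereal\<close> difference is an ordinary
  one.\<close>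

lemma menu_risk_excess:
  fixes q :: 'a
  assumes V: "V \<in> menus M k"
  defines "x \<equiv> x\<^sub>0 + \<kappa> * (menu_dist V q)\<^sup>2"
  shows "enn2ereal (local_risk \<psi> \<theta>\<^sub>0 n H (menu_value \<theta>\<^sub>0 x\<^sub>0 \<kappa> V q)) -
      enn2ereal (local_risk \<psi> \<theta>\<^sub>0 n H (oracle_value \<theta>\<^sub>0 x\<^sub>0)) = ereal (excess n x\<^sub>0 x)" (is ?local)
    and "enn2ereal (orig_risk \<psi> \<theta>\<^sub>0 n H (menu_value \<theta>\<^sub>0 x\<^sub>0 \<kappa> V q)) -
      enn2ereal (orig_risk \<psi> \<theta>\<^sub>0 n H (oracle_value \<theta>\<^sub>0 x\<^sub>0)) = ereal (1 / real n) * ereal (excess n x\<^sub>0 x)" (is ?orig)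
proof -
  have x: "x > 0" using pos by (simp add: x_def add_pos_nonneg)
  have val: "menu_value \<theta>\<^sub>0 x\<^sub>0 \<kappa> V q = \<theta>\<^sub>0 * x"
    using menusD[OF V] eta pos by (simp add: menu_value_eq x_def)
  note loc = local_risk_eq[OF pos(1) _ \<phi>_eq \<eta>_eq] and org = orig_risk_eq[OF pos(1) _ \<phi>_eq \<eta>_eq]
  show ?local
    unfolding val oracle_value_def loc[OF x] loc[OF pos(2)]
    using minimax_nonneg by (simp add: excess_def right_diff_distrib)
  show ?orig
    unfolding val oracle_value_def org[OF x] org[OF pos(2)]
    using minimax_nonneg pos(1) by (simp add: excess_def)
qed

lemma orig_excess_eq:
  "orig_excess M \<psi> \<theta>\<^sub>0 x\<^sub>0 \<kappa> n k H = ereal (1 / real n) * frontier_F M \<psi> \<theta>\<^sub>0 x\<^sub>0 \<kappa> n k H"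
proof -
  have "orig_excess M \<psi> \<theta>\<^sub>0 x\<^sub>0 \<kappa> n k H =
     (INF V\<in>menus M k. SUP q\<in>M. ereal (1 / real n) * (enn2ereal (local_risk \<psi> \<theta>\<^sub>0 n H (menu_value \<theta>\<^sub>0 x\<^sub>0 \<kappa> V q)) -
      enn2ereal (local_risk \<psi> \<theta>\<^sub>0 n H (oracle_value \<theta>\<^sub>0 x\<^sub>0))))"
    unfolding orig_excess_def by (intro INF_cong SUP_cong refl) (simp only: menu_risk_excess)
  also have "\<dots> = ereal (1 / real n) * frontier_F M \<psi> \<theta>\<^sub>0 x\<^sub>0 \<kappa> n k H"
    unfolding frontier_F_def by (rule ereal_INF_SUP_cmult) (use pos M in auto)
  finally show ?thesis .
qed

lemma frontier_F_le:
  assumes "covering_radius M k < \<gamma>"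
  shows "frontier_F M \<psi> \<theta>\<^sub>0 x\<^sub>0 \<kappa> n k H \<le> ereal (excess n x\<^sub>0 (x\<^sub>0 + \<kappa> * \<gamma>\<^sup>2))"
proof -
  obtain V where V: "V \<in> menus M k" and near: "\<And>q. q \<in> M \<Longrightarrow> menu_dist V q \<le> \<gamma>"
    using covering_radius_upper[OF M k assms] by blast
  have "excess n x\<^sub>0 (x\<^sub>0 + \<kappa> * (menu_dist V q)\<^sup>2) \<le> excess n x\<^sub>0 (x\<^sub>0 + \<kappa> * \<gamma>\<^sup>2)" if "q \<in> M" for q
    using near[OF that] menusD[OF V] pos
    by (intro excess_mono add_left_mono mult_left_mono power_mono) (auto intro: add_pos_nonneg)
  then have "(SUP q\<in>M. ereal (excess n x\<^sub>0 (x\<^sub>0 + \<kappa> * (menu_dist V q)\<^sup>2))) \<le> ereal (excess n x\<^sub>0 (x\<^sub>0 + \<kappa> * \<gamma>\<^sup>2))"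
    by (intro SUP_least) simp
  then show ?thesis
    unfolding frontier_F_def by (intro INF_lower2[OF V]) (simp only: menu_risk_excess[OF V])
qed

lemma frontier_F_ge:
  assumes "\<gamma> < covering_radius M k" "0 \<le> \<gamma>"
  shows "ereal (excess n x\<^sub>0 (x\<^sub>0 + \<kappa> * \<gamma>\<^sup>2)) \<le> frontier_F M \<psi> \<theta>\<^sub>0 x\<^sub>0 \<kappa> n k H"
  unfolding frontier_F_def
proof (rule INF_greatest)
  fix V assume V: "V \<in> menus M k"
  obtain q where q: "q \<in> M" "\<gamma> < menu_dist V q"
    using covering_radius_lower[OF M V assms(1)] by blast
  have "excess n x\<^sub>0 (x\<^sub>0 + \<kappa> * \<gamma>\<^sup>2) \<le> excess n x\<^sub>0 (x\<^sub>0 + \<kappa> * (menu_dist V q)\<^sup>2)"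
    using q assms(2) pos
    by (intro excess_mono add_left_mono mult_left_mono power_mono) (auto intro: add_pos_nonneg)
  then have "ereal (excess n x\<^sub>0 (x\<^sub>0 + \<kappa> * \<gamma>\<^sup>2)) \<le> ereal (excess n x\<^sub>0 (x\<^sub>0 + \<kappa> * (menu_dist V q)\<^sup>2))"
    by simp
  then show "ereal (excess n x\<^sub>0 (x\<^sub>0 + \<kappa> * \<gamma>\<^sup>2)) \<le> (SUP q\<in>M.
      enn2ereal (local_risk \<psi> \<theta>\<^sub>0 n H (menu_value \<theta>\<^sub>0 x\<^sub>0 \<kappa> V q)) -
      enn2ereal (local_risk \<psi> \<theta>\<^sub>0 n H (oracle_value \<theta>\<^sub>0 x\<^sub>0)))"
    by (intro SUP_upper2[OF q(1)]) (simp only: menu_risk_excess[OF V])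
qed

end

end

section \<open>Limits along the sequence\<close>

text \<open>With \<omega> = C \<eta> and n \<eta>^2 = H^2 the errors become (C H \<eta>)^2 and C H^2
  \<eta> (|b| + C \<eta>).\<close>

lemma error_tendsto:
  fixes H \<eta> :: "nat \<Rightarrow> real"
  assumes \<eta>0: "\<eta> \<longlonglongrightarrow> 0" and H1: "(\<lambda>n. H n * \<eta> n) \<longlonglongrightarrow> 0" and H2: "(\<lambda>n. (H n)\<^sup>2 * \<eta> n) \<longlonglongrightarrow> 0"
    and Heq: "\<forall>\<^sub>F n in sequentially. sqrt (real n) * \<eta> n = H n"
  shows error1_tendsto: "(\<lambda>n. real n * (C * \<eta> n)\<^sup>2 * (\<eta> n)\<^sup>2) \<longlonglongrightarrow> 0"
    and error2_tendsto: "(\<lambda>n. real n * (C * \<eta> n) * \<eta> n * ((\<bar>b\<bar> + C * \<eta> n) * \<eta> n)) \<longlonglongrightarrow> 0"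
proof -
  have sq: "\<forall>\<^sub>F n in sequentially. real n * (\<eta> n)\<^sup>2 = (H n)\<^sup>2"
    using Heq by eventually_elim (metis power_mult_distrib real_sqrt_pow2 of_nat_0_le_iff)
  have "(\<lambda>n. (C * (H n * \<eta> n))\<^sup>2) \<longlonglongrightarrow> (C * 0)\<^sup>2"
    by (intro tendsto_intros H1)
  moreover have "\<forall>\<^sub>F n in sequentially. (C * (H n * \<eta> n))\<^sup>2 = real n * (C * \<eta> n)\<^sup>2 * (\<eta> n)\<^sup>2"
    using sq
  proof eventually_elim
    case (elim n)
    have "real n * (C * \<eta> n)\<^sup>2 * (\<eta> n)\<^sup>2 = C\<^sup>2 * (real n * (\<eta> n)\<^sup>2) * (\<eta> n)\<^sup>2"
      by (simp only: power_mult_distrib mult_ac)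
    also have "\<dots> = (C * (H n * \<eta> n))\<^sup>2"
      unfolding elim by (simp only: power_mult_distrib mult_ac)
    finally show ?case ..
  qed
  ultimately have "(\<lambda>n. real n * (C * \<eta> n)\<^sup>2 * (\<eta> n)\<^sup>2) \<longlonglongrightarrow> (C * 0)\<^sup>2"
    by (rule Lim_transform_eventually)
  then show "(\<lambda>n. real n * (C * \<eta> n)\<^sup>2 * (\<eta> n)\<^sup>2) \<longlonglongrightarrow> 0" by simp
  have "(\<lambda>n. C * ((H n)\<^sup>2 * \<eta> n) * (\<bar>b\<bar> + C * \<eta> n)) \<longlonglongrightarrow> C * 0 * (\<bar>b\<bar> + C * 0)"
    by (intro tendsto_intros H2 \<eta>0)
  moreover have "\<forall>\<^sub>F n in sequentially. C * ((H n)\<^sup>2 * \<eta> n) * (\<bar>b\<bar> + C * \<eta> n) =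
      real n * (C * \<eta> n) * \<eta> n * ((\<bar>b\<bar> + C * \<eta> n) * \<eta> n)"
    using sq
  proof eventually_elim
    case (elim n)
    have "real n * (C * \<eta> n) * \<eta> n * ((\<bar>b\<bar> + C * \<eta> n) * \<eta> n) =
        C * (real n * (\<eta> n)\<^sup>2 * \<eta> n) * (\<bar>b\<bar> + C * \<eta> n)"
      by (simp only: power2_eq_square mult_ac)
    then show ?case unfolding elim ..
  qed
  ultimately have "(\<lambda>n. real n * (C * \<eta> n) * \<eta> n * ((\<bar>b\<bar> + C * \<eta> n) * \<eta> n)) \<longlonglongrightarrow> C * 0 * (\<bar>b\<bar> + C * 0)"
    by (rule Lim_transform_eventually)
  then show "(\<lambda>n. real n * (C * \<eta> n) * \<eta> n * ((\<bar>b\<bar> + C * \<eta> n) * \<eta> n)) \<longlonglongrightarrow> 0" by simp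
qed

text \<open>The covering radius enters only through its positivity, needed to divide by the
  frontier, and its limit 0, which keeps the menu scales near \<open>x\<^sub>0\<close>.\<close>

lemma frontier_asymptotics:
  fixes M :: "'a::metric_space set" and kn :: "nat \<Rightarrow> nat" and Hn :: "nat \<Rightarrow> real"
  assumes M: "M \<noteq> {}" "compact M" and pos: "0 < \<theta>\<^sub>0" "0 < x\<^sub>0" "0 < \<kappa>"
    and \<psi>: "C2_near \<psi> \<theta>\<^sub>0" "b = deriv \<psi> \<theta>\<^sub>0" "b \<noteq> 0"
    and k: "\<forall>\<^sub>F n in sequentially. 1 \<le> kn n"
    and \<rho>_pos: "\<forall>\<^sub>F n in sequentially. 0 < covering_radius M (kn n)"
    and \<rho>_lim: "(\<lambda>n. covering_radius M (kn n)) \<longlonglongrightarrow> 0"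
    and H: "filterlim Hn at_top sequentially" and H11: "(\<lambda>n. Hn n ^ 11 / sqrt (real n)) \<longlonglongrightarrow> 0"
  shows "\<forall>\<^sub>F n in sequentially. orig_excess M \<psi> \<theta>\<^sub>0 x\<^sub>0 \<kappa> n (kn n) (Hn n) =
      ereal (1 / real n) * frontier_F M \<psi> \<theta>\<^sub>0 x\<^sub>0 \<kappa> n (kn n) (Hn n)" (is ?orig)
    and "\<exists>\<epsilon>. \<epsilon> \<longlonglongrightarrow> 0 \<and> (\<forall>\<^sub>F n in sequentially. frontier_F M \<psi> \<theta>\<^sub>0 x\<^sub>0 \<kappa> n (kn n) (Hn n) =
      ereal (frontier_A M \<theta>\<^sub>0 x\<^sub>0 \<kappa> b (kn n) * (1 + \<epsilon> n)))" (is ?asymp)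
proof -
  obtain C \<delta> where C: "0 < C" "0 < \<delta>" and
    model: "\<And>\<eta>. 0 < \<eta> \<Longrightarrow> \<eta> < \<delta> \<Longrightarrow> local_model (\<lambda>\<theta>. \<psi> \<theta> - \<psi> \<theta>\<^sub>0) b (C * \<eta>) \<theta>\<^sub>0 \<eta>"
    using C2_near_local_model[OF \<psi>(1) pos(1)] \<psi> by blast
  define \<eta> where "\<eta> n = Hn n / sqrt n" for n
  define \<rho> where "\<rho> n = covering_radius M (kn n)" for n
  have n0: "\<forall>\<^sub>F n in sequentially. 0 < n" by (rule eventually_gt_at_top)
  have H1: "\<forall>\<^sub>F n in sequentially. 1 \<le> Hn n"
    using H by (simp add: filterlim_at_top)
  \<comment> \<open>Once H \<ge> 1, lower powers are dominated by the eleventh; the powers 1, 2 and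
    3 are used.\<close>
  have pow_lim: "(\<lambda>n. Hn n ^ j / sqrt n) \<longlonglongrightarrow> 0" if "j \<le> 11" for j
  proof (rule tendsto_sandwich[OF _ _ tendsto_const H11])
    show "\<forall>\<^sub>F n in sequentially. 0 \<le> Hn n ^ j / sqrt n"
      using H1 by eventually_elim simp
    show "\<forall>\<^sub>F n in sequentially. Hn n ^ j / sqrt n \<le> Hn n ^ 11 / sqrt n"
      using H1 by eventually_elim (use that in \<open>auto intro!: divide_right_mono power_increasing\<close>)
  qed
  have \<eta>_lim: "\<eta> \<longlonglongrightarrow> 0" using pow_lim[of 1] by (simp add: \<eta>_def[abs_def])
  have H\<eta>_lim: "(\<lambda>n. Hn n * \<eta> n) \<longlonglongrightarrow> 0"
    using pow_lim[of 2] by (simp add: \<eta>_def[abs_def] power2_eq_square)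
  have HH\<eta>_lim: "(\<lambda>n. (Hn n)\<^sup>2 * \<eta> n) \<longlonglongrightarrow> 0"
    using pow_lim[of 3] by (simp add: \<eta>_def[abs_def] power2_eq_square power3_eq_cube mult_ac)
  have Heq: "\<forall>\<^sub>F n in sequentially. sqrt (real n) * \<eta> n = Hn n"
    using n0 by eventually_elim (simp add: \<eta>_def)
  have \<eta>_pos: "\<forall>\<^sub>F n in sequentially. 0 < \<eta> n"
    using n0 H1 by eventually_elim (simp add: \<eta>_def)
  have \<eta>_small: "\<forall>\<^sub>F n in sequentially. \<eta> n < \<delta>"
    using order_tendstoD(2)[OF \<eta>_lim C(2)] .
  have \<omega>_lim: "(\<lambda>n. C * \<eta> n) \<longlonglongrightarrow> 0" using tendsto_mult_left[OF \<eta>_lim, of C] by simp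
  have \<omega>_small: "\<forall>\<^sub>F n in sequentially. C * \<eta> n < \<bar>b\<bar>"
    using order_tendstoD(2)[OF \<omega>_lim, of "\<bar>b\<bar>"] \<psi>(3) by simp
  have is_model: "\<forall>\<^sub>F n in sequentially. local_model (\<lambda>\<theta>. \<psi> \<theta> - \<psi> \<theta>\<^sub>0) b (C * \<eta> n) \<theta>\<^sub>0 (\<eta> n)"
    using \<eta>_pos \<eta>_small by eventually_elim (rule model)

  show ?orig
    using is_model n0 k
  proof eventually_elim
    case (elim n)
    then interpret local_model "\<lambda>\<theta>. \<psi> \<theta> - \<psi> \<theta>\<^sub>0" b "C * \<eta> n" \<theta>\<^sub>0 "\<eta> n" by simp
    show ?case
      by (rule orig_excess_eq) (use M pos elim in \<open>auto simp: \<eta>_def\<close>)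
  qed

  \<comment> \<open>\<open>frontier_F_le\<close> and \<open>frontier_F_ge\<close> ask for strict
    inequalities. Any factor above 1 tending to 1 provides them; the radius is multiplied or divided
    by its square root.\<close>
  define s where "s n = 1 + 1 / real n" for n
  have s_lim: "s \<longlonglongrightarrow> 1"
    using tendsto_add[OF tendsto_const[of 1] lim_1_over_n] by (simp add: s_def[abs_def])
  have s_gt: "\<forall>\<^sub>F n in sequentially. 1 < s n"
    using n0 by eventually_elim (simp add: s_def)
  define e1 where "e1 n = real n * (C * \<eta> n)\<^sup>2 * (\<eta> n)\<^sup>2" for n
  define e2 where "e2 n = real n * (C * \<eta> n) * \<eta> n * ((\<bar>b\<bar> + C * \<eta> n) * \<eta> n)" for n
  have e1_lim: "e1 \<longlonglongrightarrow> 0"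
    unfolding e1_def by (rule error1_tendsto[OF \<eta>_lim H\<eta>_lim HH\<eta>_lim Heq])
  have e2_lim: "e2 \<longlonglongrightarrow> 0"
    unfolding e2_def by (rule error2_tendsto[OF \<eta>_lim H\<eta>_lim HH\<eta>_lim Heq])
  define up where "up n = b\<^sup>2 * (\<theta>\<^sub>0 + \<eta> n) + (e1 n + 16 * e2 n) / x\<^sub>0" for n
  have "(\<lambda>n. b\<^sup>2 * (\<theta>\<^sub>0 + \<eta> n) + (e1 n + 16 * e2 n) / x\<^sub>0) \<longlonglongrightarrow> b\<^sup>2 * (\<theta>\<^sub>0 + 0) + (0 + 16 * 0) / x\<^sub>0"
    using pos by (intro tendsto_intros \<eta>_lim e1_lim e2_lim) auto
  then have up_lim: "up \<longlonglongrightarrow> b\<^sup>2 * \<theta>\<^sub>0" by (simp add: up_def[abs_def])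
  define x1 where "x1 n = x\<^sub>0 + \<kappa> * ((\<rho> n)\<^sup>2 / s n)" for n
  have \<rho>_lim': "\<rho> \<longlonglongrightarrow> 0" using \<rho>_lim by (simp add: \<rho>_def[abs_def])
  have "(\<lambda>n. x\<^sub>0 + \<kappa> * ((\<rho> n)\<^sup>2 / s n)) \<longlonglongrightarrow> x\<^sub>0 + \<kappa> * (0\<^sup>2 / 1)"
    by (intro tendsto_intros \<rho>_lim' s_lim) auto
  then have x1_lim: "x1 \<longlonglongrightarrow> x\<^sub>0" by (simp add: x1_def[abs_def])
  define lo where "lo n = ((1 + x\<^sub>0 / x1 n) * ((\<bar>b\<bar> - C * \<eta> n) / (1 / (sqrt n * \<eta> n) + sqrt (1 / (x\<^sub>0 * (\<theta>\<^sub>0 - \<eta> n)))))\<^sup>2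
     - (4 * e2 n + e1 n + b\<^sup>2 * (\<theta>\<^sub>0 + \<eta> n) * x\<^sub>0)) / x1 n" for n
  \<comment> \<open>Here the growth of H enters: relative to sqrt n, the term 1 / \<eta> of the
    Cramer-Rao bound is 1 / H.\<close>
  have invH: "(\<lambda>n. 1 / (sqrt n * \<eta> n)) \<longlonglongrightarrow> 0"
  proof -
    have "(\<lambda>n. inverse (Hn n)) \<longlonglongrightarrow> 0" by (rule tendsto_inverse_0_at_top[OF H])
    moreover have "\<forall>\<^sub>F n in sequentially. inverse (Hn n) = 1 / (sqrt n * \<eta> n)"
      using Heq by eventually_elim (simp add: inverse_eq_divide)
    ultimately show ?thesis by (rule Lim_transform_eventually)
  qed
  \<comment> \<open>Twice \<open>b\<^sup>2 * \<theta>\<^sub>0 * x\<^sub>0\<close> from the doubled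
    lower bound, minus once the same as price, over \<open>x\<^sub>0\<close>: the limit matches that
    of \<open>up\<close>.\<close>
  have "lo \<longlonglongrightarrow> ((1 + x\<^sub>0 / x\<^sub>0) * ((\<bar>b\<bar> - 0) / (0 + sqrt (1 / (x\<^sub>0 * (\<theta>\<^sub>0 - 0)))))\<^sup>2
     - (4 * 0 + 0 + b\<^sup>2 * (\<theta>\<^sub>0 + 0) * x\<^sub>0)) / x\<^sub>0"
    unfolding lo_def using pos
    by (intro tendsto_intros \<eta>_lim e1_lim e2_lim x1_lim invH \<omega>_lim) auto
  also have "((1 + x\<^sub>0 / x\<^sub>0) * ((\<bar>b\<bar> - 0) / (0 + sqrt (1 / (x\<^sub>0 * (\<theta>\<^sub>0 - 0)))))\<^sup>2
     - (4 * 0 + 0 + b\<^sup>2 * (\<theta>\<^sub>0 + 0) * x\<^sub>0)) / x\<^sub>0 = b\<^sup>2 * \<theta>\<^sub>0"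
    using pos by (simp add: power_divide)
  finally have lo_lim: "lo \<longlonglongrightarrow> b\<^sup>2 * \<theta>\<^sub>0" .
  have "(\<lambda>n. x\<^sub>0 + \<kappa> * ((\<rho> n)\<^sup>2 * s n)) \<longlonglongrightarrow> x\<^sub>0 + \<kappa> * (0\<^sup>2 * 1)"
    by (intro tendsto_intros \<rho>_lim' s_lim)
  then have x2: "\<forall>\<^sub>F n in sequentially. x\<^sub>0 + \<kappa> * ((\<rho> n)\<^sup>2 * s n) < 2 * x\<^sub>0"
    using pos by (intro order_tendstoD(2)) auto
  define F where "F n = frontier_F M \<psi> \<theta>\<^sub>0 x\<^sub>0 \<kappa> n (kn n) (Hn n)" for n
  have sandwich: "\<forall>\<^sub>F n in sequentially.
      ereal (\<kappa> * ((\<rho> n)\<^sup>2 / s n) * lo n) \<le> F n \<and> F n \<le> ereal (\<kappa> * ((\<rho> n)\<^sup>2 * s n) * up n)"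
    using is_model n0 k \<rho>_pos s_gt x2 \<omega>_small
  proof eventually_elim
    case (elim n)
    then interpret local_model "\<lambda>\<theta>. \<psi> \<theta> - \<psi> \<theta>\<^sub>0" b "C * \<eta> n" \<theta>\<^sub>0 "\<eta> n" by simp
    have \<rho>n: "0 < \<rho> n" and sn: "1 < s n" using elim by (auto simp: \<rho>_def)
    have e1: "e1 n = real n * (C * \<eta> n)\<^sup>2 * (\<eta> n)\<^sup>2" by (simp add: e1_def)
    have e2: "e2 n = real n * (C * \<eta> n) * \<eta> n * range_bound" by (simp add: e2_def range_bound_def)
    have sq: "1 < sqrt (s n)" "(sqrt (s n))\<^sup>2 = s n" using sn by auto
    have "F n \<le> ereal (excess n x\<^sub>0 (x\<^sub>0 + \<kappa> * (\<rho> n * sqrt (s n))\<^sup>2))"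
      unfolding F_def by (rule frontier_F_le) (use M pos elim \<rho>n sq in \<open>auto simp: \<eta>_def \<rho>_def\<close>)
    also have "(\<rho> n * sqrt (s n))\<^sup>2 = (\<rho> n)\<^sup>2 * s n" by (simp add: power_mult_distrib sq)
    also have "excess n x\<^sub>0 (x\<^sub>0 + \<kappa> * ((\<rho> n)\<^sup>2 * s n)) \<le>
        (x\<^sub>0 + \<kappa> * ((\<rho> n)\<^sup>2 * s n) - x\<^sub>0) * up n"
      unfolding up_def e1 e2 using excess_upper[of n x\<^sub>0 "x\<^sub>0 + \<kappa> * ((\<rho> n)\<^sup>2 * s n)"] elim pos sn by simp
    finally have U: "F n \<le> ereal (\<kappa> * ((\<rho> n)\<^sup>2 * s n) * up n)" by simp
    have x1: "x1 n = x\<^sub>0 + \<kappa> * (\<rho> n / sqrt (s n))\<^sup>2" by (simp add: x1_def power_divide sq)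
    have "(x1 n - x\<^sub>0) * lo n \<le> excess n x\<^sub>0 (x1 n)"
      unfolding lo_def e1 e2 by (rule excess_lower) (use elim pos sn in \<open>auto simp: x1_def\<close>)
    then have "ereal ((x1 n - x\<^sub>0) * lo n) \<le> ereal (excess n x\<^sub>0 (x1 n))" by simp
    also have "\<dots> \<le> F n"
      unfolding F_def x1 by (rule frontier_F_ge)
        (use M pos elim \<rho>n sq in \<open>auto simp: \<eta>_def \<rho>_def divide_less_eq\<close>)
    finally have "ereal ((x1 n - x\<^sub>0) * lo n) \<le> F n" .
    then have L: "ereal (\<kappa> * ((\<rho> n)\<^sup>2 / s n) * lo n) \<le> F n" by (simp add: x1_def)
    from L U show ?case by simp
  qed
  define A where "A n = frontier_A M \<theta>\<^sub>0 x\<^sub>0 \<kappa> b (kn n)" for n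
  have A: "\<forall>\<^sub>F n in sequentially. A n = b\<^sup>2 * \<theta>\<^sub>0 * \<kappa> * (\<rho> n)\<^sup>2"
    using k by eventually_elim (simp add: A_def \<rho>_def frontier_A_eq[OF M] pos)
  \<comment> \<open>\<open>real_of_ereal\<close> loses nothing once \<open>sandwich\<close> makes F
    finite.\<close>
  define \<epsilon> where "\<epsilon> n = real_of_ereal (F n) / A n - 1" for n
  have F_eq: "\<forall>\<^sub>F n in sequentially. F n = ereal (A n * (1 + \<epsilon> n))"
    using sandwich A \<rho>_pos
  proof eventually_elim
    case (elim n)
    then have "\<bar>F n\<bar> \<noteq> \<infinity>" by (cases "F n") auto
    moreover have "A n \<noteq> 0" using elim pos \<psi>(3) by (simp add: \<rho>_def)
    ultimately show ?case by (simp add: \<epsilon>_def ereal_real')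
  qed
  have "(\<lambda>n. 1 + \<epsilon> n) \<longlonglongrightarrow> 1"
  proof (rule tendsto_sandwich)
    have "(\<lambda>n. lo n / s n / (b\<^sup>2 * \<theta>\<^sub>0)) \<longlonglongrightarrow> b\<^sup>2 * \<theta>\<^sub>0 / 1 / (b\<^sup>2 * \<theta>\<^sub>0)"
      using pos \<psi>(3) by (intro tendsto_intros lo_lim s_lim) auto
    then show "(\<lambda>n. lo n / s n / (b\<^sup>2 * \<theta>\<^sub>0)) \<longlonglongrightarrow> 1" using pos \<psi>(3) by simp
    have "(\<lambda>n. s n * up n / (b\<^sup>2 * \<theta>\<^sub>0)) \<longlonglongrightarrow> 1 * (b\<^sup>2 * \<theta>\<^sub>0) / (b\<^sup>2 * \<theta>\<^sub>0)"
      using pos \<psi>(3) by (intro tendsto_intros up_lim s_lim) auto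
    then show "(\<lambda>n. s n * up n / (b\<^sup>2 * \<theta>\<^sub>0)) \<longlonglongrightarrow> 1" using pos \<psi>(3) by simp
    have ratio: "\<forall>\<^sub>F n in sequentially. lo n / s n / (b\<^sup>2 * \<theta>\<^sub>0) \<le> 1 + \<epsilon> n \<and> 1 + \<epsilon> n \<le> s n * up n / (b\<^sup>2 * \<theta>\<^sub>0)"
      using sandwich A \<rho>_pos F_eq
    proof eventually_elim
      case (elim n)
      define m where "m = \<kappa> * (\<rho> n)\<^sup>2"
      have m: "0 < m" using elim pos by (simp add: m_def \<rho>_def)
      have B: "0 < b\<^sup>2 * \<theta>\<^sub>0" using pos \<psi>(3) by simp
      have An: "A n = m * (b\<^sup>2 * \<theta>\<^sub>0)" using elim by (simp add: m_def)
      have "m * (lo n / s n) \<le> A n * (1 + \<epsilon> n)" "A n * (1 + \<epsilon> n) \<le> m * (s n * up n)"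
        using elim by (auto simp: m_def mult_ac)
      then have "m * (lo n / s n) \<le> m * ((1 + \<epsilon> n) * (b\<^sup>2 * \<theta>\<^sub>0))" "m * ((1 + \<epsilon> n) * (b\<^sup>2 * \<theta>\<^sub>0)) \<le> m * (s n * up n)"
        unfolding An by (simp_all add: mult_ac)
      then have "lo n / s n \<le> (1 + \<epsilon> n) * (b\<^sup>2 * \<theta>\<^sub>0)" "(1 + \<epsilon> n) * (b\<^sup>2 * \<theta>\<^sub>0) \<le> s n * up n"
        using m by (simp_all only: mult_le_cancel_left_pos)
      then show ?case using B by (simp only: pos_divide_le_eq pos_le_divide_eq simp_thms)
    qed
    show "\<forall>\<^sub>F n in sequentially. lo n / s n / (b\<^sup>2 * \<theta>\<^sub>0) \<le> 1 + \<epsilon> n"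
      using ratio by eventually_elim simp
    show "\<forall>\<^sub>F n in sequentially. 1 + \<epsilon> n \<le> s n * up n / (b\<^sup>2 * \<theta>\<^sub>0)"
      using ratio by eventually_elim simp
  qed
  from tendsto_diff[OF this tendsto_const[of 1]] have "\<epsilon> \<longlonglongrightarrow> 0" by simp
  with F_eq show ?asymp unfolding F_def A_def by blast
qed

theorem corollary5p3:
  fixes M :: "'a::metric_space set" and r \<theta>\<^sub>0 x\<^sub>0 \<kappa> b :: real and \<psi> :: "real \<Rightarrow> real"
  assumes "M \<noteq> {}" and "compact M" and "geodesic_space M"
    and "r > 0" and "ahlfors_regular M r"
    and "\<theta>\<^sub>0 > 0" and "x\<^sub>0 \<ge> 1" and "\<kappa> > 0"
    and "C2_near \<psi> \<theta>\<^sub>0" and "b = deriv \<psi> \<theta>\<^sub>0" and "b \<noteq> 0"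
  shows "(\<forall>k\<ge>1. frontier_A M \<theta>\<^sub>0 x\<^sub>0 \<kappa> b k = b\<^sup>2 * \<theta>\<^sub>0 * \<kappa> * (covering_radius M k)\<^sup>2) \<and>
    (\<exists>c C :: real. 0 < c \<and> 0 < C \<and>
       (\<forall>k\<ge>1. c * real k powr (-2 / r) \<le> frontier_A M \<theta>\<^sub>0 x\<^sub>0 \<kappa> b k \<and>
               frontier_A M \<theta>\<^sub>0 x\<^sub>0 \<kappa> b k \<le> C * real k powr (-2 / r))) \<and>
    (\<forall>(kn :: nat \<Rightarrow> nat) (Hn :: nat \<Rightarrow> real).
       filterlim kn at_top sequentially \<longrightarrow>
       filterlim Hn at_top sequentially \<longrightarrow>
       (\<lambda>n. Hn n ^ 11 / sqrt (real n)) \<longlonglongrightarrow> 0 \<longrightarrow>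
       (\<lambda>n. Hn n ^ 10 * frontier_A M \<theta>\<^sub>0 x\<^sub>0 \<kappa> b (kn n)) \<longlonglongrightarrow> 0 \<longrightarrow>
       (\<exists>\<epsilon> :: nat \<Rightarrow> real. \<epsilon> \<longlonglongrightarrow> 0 \<and>
          (\<forall>\<^sub>F n in sequentially. frontier_F M \<psi> \<theta>\<^sub>0 x\<^sub>0 \<kappa> n (kn n) (Hn n) =
             ereal (frontier_A M \<theta>\<^sub>0 x\<^sub>0 \<kappa> b (kn n) * (1 + \<epsilon> n)))) \<and>
       (\<forall>\<^sub>F n in sequentially. orig_excess M \<psi> \<theta>\<^sub>0 x\<^sub>0 \<kappa> n (kn n) (Hn n) =
          ereal (1 / real n) * frontier_F M \<psi> \<theta>\<^sub>0 x\<^sub>0 \<kappa> n (kn n) (Hn n)) \<and>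
       (\<lambda>n. 1 / real n * real_of_ereal (frontier_F M \<psi> \<theta>\<^sub>0 x\<^sub>0 \<kappa> n (kn n) (Hn n)))
          \<in> \<Theta>(\<lambda>n. 1 / real n * real (kn n) powr (-2 / r)))"
proof (intro conjI allI impI)
  note M = assms(1,2)
  have x0: "0 < x\<^sub>0" using assms(7) by simp
  show "frontier_A M \<theta>\<^sub>0 x\<^sub>0 \<kappa> b k = b\<^sup>2 * \<theta>\<^sub>0 * \<kappa> * (covering_radius M k)\<^sup>2" if "1 \<le> k" for k
    by (rule frontier_A_eq[OF M that assms(6,8)])
  show rate: "\<exists>c C :: real. 0 < c \<and> 0 < C \<and>
       (\<forall>k\<ge>1. c * real k powr (-2 / r) \<le> frontier_A M \<theta>\<^sub>0 x\<^sub>0 \<kappa> b k \<and>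
               frontier_A M \<theta>\<^sub>0 x\<^sub>0 \<kappa> b k \<le> C * real k powr (-2 / r))"
    by (rule frontier_A_rate[OF M assms(4,5,6,8,11)])
  fix kn :: "nat \<Rightarrow> nat" and Hn :: "nat \<Rightarrow> real"
  assume kn: "filterlim kn at_top sequentially" and Hn: "filterlim Hn at_top sequentially"
    and H11: "(\<lambda>n. Hn n ^ 11 / sqrt (real n)) \<longlonglongrightarrow> 0"
  have k1: "\<forall>\<^sub>F n in sequentially. 1 \<le> kn n"
    using kn by (simp add: filterlim_at_top)
  obtain a a' where a: "0 < a" "\<And>k. k \<ge> 1 \<Longrightarrow> a * real k powr (- 1 / r) \<le> covering_radius M k"
      "\<And>k. k \<ge> 1 \<Longrightarrow> covering_radius M k \<le> a' * real k powr (- 1 / r)"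
    using covering_radius_rate[OF M assms(4,5)] by blast
  have \<rho>_pos: "\<forall>\<^sub>F n in sequentially. 0 < covering_radius M (kn n)"
    using k1
  proof eventually_elim
    case (elim n)
    have "0 < a * real (kn n) powr (- 1 / r)" using a(1) elim by simp
    with a(2)[OF elim] show ?case by linarith
  qed
  have \<rho>_lim: "(\<lambda>n. covering_radius M (kn n)) \<longlonglongrightarrow> 0"
  proof (rule tendsto_sandwich[OF _ _ tendsto_const])
    have "filterlim (\<lambda>n. real (kn n)) at_top sequentially"
      by (rule filterlim_compose[OF filterlim_real_sequentially kn])
    then have "(\<lambda>n. real (kn n) powr (- 1 / r)) \<longlonglongrightarrow> 0"
      using assms(4) by (intro tendsto_neg_powr) auto
    then show "(\<lambda>n. a' * real (kn n) powr (- 1 / r)) \<longlonglongrightarrow> 0"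
      using tendsto_mult_right_zero by blast
    show "\<forall>\<^sub>F n in sequentially. covering_radius M (kn n) \<le> a' * real (kn n) powr (- 1 / r)"
      using k1 by eventually_elim (rule a(3))
    show "\<forall>\<^sub>F n in sequentially. 0 \<le> covering_radius M (kn n)"
      using \<rho>_pos by eventually_elim simp
  qed
  note asymptotics = frontier_asymptotics[OF M assms(6) x0 assms(8,9,10,11) k1 \<rho>_pos \<rho>_lim Hn H11]
  show "\<exists>\<epsilon> :: nat \<Rightarrow> real. \<epsilon> \<longlonglongrightarrow> 0 \<and>
          (\<forall>\<^sub>F n in sequentially. frontier_F M \<psi> \<theta>\<^sub>0 x\<^sub>0 \<kappa> n (kn n) (Hn n) =
             ereal (frontier_A M \<theta>\<^sub>0 x\<^sub>0 \<kappa> b (kn n) * (1 + \<epsilon> n)))"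
    by (rule asymptotics(2))
  then obtain \<epsilon> where \<epsilon>: "\<epsilon> \<longlonglongrightarrow> 0" and F_eq: "\<forall>\<^sub>F n in sequentially. frontier_F M \<psi> \<theta>\<^sub>0 x\<^sub>0 \<kappa> n (kn n) (Hn n) =
      ereal (frontier_A M \<theta>\<^sub>0 x\<^sub>0 \<kappa> b (kn n) * (1 + \<epsilon> n))" by blast
  show "\<forall>\<^sub>F n in sequentially. orig_excess M \<psi> \<theta>\<^sub>0 x\<^sub>0 \<kappa> n (kn n) (Hn n) =
          ereal (1 / real n) * frontier_F M \<psi> \<theta>\<^sub>0 x\<^sub>0 \<kappa> n (kn n) (Hn n)"
    by (rule asymptotics(1))
  obtain c C where c: "0 < c" "0 < C"
    and A_rate: "\<And>k. 1 \<le> k \<Longrightarrow> c * real k powr (-2 / r) \<le> frontier_A M \<theta>\<^sub>0 x\<^sub>0 \<kappa> b k"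
      "\<And>k. 1 \<le> k \<Longrightarrow> frontier_A M \<theta>\<^sub>0 x\<^sub>0 \<kappa> b k \<le> C * real k powr (-2 / r)"
    using rate by blast
  \<comment> \<open>This keeps 1 + \<epsilon> between 1/2 and 2, whence the constants c / 2 and 2
    C.\<close>
  have \<epsilon>_bounds: "\<forall>\<^sub>F n in sequentially. -1/2 < \<epsilon> n \<and> \<epsilon> n < 1"
    using order_tendstoD(1)[OF \<epsilon>, of "-1/2"] order_tendstoD(2)[OF \<epsilon>, of 1] by (simp add: eventually_conj)
  have bounds: "\<forall>\<^sub>F n in sequentially.
      c / 2 * (1 / real n * real (kn n) powr (-2 / r)) \<le> 1 / real n * real_of_ereal (frontier_F M \<psi> \<theta>\<^sub>0 x\<^sub>0 \<kappa> n (kn n) (Hn n)) \<and>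
      1 / real n * real_of_ereal (frontier_F M \<psi> \<theta>\<^sub>0 x\<^sub>0 \<kappa> n (kn n) (Hn n)) \<le> 2 * C * (1 / real n * real (kn n) powr (-2 / r))"
    using F_eq \<epsilon>_bounds k1
  proof eventually_elim
    case (elim n)
    let ?A = "frontier_A M \<theta>\<^sub>0 x\<^sub>0 \<kappa> b (kn n)" and ?p = "real (kn n) powr (-2 / r)"
    have A0: "0 \<le> ?A" using A_rate(1)[OF elim(3)] c by (meson mult_nonneg_nonneg order_trans less_imp_le powr_ge_zero)
    have "?A * (1/2) \<le> ?A * (1 + \<epsilon> n)" "?A * (1 + \<epsilon> n) \<le> ?A * 2"
      by (intro mult_left_mono; use elim A0 in simp)+
    with A_rate[OF elim(3)] have "c / 2 * ?p \<le> ?A * (1 + \<epsilon> n)" "?A * (1 + \<epsilon> n) \<le> 2 * C * ?p"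
      by auto
    then have "1 / real n * (c / 2 * ?p) \<le> 1 / real n * (?A * (1 + \<epsilon> n))"
      "1 / real n * (?A * (1 + \<epsilon> n)) \<le> 1 / real n * (2 * C * ?p)"
      by (intro mult_left_mono; simp)+
    then show ?case using elim(1) by (simp add: mult_ac)
  qed
  define f where "f n = 1 / real n * real_of_ereal (frontier_F M \<psi> \<theta>\<^sub>0 x\<^sub>0 \<kappa> n (kn n) (Hn n))" for n
  define g where "g n = 1 / real n * real (kn n) powr (-2 / r)" for n
  have fg: "\<forall>\<^sub>F n in sequentially. norm (f n) \<le> 2 * C * norm (g n) \<and> c / 2 * norm (g n) \<le> norm (f n)"
    using bounds
  proof eventually_elim
    case (elim n)
    then have fg: "c / 2 * g n \<le> f n" "f n \<le> 2 * C * g n" by (simp_all only: f_def g_def)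
    have g: "0 \<le> g n" by (simp add: g_def)
    then have "0 \<le> c / 2 * g n" using c by simp
    then have "0 \<le> f n" using fg by linarith
    with fg g show ?case by simp
  qed
  have "f \<in> \<Theta>(g)"
  proof (rule bigthetaI)
    show "f \<in> O(g)"
      by (rule bigoI[where c = "2 * C"]) (use fg in eventually_elim, simp)
    show "f \<in> \<Omega>(g)"
      by (rule landau_omega.bigI[where c = "c / 2"]) (use c in simp, use fg in eventually_elim, simp)
  qed
  then show "(\<lambda>n. 1 / real n * real_of_ereal (frontier_F M \<psi> \<theta>\<^sub>0 x\<^sub>0 \<kappa> n (kn n) (Hn n)))
          \<in> \<Theta>(\<lambda>n. 1 / real n * real (kn n) powr (-2 / r))"
    unfolding f_def[abs_def] g_def[abs_def] .
qed

end
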